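(* Let $n\ge3$, let $r$ and $s$ be positive integers, and let $1\le p\le\infty$. Then the sequence of operators $\{\oplus^rJ_{k,s}\}_{k=1}^{\infty}$ is saturated on $L^p(\mathbb S^{n-1})$ with order $k^{-2r}$, and the collection of constant functions is its invariant class.
   Context: $\mathbb S^{n-1}$ is the unit sphere of $\mathbb R^n$ with surface measure $d\omega$, $|\mathbb S^{n-1}|$ is its total measure, and $L^p(\mathbb S^{n-1})$ carries the usual norm $\|\cdot\|_p$ ($1\le p<\infty$: $\|f\|_p=(\int|f|^p d\omega)^{1/p}$; $p=\infty$: essential supremum). Put $\lambda=\frac{n-2}{2}$. Jackson operators: for positive integers $k,s$, let $$\mathscr D_{k,s}(\theta)=A_{k,s}^{-1}\left(\frac{\sin\frac{k\theta}{2}}{\sin\frac{\theta}{2}}\right)^{2s},$$ where the constant $A_{k,s}^{-1}$ is chosen so that $\int_0^\pi\mathscr D_{k,s}(\theta)\sin^{2\lambda}\theta\,d\theta=1$, and $$J_{k,s}(f)(x)=\frac1{|\mathbb S^{n-2}|}\int_{\mathbb S^{n-1}}f(y)\,\mathscr D_{k,s}(\arccos x\cdot y)\,d\omega(y).$$ The $r$-th Boolean sum of the Jackson operator is $\oplus^rJ_{k,s}=I-(I-J_{k,s})^r$, where $I$ is the identity operator. Saturation: let $\varphi(\rho)$ be a positive function of $\rho>0$ tending monotonically to $0$ as $\rho\to\infty$. A family of operators $\{I_\rho\}_{\rho>0}$ on $L^p(\mathbb S^{n-1})$ (here indexed by $\rho=k=1,2,\dots$, with $\varphi(k)=k^{-2r}$)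 is saturated on $L^p(\mathbb S^{n-1})$ with order $O(\varphi(\rho))$ if there exists $\mathcal K\subseteq L^p(\mathbb S^{n-1})$ (the saturation class) such that (i) if $\|I_\rho(f)-f\|_p=o(\varphi(\rho))$ as $\rho\to\infty$, then $I_\rho(f)=f$ (for all $\rho$); and (ii) $\|I_\rho(f)-f\|_p=O(\varphi(\rho))$ as $\rho\to\infty$ if and only if $f\in\mathcal K$. The invariant class is the set of $f\in L^p(\mathbb S^{n-1})$ with $I_\rho(f)=f$ for all $\rho$, that is, the functions $f$ occurring in (i). *)

theory Defs
  imports "HOL-Analysis.Analysis" "HOL-Probability.Essential_Supremum"
    "HOL-Library.Landau_Symbols"
begin

section \<open>Surface measure on the unit sphere\<close>

text \<open>
  By polar coordinates, the surface measure of a Borel set \<open>A\<close> of the unit sphere of an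
  \<open>n\<close>-dimensional space is \<open>n\<close> times the volume of the cone \<open>{t *\<^sub>R x | 0 < t \<le> 1, x \<in> A}\<close>.
  Equivalently, it is \<open>n\<close> times the image of Lebesgue measure on the punctured unit ball under
  the radial projection; the lemma \<open>emeasure_sphere_measure\<close> gives back the cone formula.
\<close>

definition sphere_measure :: "'a::euclidean_space measure" where
  "sphere_measure =
     scale_measure (of_nat DIM('a))
       (distr (restrict_space lborel (cball 0 1 - {0})) (restrict_space borel (sphere 0 1))
         (\<lambda>x. x /\<^sub>R norm x))"

lemma space_sphere_measure [simp]: "space (sphere_measure :: 'a::euclidean_space measure) = sphere 0 1"
  by (simp add: sphere_measure_def space_scale_measure space_restrict_space)

lemma sets_sphere_measure [simp]:
  "sets (sphere_measure :: 'a::euclidean_space measure) = sets (restrict_space borel (sphere 0 1))"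
  by (simp add: sphere_measure_def)

lemma radial_projection_measurable:
  "(\<lambda>x. x /\<^sub>R norm x) \<in> restrict_space lborel (cball 0 1 - {0 :: 'a::euclidean_space})
     \<rightarrow>\<^sub>M restrict_space borel (sphere 0 1)"
proof (rule measurable_restrict_space2)
  show "(\<lambda>x. x /\<^sub>R norm x) \<in> space (restrict_space lborel (cball 0 1 - {0 :: 'a})) \<rightarrow> sphere 0 1"
    by (auto simp: space_restrict_space)
  have "(\<lambda>x::'a. x /\<^sub>R norm x) \<in> borel_measurable lborel"
    by measurable
  then show "(\<lambda>x. x /\<^sub>R norm x) \<in> restrict_space lborel (cball 0 1 - {0 :: 'a}) \<rightarrow>\<^sub>M borel"
    by (rule measurable_restrict_space1)
qed

lemma emeasure_sphere_measure:
  fixes A :: "'a::euclidean_space set"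
  assumes "A \<in> sets borel" "A \<subseteq> sphere 0 1"
  shows "emeasure sphere_measure A =
           of_nat DIM('a) * emeasure lborel {t *\<^sub>R x | t x. 0 < t \<and> t \<le> 1 \<and> x \<in> A}"
proof -
  let ?S = "restrict_space lborel (cball 0 1 - {0 :: 'a})"
  have A: "A \<in> sets (restrict_space borel (sphere 0 1))"
    using assms by (simp add: sets_restrict_space_iff)
  have eq: "(\<lambda>x. x /\<^sub>R norm x) -` A \<inter> space ?S = {t *\<^sub>R x | t x. 0 < t \<and> t \<le> 1 \<and> x \<in> A}"
    (is "?L = ?R")
  proof
    show "?L \<subseteq> ?R"
    proof
      fix y assume y: "y \<in> ?L"
      then have "y = norm y *\<^sub>R (y /\<^sub>R norm y)" "0 < norm y" "norm y \<le> 1" "y /\<^sub>R norm y \<in> A"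
        by (auto simp: space_restrict_space)
      then show "y \<in> ?R" by blast
    qed
    show "?R \<subseteq> ?L"
      using assms(2) by (auto simp: space_restrict_space subset_iff)
  qed
  show ?thesis
    using A unfolding sphere_measure_def
    by (simp add: emeasure_distr[OF radial_projection_measurable A] eq[symmetric]
        emeasure_restrict_space space_restrict_space Int_commute)
qed

text \<open>
  \<open>sphere_area m\<close> is the total measure of the unit sphere of \<open>m\<close>-dimensional space; as the
  dimension of a type cannot be decremented, it is needed as a function of the number \<open>m\<close>.
\<close>

definition sphere_area :: "nat \<Rightarrow> real" where
  "sphere_area m = real m * unit_ball_vol (real m)"

lemma sphere_area_eq_measure:
  "measure sphere_measure (sphere (0 :: 'a::euclidean_space) 1) = sphere_area DIM('a)"
proof -
  have "{t *\<^sub>R x | t x. 0 < t \<and> t \<le> 1 \<and> x \<in> sphere (0::'a) 1} = cball 0 1 - {0}" (is "?L = ?R")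
  proof
    show "?R \<subseteq> ?L"
    proof
      fix y :: 'a assume y: "y \<in> ?R"
      then have "y = norm y *\<^sub>R (y /\<^sub>R norm y)" "0 < norm y" "norm y \<le> 1" "y /\<^sub>R norm y \<in> sphere 0 1"
        by auto
      then show "y \<in> ?L" by blast
    qed
  qed auto
  moreover have "emeasure lborel (cball (0::'a) 1 - {0}) = ennreal (unit_ball_vol (real DIM('a)))"
    by (subst emeasure_Diff) (auto simp: emeasure_cball)
  ultimately show ?thesis
    by (simp add: measure_def emeasure_sphere_measure sphere_area_def enn2real_mult)
qed


section \<open>Lebesgue spaces\<close>

text \<open>
  Elements of \<open>L\<^sup>p\<close> are represented by functions, so that equality in \<open>L\<^sup>p\<close> is equality
  almost everywhere.
\<close>

definition Lp :: "'a measure \<Rightarrow> ennreal \<Rightarrow> ('a \<Rightarrow> real) set" where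
  "Lp M p = {f \<in> borel_measurable M.
     if p = \<infinity> then esssup M (\<lambda>x. ennreal \<bar>f x\<bar>) < \<infinity>
     else integrable M (\<lambda>x. \<bar>f x\<bar> powr enn2real p)}"

definition Lp_norm :: "'a measure \<Rightarrow> ennreal \<Rightarrow> ('a \<Rightarrow> real) \<Rightarrow> real" where
  "Lp_norm M p f =
     (if p = \<infinity> then enn2real (esssup M (\<lambda>x. ennreal \<bar>f x\<bar>))
      else (LINT x|M. \<bar>f x\<bar> powr enn2real p) powr (1 / enn2real p))"


section \<open>Saturation\<close>

text \<open>
  The sequences are indexed by \<open>k = 1, 2, \<dots>\<close>; the values at \<open>k = 0\<close> are irrelevant.
\<close>

definition operator_on_Lp :: "'a measure \<Rightarrow> ennreal \<Rightarrow> (('a \<Rightarrow> real) \<Rightarrow> 'a \<Rightarrow> real) \<Rightarrow> bool" where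
  "operator_on_Lp M p T \<longleftrightarrow>
     (\<forall>f\<in>Lp M p. T f \<in> Lp M p) \<and>
     (\<forall>f\<in>Lp M p. \<forall>g\<in>Lp M p. (AE x in M. f x = g x) \<longrightarrow> (AE x in M. T f x = T g x))"

definition invariant_class ::
    "'a measure \<Rightarrow> ennreal \<Rightarrow> (nat \<Rightarrow> ('a \<Rightarrow> real) \<Rightarrow> 'a \<Rightarrow> real) \<Rightarrow> ('a \<Rightarrow> real) set" where
  "invariant_class M p T = {f \<in> Lp M p. \<forall>k\<ge>1. AE x in M. T k f x = f x}"

definition saturated ::
    "'a measure \<Rightarrow> ennreal \<Rightarrow> (nat \<Rightarrow> ('a \<Rightarrow> real) \<Rightarrow> 'a \<Rightarrow> real) \<Rightarrow> (nat \<Rightarrow> real) \<Rightarrow> bool" where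
  "saturated M p T \<phi> \<longleftrightarrow>
     (\<forall>k\<ge>1. operator_on_Lp M p (T k)) \<and>
     (\<forall>k\<ge>1. 0 < \<phi> k) \<and> antimono_on {1..} \<phi> \<and> \<phi> \<longlonglongrightarrow> 0 \<and>
     (\<exists>K \<subseteq> Lp M p.
        (\<forall>f\<in>Lp M p. (\<lambda>k. Lp_norm M p (\<lambda>x. T k f x - f x)) \<in> o(\<phi>) \<longrightarrow>
           (\<forall>k\<ge>1. AE x in M. T k f x = f x)) \<and>
        (\<forall>f\<in>Lp M p. (\<lambda>k. Lp_norm M p (\<lambda>x. T k f x - f x)) \<in> O(\<phi>) \<longleftrightarrow> f \<in> K))"


section \<open>Jackson operators\<close>

text \<open>
  \<open>n\<close> is the dimension of the ambient space and \<open>lam n\<close> is the parameter usually called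
  \<open>\<lambda>\<close>. At \<open>\<theta> = 0\<close> the quotient of sines is \<open>0\<close> by the convention on division rather than its
  limit \<open>k\<close>; this affects the integrals below only on a null set.
\<close>

definition lam :: "nat \<Rightarrow> real" where
  "lam n = (real n - 2) / 2"

definition jackson_const :: "nat \<Rightarrow> nat \<Rightarrow> nat \<Rightarrow> real" where
  "jackson_const n k s =
     (LINT \<theta>:{0..pi}|lborel. (sin (real k * \<theta> / 2) / sin (\<theta> / 2)) ^ (2 * s) * sin \<theta> powr (2 * lam n))"

definition jackson_kernel :: "nat \<Rightarrow> nat \<Rightarrow> nat \<Rightarrow> real \<Rightarrow> real" where
  "jackson_kernel n k s \<theta> =
     inverse (jackson_const n k s) * (sin (real k * \<theta> / 2) / sin (\<theta> / 2)) ^ (2 * s)"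

definition jackson :: "nat \<Rightarrow> nat \<Rightarrow> ('a::euclidean_space \<Rightarrow> real) \<Rightarrow> 'a \<Rightarrow> real" where
  "jackson k s f x =
     1 / sphere_area (DIM('a) - 1) *
     (LINT y|sphere_measure. f y * jackson_kernel DIM('a) k s (arccos (x \<bullet> y)))"

text \<open>\<open>boolean_sum r T\<close> is \<open>I - (I - T)\<^sup>r\<close>.\<close>

definition boolean_sum :: "nat \<Rightarrow> (('a \<Rightarrow> real) \<Rightarrow> 'a \<Rightarrow> real) \<Rightarrow> ('a \<Rightarrow> real) \<Rightarrow> 'a \<Rightarrow> real" where
  "boolean_sum r T f = (\<lambda>x. f x - ((\<lambda>g y. g y - T g y) ^^ r) f x)"

end

theory Submission
  imports Defs
begin

text \<open>
  Write \<open>J\<close> for the Jackson operator with parameters \<open>k\<close>, \<open>s\<close>. The \<open>r\<close>-th Boolean sum differs from the identity by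
  \<open>- (I - J) ^ r\<close>, and functions in \<open>L\<^sup>p\<close> are integrable. So everything follows from one statement: if the \<open>L\<^sup>1\<close> norm of
  \<open>(I - J) ^ r f\<close> is \<open>o (k ^ (- 2 * r))\<close>, then \<open>f\<close> is constant (\<open>constant_if_residual_small\<close>). Conversely constants are reproduced,
  as the kernel has mass one by the integral formula for zonal functions (\<open>integral_zonal\<close>).

  Instead of expanding in spherical harmonics and estimating the multiplier of each degree, the proof uses a spectral gap for
  functions that are odd under a reflection. Operators whose kernel depends on \<open>x \<bullet> y\<close> only are symmetric, commute with each
  other and commute with reflections. Convolve \<open>f\<close> with the bounded kernel \<open>exp (\<tau> * t)\<close> to obtain \<open>F\<close>, and let
  \<open>h = F - F \<circ> R\<close> for a reflection \<open>R\<close>. Then \<open>(I - J) ^ r h\<close> is bounded by a multiple of the \<open>L\<^sup>1\<close> norm of \<open>(I - J) ^ r f\<close>, hence is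
  uniformly \<open>o (k ^ (- 2 * r))\<close>. On the other hand \<open>\<parallel>(I - J) h\<parallel> \<ge> (c / k\<^sup>2) * \<parallel>h\<parallel>\<close> in \<open>L\<^sup>2\<close> for large \<open>k\<close> and all bounded odd \<open>h\<close>
  (\<open>jackson_gap\<close>), and iterating this (\<open>residual_odd_bound\<close>) forces \<open>h = 0\<close>. So \<open>F\<close> is invariant under all reflections,
  which act transitively: it is constant, for every \<open>\<tau>\<close>. Then \<open>f\<close> minus its mean annihilates all exponentials \<open>exp (u \<bullet> y)\<close>, which span
  a dense algebra by the theorem of Stone and Weierstrass, and is zero (\<open>constant_if_reflection_invariant\<close>).

  The gap is a lower bound for the Dirichlet form \<open>\<integral>\<integral> (h x - h y)\<^sup>2 * D (x \<bullet> y)\<close>, which is monotone in the kernel \<open>D\<close>. If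
  \<open>n \<le> 2 * s\<close>, the Jackson kernel dominates a multiple of the indicator of a cap of radius \<open>1 / k\<close>. For kernels increasing in
  \<open>x \<bullet> y\<close> the odd linear function is positive on a half-sphere and an eigenfunction, so it realises the gap among odd functions
  (\<open>zonal_form_odd_le\<close>), and its eigenvalue is explicit. If \<open>2 * s < n\<close>, the normalising constant grows at most like \<open>k\<^sup>2\<close> and the kernel
  is bounded below by a multiple of its reciprocal on more than half of the sphere, which gives a gap
  for all functions of mean zero (\<open>dirichlet_mean_zero\<close>). For small \<open>s\<close> the gap may be much larger than \<open>k ^ (- 2)\<close>;
  only the lower bound matters.
\<close>

section \<open>Invariance of the surface measure under orthogonal maps\<close>

text \<open>
  Haar's uniqueness argument: the image \<open>N\<close> of Lebesgue measure under \<open>f\<close> is translation invariant,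
  and for two translation invariant measures Fubini's theorem gives
  \<open>lborel A * N B = N A * lborel B\<close> whenever \<open>B = - B\<close>. For \<open>B\<close> the unit ball, which \<open>f\<close> preserves,
  the two measures agree on \<open>B\<close>, hence everywhere.
\<close>

lemma lborel_distr_orthogonal:
  fixes f :: "'a::euclidean_space \<Rightarrow> 'a"
  assumes f: "orthogonal_transformation f"
  shows "distr lborel borel f = lborel"
proof (rule measure_eqI)
  fix A :: "'a set" assume "A \<in> sets (distr lborel borel f)"
  then have A [measurable]: "A \<in> sets borel" by simp
  define N where "N = distr lborel borel f"
  define B where "B = cball (0::'a) 1"
  have B [measurable]: "B \<in> sets borel" by (simp add: B_def)
  have sN [measurable_cong]: "sets N = sets borel" by (simp add: N_def)
  have lf: "linear f" using f by (simp add: orthogonal_transformation_linear)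
  have [measurable]: "f \<in> borel_measurable borel"
    using lf by (intro borel_measurable_continuous_onI linear_continuous_on linear_linear[THEN iffD2])
      (simp add: linear_conv_bounded_linear)
  obtain g where g: "orthogonal_transformation g" "\<And>x. f (g x) = x" "\<And>x. g (f x) = x"
    using f orthogonal_transformation_bij[OF f]
    by (metis bij_inv_eq_iff orthogonal_transformation_inv)
  have lg: "linear g" using g by (simp add: orthogonal_transformation_linear)
  have [measurable]: "g \<in> borel_measurable borel"
    using lg by (intro borel_measurable_continuous_onI linear_continuous_on)
      (simp add: linear_conv_bounded_linear)
  have transl: "(\<integral>\<^sup>+y. h (c + y) \<partial>lborel) = (\<integral>\<^sup>+y. h y \<partial>lborel)"
    if [measurable]: "h \<in> borel_measurable borel" for h :: "'a \<Rightarrow> ennreal" and c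
  proof -
    have "(\<integral>\<^sup>+y. h y \<partial>lborel) = (\<integral>\<^sup>+y. h y \<partial>distr lborel borel ((+) c))"
      by (simp add: lborel_distr_plus)
    also have "\<dots> = (\<integral>\<^sup>+y. h (c + y) \<partial>lborel)"
      by (subst nn_integral_distr) auto
    finally show ?thesis by simp
  qed
  have translN: "(\<integral>\<^sup>+y. h (y - c) \<partial>N) = (\<integral>\<^sup>+y. h y \<partial>N)"
    if [measurable]: "h \<in> borel_measurable borel" for h :: "'a \<Rightarrow> ennreal" and c
  proof -
    have "(\<integral>\<^sup>+y. h (y - c) \<partial>N) = (\<integral>\<^sup>+y. h (f y - c) \<partial>lborel)"
      unfolding N_def by (subst nn_integral_distr) auto
    also have "\<dots> = (\<integral>\<^sup>+y. h (f (- g c + y)) \<partial>lborel)"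
      by (simp add: linear_diff[OF lf] g)
    also have "\<dots> = (\<integral>\<^sup>+y. h (f y) \<partial>lborel)"
      by (rule transl[of "\<lambda>y. h (f y)"]) simp
    also have "\<dots> = (\<integral>\<^sup>+y. h y \<partial>N)"
      unfolding N_def by (subst nn_integral_distr) auto
    finally show ?thesis .
  qed
  have "sigma_finite_measure N"
  proof
    let ?C = "range (\<lambda>n. cball (0::'a) (real n))"
    have "emeasure N a \<noteq> \<infinity>" if "a \<in> ?C" for a
    proof -
      from that obtain n :: nat where a: "a = cball 0 n" by auto
      have "f -` cball 0 n = cball 0 n"
        using orthogonal_transformation_norm[OF f] by (auto simp: dist_norm)
      then show ?thesis
        unfolding N_def a by (simp add: emeasure_distr emeasure_cball)
    qed
    moreover have "\<Union>?C = space N"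
      by (auto simp: N_def dist_norm intro: real_arch_simple)
    ultimately show "\<exists>A. countable A \<and> A \<subseteq> sets N \<and> \<Union>A = space N \<and> (\<forall>a\<in>A. emeasure N a \<noteq> \<infinity>)"
      by (intro exI[of _ ?C]) (auto simp: sN)
  qed
  then interpret N: sigma_finite_measure N .
  interpret P: pair_sigma_finite lborel N
    by standard
  have NB: "emeasure N B = emeasure lborel B"
  proof -
    have "f -` B = B"
      using orthogonal_transformation_norm[OF f] by (auto simp: dist_norm B_def)
    then show ?thesis
      unfolding N_def by (simp add: emeasure_distr)
  qed
  \<comment> \<open>Translate \<open>A\<close> by \<open>y\<close>, exchange the integrals, then translate back under \<open>N\<close>.\<close>
  have "emeasure lborel A * emeasure N B = (\<integral>\<^sup>+y. (\<integral>\<^sup>+x. indicator A x * indicator B y \<partial>lborel) \<partial>N)"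
    by (simp add: nn_integral_multc nn_integral_cmult sN)
  also have "\<dots> = (\<integral>\<^sup>+y. (\<integral>\<^sup>+x. indicator A (y + x) * indicator B y \<partial>lborel) \<partial>N)"
    by (intro nn_integral_cong transl[symmetric]) auto
  also have "\<dots> = (\<integral>\<^sup>+x. (\<integral>\<^sup>+y. indicator A (y + x) * indicator B y \<partial>N) \<partial>lborel)"
    by (rule P.Fubini') measurable
  also have "\<dots> = (\<integral>\<^sup>+x. (\<integral>\<^sup>+y. indicator A (y - x + x) * indicator B (y - x) \<partial>N) \<partial>lborel)"
    by (intro nn_integral_cong translN[symmetric]) auto
  also have "\<dots> = (\<integral>\<^sup>+x. (\<integral>\<^sup>+y. indicator A y * indicator B (y - x) \<partial>N) \<partial>lborel)"
    by simp
  also have "\<dots> = (\<integral>\<^sup>+y. (\<integral>\<^sup>+x. indicator A y * indicator B (y - x) \<partial>lborel) \<partial>N)"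
    by (rule P.Fubini'[symmetric]) measurable
  also have "\<dots> = (\<integral>\<^sup>+y. (\<integral>\<^sup>+x. indicator A y * indicator B (- y + x) \<partial>lborel) \<partial>N)"
  proof (intro nn_integral_cong arg_cong2[where f = "(*)"] refl)
    show "indicator B (y - x) = (indicator B (- y + x) :: ennreal)" for x y
      by (simp add: B_def indicator_def dist_norm norm_minus_commute)
  qed
  also have "\<dots> = (\<integral>\<^sup>+y. (\<integral>\<^sup>+x. indicator A y * indicator B x \<partial>lborel) \<partial>N)"
    by (intro nn_integral_cong transl[of "\<lambda>x. indicator A y * indicator B x" for y]) auto
  also have "\<dots> = emeasure N A * emeasure lborel B"
    by (simp add: nn_integral_multc nn_integral_cmult sN)
  finally have "emeasure lborel A * emeasure lborel B = emeasure N A * emeasure lborel B"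
    by (simp add: NB)
  moreover have "emeasure lborel B \<noteq> 0" "emeasure lborel B \<noteq> \<infinity>"
    using unit_ball_vol_pos[of "real DIM('a)"] by (auto simp: B_def emeasure_cball simp del: unit_ball_vol_pos)
  ultimately have "emeasure lborel A = emeasure N A"
    using ennreal_mult_cancel_left[of "emeasure lborel B" "emeasure lborel A" "emeasure N A"]
    by (simp add: mult.commute)
  then show "emeasure (distr lborel borel f) A = emeasure lborel A"
    by (simp add: N_def)
qed simp


abbreviation sph :: "'a::euclidean_space measure" where "sph \<equiv> sphere_measure"

lemma finite_measure_sphere: "finite_measure (sph :: 'a::euclidean_space measure)"
proof
  have "emeasure (sph :: 'a measure) (sphere 0 1) \<le>
      of_nat DIM('a) * emeasure lborel (cball (0::'a) 1)"
    by (subst emeasure_sphere_measure) (auto intro!: mult_left_mono emeasure_mono)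
  also have "\<dots> < \<infinity>"
    by (simp add: emeasure_cball ennreal_mult_less_top less_top[symmetric] ennreal_mult_eq_top_iff)
  finally show "emeasure (sph :: 'a measure) (space sph) \<noteq> \<infinity>" by simp
qed

interpretation sph: finite_measure "sph :: 'a::euclidean_space measure"
  by (rule finite_measure_sphere)

interpretation sph2: pair_sigma_finite "sph :: 'a::euclidean_space measure" "sph :: 'a measure"
  ..

lemma measurable_ident_sphere: "(\<lambda>x. x) \<in> borel_measurable (sph :: 'a::euclidean_space measure)"
proof -
  have "(\<lambda>x. x) \<in> borel_measurable (restrict_space borel (sphere (0::'a) 1))"
    by (rule measurable_restrict_space1) simp
  then show ?thesis
    using measurable_cong_sets[OF sets_sphere_measure refl] by blast
qed

text \<open>
  The cone definition of the surface measure, in the form used for computations.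
\<close>

lemma nn_integral_sphere:
  fixes h :: "'a::euclidean_space \<Rightarrow> ennreal"
  assumes h: "h \<in> borel_measurable sph"
  shows "(\<integral>\<^sup>+x. h x \<partial>sph) =
    of_nat DIM('a) * (\<integral>\<^sup>+z. h (z /\<^sub>R norm z) * indicator (cball 0 1 - {0}) z \<partial>lborel)"
proof -
  have h': "h \<in> borel_measurable (restrict_space borel (sphere 0 1))"
    using h measurable_cong_sets[OF sets_sphere_measure refl] by blast
  have "(\<integral>\<^sup>+x. h x \<partial>sph) = of_nat DIM('a) *
      (\<integral>\<^sup>+x. h x \<partial>distr (restrict_space lborel (cball 0 1 - {0})) (restrict_space borel (sphere 0 1))
         (\<lambda>x. x /\<^sub>R norm x))"
    unfolding sphere_measure_def by (rule nn_integral_scale_measure) (simp add: h')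
  then show ?thesis
    by (simp add: nn_integral_distr[OF radial_projection_measurable] h' nn_integral_restrict_space)
qed

lemma distr_sphere_orthogonal:
  fixes f :: "'a::euclidean_space \<Rightarrow> 'a"
  assumes f: "orthogonal_transformation f"
  shows "distr sph sph f = sph"
proof (rule measure_eqI)
  fix A assume "A \<in> sets (distr sph sph f)"
  then have A [measurable]: "A \<in> sets (sph :: 'a measure)" by simp
  have lf: "linear f" using f by (simp add: orthogonal_transformation_linear)
  have fb [measurable]: "f \<in> borel_measurable borel"
    using lf by (intro borel_measurable_continuous_onI linear_continuous_on)
      (simp add: linear_conv_bounded_linear)
  have nf: "norm (f x) = norm x" for x
    using orthogonal_transformation_norm[OF f] .
  have "f \<in> restrict_space borel (sphere 0 1) \<rightarrow>\<^sub>M restrict_space borel (sphere 0 1)"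
    by (rule measurable_restrict_space3) (auto simp: nf)
  then have fm [measurable]: "f \<in> sph \<rightarrow>\<^sub>M sph"
    using measurable_cong_sets[OF sets_sphere_measure sets_sphere_measure] by blast
  have A_proj: "(\<lambda>z. indicator A (z /\<^sub>R norm z) * indicator (cball 0 1 - {0}) z :: ennreal) \<in> borel_measurable borel"
  proof -
    have "A \<in> sets borel"
      using A sets_restrict_space_iff[of "sphere (0::'a) 1" borel A] by auto
    moreover have "cball 0 1 - {0} \<in> sets (borel :: 'a measure)" by auto
    ultimately show ?thesis by measurable
  qed
  have "emeasure (distr sph sph f) A = (\<integral>\<^sup>+x. indicator A x \<partial>distr sph sph f)"
    using A by (intro nn_integral_indicator[symmetric]) simp
  also have "\<dots> = (\<integral>\<^sup>+x. indicator A (f x) \<partial>sph)"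
    using A by (intro nn_integral_distr[OF fm] borel_measurable_indicator) simp
  also have "\<dots> = of_nat DIM('a) *
      (\<integral>\<^sup>+z. indicator A (f (z /\<^sub>R norm z)) * indicator (cball 0 1 - {0}) z \<partial>lborel)"
    by (rule nn_integral_sphere) simp
  also have "(\<integral>\<^sup>+z. indicator A (f (z /\<^sub>R norm z)) * indicator (cball 0 1 - {0}) z \<partial>lborel) =
      (\<integral>\<^sup>+z. indicator A (f z /\<^sub>R norm (f z)) * indicator (cball 0 1 - {0}) (f z) \<partial>lborel)"
    by (intro nn_integral_cong)
      (auto simp: nf linear_scale[OF lf] indicator_def dist_norm linear_0[OF lf]
        simp flip: norm_eq_zero[of "f _"])
  also have "\<dots> = (\<integral>\<^sup>+z. indicator A (z /\<^sub>R norm z) * indicator (cball 0 1 - {0}) z \<partial>distr lborel borel f)"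
    using A_proj by (subst nn_integral_distr) auto
  also have "\<dots> = (\<integral>\<^sup>+z. indicator A (z /\<^sub>R norm z) * indicator (cball 0 1 - {0}) z \<partial>lborel)"
    by (simp add: lborel_distr_orthogonal[OF f])
  also have "of_nat DIM('a) * \<dots> = (\<integral>\<^sup>+x. indicator A x \<partial>sph)"
    by (rule nn_integral_sphere[symmetric]) simp
  also have "\<dots> = emeasure sph A"
    using A by (rule nn_integral_indicator)
  finally show "emeasure (distr sph sph f) A = emeasure sph A" .
qed simp

lemma measurable_orthogonal_sphere:
  fixes f :: "'a::euclidean_space \<Rightarrow> 'a"
  assumes f: "orthogonal_transformation f"
  shows "f \<in> sph \<rightarrow>\<^sub>M sph"
proof -
  have "f \<in> restrict_space borel (sphere 0 1) \<rightarrow>\<^sub>M restrict_space borel (sphere 0 1)"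
  proof (rule measurable_restrict_space3)
    show "f \<in> borel \<rightarrow>\<^sub>M borel"
      using orthogonal_transformation_linear[OF f]
      by (intro borel_measurable_continuous_onI linear_continuous_on)
        (simp add: linear_conv_bounded_linear)
  qed (auto simp: orthogonal_transformation_norm[OF f])
  then show ?thesis
    using measurable_cong_sets[OF sets_sphere_measure sets_sphere_measure] by blast
qed

lemma
  fixes f :: "'a::euclidean_space \<Rightarrow> 'a" and h :: "'a \<Rightarrow> real"
  assumes f: "orthogonal_transformation f" and h: "h \<in> borel_measurable sph"
  shows integral_sphere_orthogonal: "(\<integral>x. h (f x) \<partial>sph) = (\<integral>x. h x \<partial>sph)"
    and integrable_sphere_orthogonal: "integrable sph (\<lambda>x. h (f x)) \<longleftrightarrow> integrable sph h"
  using integral_distr[OF measurable_orthogonal_sphere[OF f] h]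
    integrable_distr_eq[OF measurable_orthogonal_sphere[OF f] h]
  by (simp_all add: distr_sphere_orthogonal[OF f])

section \<open>Reflections\<close>

definition reflection :: "'a::euclidean_space \<Rightarrow> 'a \<Rightarrow> 'a" where
  "reflection v x = x - (2 * (v \<bullet> x)) *\<^sub>R v"

lemma orthogonal_reflection:
  assumes "norm v = 1"
  shows "orthogonal_transformation (reflection v)"
proof -
  have "v \<bullet> v = 1" using assms by (simp add: dot_square_norm)
  then show ?thesis
    unfolding orthogonal_transformation_def reflection_def
    by (auto simp: linear_iff algebra_simps inner_commute)
qed

lemma reflection_reflection:
  assumes "norm v = 1"
  shows "reflection v (reflection v x) = x"
proof -
  have "v \<bullet> v = 1" using assms by (simp add: dot_square_norm)
  then show ?thesis by (simp add: reflection_def algebra_simps)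
qed

lemma inner_reflection:
  assumes "norm v = 1"
  shows "reflection v x \<bullet> y = x \<bullet> reflection v y"
  by (simp add: reflection_def algebra_simps inner_commute)

lemma norm_reflection: "norm v = 1 \<Longrightarrow> norm (reflection v x) = norm x"
  using orthogonal_transformation_norm orthogonal_reflection by blast

text \<open>
  Reflections act transitively on every sphere, so they suffice wherever rotation invariance is needed; being
  symmetric and their own inverses they are easier to handle than rotations.
\<close>

lemma reflection_exchanges:
  fixes x y :: "'a::euclidean_space"
  assumes "norm x = norm y" "x \<noteq> y"
  obtains v where "norm v = 1" "reflection v x = y"
proof
  define v where "v = (x - y) /\<^sub>R norm (x - y)"
  show "norm v = 1" using assms by (simp add: v_def)
  have "x \<bullet> x = y \<bullet> y" using assms(1) by (simp add: norm_eq)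
  then have *: "(norm (x - y))\<^sup>2 = 2 * ((x - y) \<bullet> x)"
    by (simp add: power2_norm_eq_inner algebra_simps inner_commute)
  have "(2 * (v \<bullet> x)) *\<^sub>R v = (2 * ((x - y) \<bullet> x) / (norm (x - y))\<^sup>2) *\<^sub>R (x - y)"
    by (simp add: v_def power2_eq_square divide_inverse mult_ac)
  also have "\<dots> = x - y"
    using assms by (subst *[symmetric]) simp
  finally show "reflection v x = y" by (simp add: reflection_def)
qed

section \<open>Integration of zonal functions\<close>

text \<open>
  The singular endpoint of the ball volume formula, which is stated for positive radii only.
\<close>

lemma emeasure_radius_le_zero:
  assumes "finite I" "I \<noteq> {}"
  shows "emeasure (Pi\<^sub>M I (\<lambda>_. lborel :: real measure))
           ({f. sqrt (\<Sum>i\<in>I. (f i)\<^sup>2) \<le> 0} \<inter> space (Pi\<^sub>M I (\<lambda>_. lborel))) = 0"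
    (is "?m 0 = 0")
proof -
  have m: "card I \<noteq> 0" using assms by simp
  have "(\<lambda>n. unit_ball_vol (real (card I)) * (inverse (real (Suc n))) ^ card I) \<longlonglongrightarrow>
      unit_ball_vol (real (card I)) * 0 ^ card I"
    by (intro tendsto_intros LIMSEQ_inverse_real_of_nat)
  from tendsto_ennrealI[OF this] m
  have lim: "(\<lambda>n. ennreal (unit_ball_vol (real (card I)) * (inverse (real (Suc n))) ^ card I)) \<longlonglongrightarrow> 0"
    by (simp add: zero_power del: of_nat_Suc)
  have "?m 0 \<le> ennreal (unit_ball_vol (real (card I)) * (inverse (real (Suc n))) ^ card I)" for n
  proof -
    have "?m 0 \<le> ?m (inverse (real (Suc n)))"
      by (rule emeasure_mono) (auto simp del: real_sqrt_le_0_iff elim!: order_trans)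
    also have "\<dots> = ennreal (unit_ball_vol (real (card I)) * (inverse (real (Suc n))) ^ card I)"
      by (rule emeasure_cball_aux) (use assms in auto)
    finally show ?thesis .
  qed
  then have "?m 0 \<le> 0"
    by (intro tendsto_lowerbound[OF lim]) auto
  then show ?thesis by simp
qed

text \<open>
  Differentiating the volume \<open>unit_ball_vol m * \<rho> ^ m\<close> of a ball gives the density of the radius.
\<close>

lemma distr_radius:
  assumes I: "finite I" "I \<noteq> {}"
  shows "distr (Pi\<^sub>M I (\<lambda>_. lborel :: real measure)) borel (\<lambda>f. sqrt (\<Sum>i\<in>I. (f i)\<^sup>2)) =
    density lborel (\<lambda>\<rho>. ennreal (sphere_area (card I) * \<rho> ^ (card I - 1)) * indicator {0..} \<rho>)"
    (is "?L = ?R")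
proof (rule measure_eqI_generator_eq)
  let ?P = "Pi\<^sub>M I (\<lambda>_. lborel :: real measure)"
  let ?E = "range (\<lambda>a::real. {..a})"
  let ?N = "\<lambda>f. sqrt (\<Sum>i\<in>I. (f i)\<^sup>2)"
  have m: "card I \<noteq> 0" using I by simp
  have N [measurable]: "?N \<in> borel_measurable ?P" by measurable
  have L: "emeasure ?L {..a} = ennreal (unit_ball_vol (card I) * max 0 a ^ card I)" for a
  proof -
    have *: "emeasure ?L {..a} = emeasure ?P ({f. ?N f \<le> a} \<inter> space ?P)"
      by (subst emeasure_distr) (auto intro!: arg_cong2[where f = emeasure])
    show ?thesis
    proof (cases "a > 0")
      case True
      then show ?thesis unfolding * using emeasure_cball_aux[OF I(1) True] by simp
    next
      case False
      then have "emeasure ?P ({f. ?N f \<le> a} \<inter> space ?P) \<le> emeasure ?P ({f. ?N f \<le> 0} \<inter> space ?P)"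
        by (intro emeasure_mono) (auto simp del: real_sqrt_le_0_iff elim!: order_trans)
      with False m show ?thesis unfolding * emeasure_radius_le_zero[OF I] by simp
    qed
  qed
  have R: "emeasure ?R {..a} = ennreal (unit_ball_vol (card I) * max 0 a ^ card I)" for a
  proof -
    have "emeasure ?R {..a} =
      (\<integral>\<^sup>+\<rho>. ennreal (sphere_area (card I) * \<rho> ^ (card I - 1)) * indicator {0..} \<rho> * indicator {..a} \<rho> \<partial>lborel)"
      by (subst emeasure_density) auto
    also have "\<dots> = (\<integral>\<^sup>+\<rho>. ennreal (sphere_area (card I) * \<rho> ^ (card I - 1)) * indicator {0..max 0 a} \<rho> \<partial>lborel)"
    proof (rule nn_integral_cong_AE)
      have "AE \<rho> in lborel. \<rho> \<notin> {0::real}"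
        by (intro AE_not_in countable_imp_null_set_lborel) auto
      then show "AE \<rho> in lborel. ennreal (sphere_area (card I) * \<rho> ^ (card I - 1)) * indicator {0..} \<rho> * indicator {..a} \<rho> =
          ennreal (sphere_area (card I) * \<rho> ^ (card I - 1)) * indicator {0..max 0 a} \<rho>"
        by eventually_elim (auto simp: indicator_def max_def)
    qed
    also have "\<dots> = ennreal (unit_ball_vol (card I) * max 0 a ^ card I - unit_ball_vol (card I) * 0 ^ card I)"
      by (rule nn_integral_FTC_Icc) (auto intro!: derivative_eq_intros simp: sphere_area_def)
    finally show ?thesis using m by simp
  qed
  show "Int_stable ?E" by (auto simp: Int_stable_def)
  show "?E \<subseteq> Pow UNIV" by simp
  show "emeasure ?L X = emeasure ?R X" if "X \<in> ?E" for X
    using that L R by auto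
  show "sets ?L = sigma_sets UNIV ?E" by (simp add: borel_eq_atMost)
  show "sets ?R = sigma_sets UNIV ?E" by (simp add: borel_eq_atMost)
  show "range (\<lambda>n. {..real n}) \<subseteq> ?E" by auto
  show "(\<Union>n. {..real n}) = UNIV" by (auto intro: real_arch_simple)
  show "emeasure ?L {..real n} \<noteq> \<infinity>" for n by (simp add: L)
qed

text \<open>
  Cylindrical coordinates around an axis: the height \<open>t\<close> and the distance \<open>\<rho>\<close> from the axis carry the
  density \<open>sphere_area (n - 1) * \<rho> ^ (n - 2)\<close>.
\<close>

lemma nn_integral_lborel_axial:
  fixes b :: "'a::euclidean_space" and G :: "real \<Rightarrow> real \<Rightarrow> ennreal"
  assumes b: "b \<in> Basis" and dim: "2 \<le> DIM('a)"
    and G [measurable]: "(\<lambda>(t, \<rho>). G t \<rho>) \<in> borel_measurable (borel \<Otimes>\<^sub>M borel)"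
  shows "(\<integral>\<^sup>+z. G (z \<bullet> b) (sqrt ((norm z)\<^sup>2 - (z \<bullet> b)\<^sup>2)) \<partial>(lborel :: 'a measure)) =
    (\<integral>\<^sup>+t. (\<integral>\<^sup>+\<rho>. G t \<rho> * (ennreal (sphere_area (DIM('a) - 1) * \<rho> ^ (DIM('a) - 2)) * indicator {0..} \<rho>)
       \<partial>lborel) \<partial>lborel)"
proof -
  define I where "I = Basis - {b}"
  have I: "finite I" "I \<noteq> {}" "b \<notin> I" "insert b I = Basis" "card I = DIM('a) - 1"
  proof -
    show card: "card I = DIM('a) - 1" using b by (simp add: I_def)
    with dim show "I \<noteq> {}" by force
  qed (use b in \<open>auto simp: I_def\<close>)
  interpret product_sigma_finite "\<lambda>_::'a. lborel :: real measure" by standard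
  let ?P = "Pi\<^sub>M I (\<lambda>_. lborel :: real measure)"
  let ?N = "\<lambda>f::'a \<Rightarrow> real. sqrt (\<Sum>i\<in>I. (f i)\<^sup>2)"
  let ?v = "\<lambda>f::'a \<Rightarrow> real. \<Sum>i\<in>Basis. f i *\<^sub>R i"
  let ?F = "\<lambda>z::'a. G (z \<bullet> b) (sqrt ((norm z)\<^sup>2 - (z \<bullet> b)\<^sup>2))"
  have F [measurable]: "?F \<in> borel_measurable borel" by measurable
  have "(\<integral>\<^sup>+z. ?F z \<partial>lborel) = (\<integral>\<^sup>+f. ?F (?v f) \<partial>Pi\<^sub>M Basis (\<lambda>_. lborel))"
    by (subst lborel_eq, rule nn_integral_distr) simp_all
  also have "\<dots> = (\<integral>\<^sup>+f. G (f b) (?N f) \<partial>Pi\<^sub>M (insert b I) (\<lambda>_. lborel))"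
  proof -
    have "?F (?v f) = G (f b) (?N f)" for f
    proof -
      have "(norm (?v f))\<^sup>2 = (\<Sum>i\<in>insert b I. (f i)\<^sup>2)"
        unfolding power2_norm_eq_inner I(4) by (subst euclidean_inner) (simp add: power2_eq_square)
      also have "\<dots> = (f b)\<^sup>2 + (\<Sum>i\<in>I. (f i)\<^sup>2)" using I(1,3) by simp
      finally show ?thesis using b by simp
    qed
    then show ?thesis by (simp add: I)
  qed
  also have "\<dots> = (\<integral>\<^sup>+t. (\<integral>\<^sup>+f. G t (?N f) \<partial>?P) \<partial>lborel)"
  proof -
    have "?N (f(b := t)) = ?N f" for f t
      using I(3) by (intro arg_cong[where f = sqrt] sum.cong) auto
    moreover have "(\<lambda>f. G (f b) (?N f)) \<in> borel_measurable (Pi\<^sub>M (insert b I) (\<lambda>_. lborel))"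
      by measurable
    ultimately show ?thesis
      using I(1,3) by (subst product_nn_integral_insert_rev) auto
  qed
  also have "\<dots> = (\<integral>\<^sup>+t. (\<integral>\<^sup>+\<rho>. G t \<rho> \<partial>distr ?P borel ?N) \<partial>lborel)"
    by (subst nn_integral_distr) auto
  also have "\<dots> = (\<integral>\<^sup>+t. (\<integral>\<^sup>+\<rho>. (ennreal (sphere_area (DIM('a) - 1) * \<rho> ^ (DIM('a) - 1 - 1)) * indicator {0..} \<rho>) * G t \<rho> 
       \<partial>lborel) \<partial>lborel)"
    unfolding distr_radius[OF I(1,2)] I(5)
    by (intro nn_integral_cong nn_integral_density) auto
  finally show ?thesis by (simp add: mult.commute numeral_2_eq_2)
qed

text \<open>
  Inside the unit half-disc the line at distance \<open>\<rho>\<close> from the axis is parametrised by its polar angle,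
  through \<open>t = - \<rho> * cot \<theta>\<close>. The sign makes the substitution increasing, at the price of
  replacing \<open>cos \<theta>\<close> by \<open>- cos \<theta>\<close>. Since the half-disc is bounded, \<open>\<theta>\<close> stays in a compact part of \<open>]0, \<pi>[\<close>.
\<close>

lemma nn_integral_half_plane_ray:
  fixes h :: "real \<Rightarrow> ennreal"
  assumes h [measurable]: "h \<in> borel_measurable borel" and \<rho>: "0 < \<rho>" "\<rho> < 1"
  shows "(\<integral>\<^sup>+t. h (t / sqrt (t\<^sup>2 + \<rho>\<^sup>2)) * indicator {0<..1} (sqrt (t\<^sup>2 + \<rho>\<^sup>2)) \<partial>lborel) =
    (\<integral>\<^sup>+\<theta>. h (- cos \<theta>) * ennreal (\<rho> / (sin \<theta>)\<^sup>2) * (indicator {0<..<pi} \<theta> * indicator {..sin \<theta>} \<rho>) \<partial>lborel)"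
proof -
  define a where "a = arcsin \<rho>"
  have a: "0 < a" "a < pi / 2" "sin a = \<rho>"
    using \<rho> arcsin_less_arcsin[of 0 \<rho>] arcsin_lt_bounded[of \<rho>] by (auto simp: a_def)
  have ca: "0 < cos a" using a by (intro cos_gt_zero_pi) auto
  have ca2: "(cos a)\<^sup>2 = 1 - \<rho>\<^sup>2" using a by (simp add: cos_squared_eq)
  define g where "g = (\<lambda>\<theta>. - \<rho> * cos \<theta> / sin \<theta>)"
  have sin_pos: "sin \<theta> > 0" if "\<theta> \<in> {a..pi - a}" for \<theta>
    using that a by (intro sin_gt_zero) auto
  have gab: "g a = - cos a" "g (pi - a) = cos a" using a \<rho> by (auto simp: g_def)
  have ball: "sqrt (t\<^sup>2 + \<rho>\<^sup>2) \<in> {0<..1} \<longleftrightarrow> t \<in> {- cos a..cos a}" for t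
  proof -
    have "sqrt (t\<^sup>2 + \<rho>\<^sup>2) > 0" using \<rho> by (simp add: add_nonneg_pos)
    moreover have "sqrt (t\<^sup>2 + \<rho>\<^sup>2) \<le> 1 \<longleftrightarrow> t\<^sup>2 \<le> (cos a)\<^sup>2" by (simp add: ca2 algebra_simps)
    moreover have "t\<^sup>2 \<le> (cos a)\<^sup>2 \<longleftrightarrow> t \<in> {- cos a..cos a}"
      using ca by (auto simp: abs_le_square_iff[symmetric] abs_le_iff)
    ultimately show ?thesis by simp
  qed
  have interval: "\<theta> \<in> {a..pi - a} \<longleftrightarrow> \<theta> \<in> {0<..<pi} \<and> \<rho> \<le> sin \<theta>" for \<theta>
  proof
    assume \<theta>: "\<theta> \<in> {a..pi - a}"
    have "sin a \<le> sin \<theta>"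
    proof (cases "\<theta> \<le> pi / 2")
      case True then show ?thesis using \<theta> a by (intro sin_monotone_2pi_le) auto
    next
      case False
      then have "sin a \<le> sin (pi - \<theta>)" using \<theta> a by (intro sin_monotone_2pi_le) auto
      then show ?thesis by simp
    qed
    with \<theta> a show "\<theta> \<in> {0<..<pi} \<and> \<rho> \<le> sin \<theta>" by auto
  next
    assume \<theta>: "\<theta> \<in> {0<..<pi} \<and> \<rho> \<le> sin \<theta>"
    show "\<theta> \<in> {a..pi - a}"
    proof (rule ccontr)
      assume "\<theta> \<notin> {a..pi - a}"
      then consider "\<theta> < a" | "pi - \<theta> < a" by fastforce
      then have "sin \<theta> < sin a"
      proof cases
        case 1 then show ?thesis using \<theta> a by (intro sin_monotone_2pi) auto
      next
        case 2
        then have "sin (pi - \<theta>) < sin a" using \<theta> a by (intro sin_monotone_2pi) auto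
        then show ?thesis by simp
      qed
      with \<theta> a show False by simp
    qed
  qed
  have ratio: "g \<theta> / sqrt ((g \<theta>)\<^sup>2 + \<rho>\<^sup>2) = - cos \<theta>" if \<theta>: "\<theta> \<in> {a..pi - a}" for \<theta>
  proof -
    have "(g \<theta>)\<^sup>2 + \<rho>\<^sup>2 = (\<rho> / sin \<theta>)\<^sup>2 * ((cos \<theta>)\<^sup>2 + (sin \<theta>)\<^sup>2)"
      using sin_pos[OF \<theta>]
      by (simp add: g_def power_divide power_mult_distrib cos_squared_eq right_diff_distrib diff_divide_distrib)
    also have "\<dots> = (\<rho> / sin \<theta>)\<^sup>2" by simp
    finally have "sqrt ((g \<theta>)\<^sup>2 + \<rho>\<^sup>2) = \<rho> / sin \<theta>"
      using sin_pos[OF \<theta>] \<rho> by simp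
    then show ?thesis using sin_pos[OF \<theta>] \<rho> by (simp add: g_def)
  qed
  have deriv: "(g has_real_derivative \<rho> / (sin \<theta>)\<^sup>2) (at \<theta>)" if \<theta>: "\<theta> \<in> {a..pi - a}" for \<theta>
  proof -
    have "(g has_real_derivative (\<rho> * sin \<theta> * sin \<theta> + \<rho> * cos \<theta> * cos \<theta>) / (sin \<theta> * sin \<theta>)) (at \<theta>)"
      unfolding g_def using sin_pos[OF \<theta>]
      by (auto intro!: derivative_eq_intros simp: field_simps)
    moreover have "\<rho> * sin \<theta> * sin \<theta> + \<rho> * cos \<theta> * cos \<theta> = \<rho>"
      using sin_cos_squared_add[of \<theta>] by (metis distrib_left mult.assoc mult.right_neutral power2_eq_square)
    ultimately show ?thesis by (simp only: power2_eq_square)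
  qed
  have "(\<integral>\<^sup>+t. h (t / sqrt (t\<^sup>2 + \<rho>\<^sup>2)) * indicator {0<..1} (sqrt (t\<^sup>2 + \<rho>\<^sup>2)) \<partial>lborel) =
      (\<integral>\<^sup>+t. h (t / sqrt (t\<^sup>2 + \<rho>\<^sup>2)) * indicator {g a..g (pi - a)} t \<partial>lborel)"
    unfolding gab by (intro nn_integral_cong) (simp only: indicator_def ball)
  also have "\<dots> = (\<integral>\<^sup>+\<theta>. h (g \<theta> / sqrt ((g \<theta>)\<^sup>2 + \<rho>\<^sup>2)) * ennreal (\<rho> / (sin \<theta>)\<^sup>2) * indicator {a..pi - a} \<theta> \<partial>lborel)"
  proof (rule nn_integral_substitution_aux)
    show "continuous_on {a..pi - a} (\<lambda>\<theta>. \<rho> / (sin \<theta>)\<^sup>2)"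
      using sin_pos by (auto intro!: continuous_intros simp: less_imp_neq[symmetric])
  qed (use deriv \<rho> a in auto)
  also have "\<dots> = (\<integral>\<^sup>+\<theta>. h (- cos \<theta>) * ennreal (\<rho> / (sin \<theta>)\<^sup>2) * (indicator {0<..<pi} \<theta> * indicator {..sin \<theta>} \<rho>) \<partial>lborel)"
  proof (rule nn_integral_cong)
    fix \<theta>
    show "h (g \<theta> / sqrt ((g \<theta>)\<^sup>2 + \<rho>\<^sup>2)) * ennreal (\<rho> / (sin \<theta>)\<^sup>2) * indicator {a..pi - a} \<theta> =
      h (- cos \<theta>) * ennreal (\<rho> / (sin \<theta>)\<^sup>2) * (indicator {0<..<pi} \<theta> * indicator {..sin \<theta>} \<rho>)"
    proof (cases "\<theta> \<in> {a..pi - a}")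
      case True
      then show ?thesis using interval[of \<theta>] by (simp add: ratio)
    next
      case False
      then have "indicator {0<..<pi} \<theta> * indicator {..sin \<theta>} \<rho> = (0::ennreal)"
        using interval[of \<theta>] by (auto simp: indicator_def)
      then show ?thesis using False by (simp del: mult_eq_0_iff)
    qed
  qed
  finally show ?thesis .
qed


text \<open>
  Exchanging the order of integration in cylindrical coordinates after the substitution above leaves, for
  each angle, the integral of \<open>\<rho> ^ (n - 1)\<close> over \<open>[0, sin \<theta>]\<close>; this turns the factor \<open>1 / (sin \<theta>)\<^sup>2\<close>
  into \<open>sin \<theta> ^ (n - 2) / n\<close>, and \<open>n\<close> cancels against the factor in the definition of the surface measure.
\<close>

lemma nn_integral_zonal_Basis:
  fixes b :: "'a::euclidean_space" and h :: "real \<Rightarrow> ennreal"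
  assumes b: "b \<in> Basis" and dim: "2 \<le> DIM('a)" and h [measurable]: "h \<in> borel_measurable borel"
  shows "(\<integral>\<^sup>+x. h (x \<bullet> b) \<partial>(sph :: 'a measure)) =
    ennreal (sphere_area (DIM('a) - 1)) *
      (\<integral>\<^sup>+\<theta>. h (cos \<theta>) * ennreal (sin \<theta> ^ (DIM('a) - 2)) * indicator {0<..<pi} \<theta> \<partial>lborel)"
proof -
  define n where "n = DIM('a)"
  define C where "C = sphere_area (n - 1)"
  have n: "2 \<le> n" using dim by (simp add: n_def)
  have C: "0 \<le> C" by (simp add: C_def sphere_area_def)
  define w where "w = (\<lambda>\<rho>::real. ennreal (C * \<rho> ^ (n - 2)) * indicator {0..} \<rho>)"
  define G where "G = (\<lambda>t \<rho>::real. h (t / sqrt (t\<^sup>2 + \<rho>\<^sup>2)) * indicator {0<..1} (sqrt (t\<^sup>2 + \<rho>\<^sup>2)))"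
  have [measurable]: "w \<in> borel_measurable borel" unfolding w_def by measurable
  have G_meas [measurable]: "(\<lambda>(t, \<rho>). G t \<rho>) \<in> borel_measurable (borel \<Otimes>\<^sub>M borel)"
    unfolding G_def by measurable
  have [measurable]: "(\<lambda>x. x \<bullet> b) \<in> borel_measurable (sph :: 'a measure)"
    using measurable_ident_sphere by (rule borel_measurable_inner) simp
  have "(\<integral>\<^sup>+x. h (x \<bullet> b) \<partial>(sph :: 'a measure)) =
      of_nat n * (\<integral>\<^sup>+z. h ((z /\<^sub>R norm z) \<bullet> b) * indicator (cball 0 1 - {0}) z \<partial>(lborel :: 'a measure))"
    unfolding n_def by (rule nn_integral_sphere) measurable
  also have "(\<integral>\<^sup>+z. h ((z /\<^sub>R norm z) \<bullet> b) * indicator (cball 0 1 - {0}) z \<partial>(lborel :: 'a measure)) =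
      (\<integral>\<^sup>+z. G (z \<bullet> b) (sqrt ((norm z)\<^sup>2 - (z \<bullet> b)\<^sup>2)) \<partial>(lborel :: 'a measure))"
  proof (rule nn_integral_cong)
    fix z :: 'a
    have "\<bar>z \<bullet> b\<bar> \<le> norm z" using Cauchy_Schwarz_ineq2[of z b] b by simp
    then have "(z \<bullet> b)\<^sup>2 \<le> (norm z)\<^sup>2" using abs_le_square_iff[of "z \<bullet> b" "norm z"] by simp
    with abs_square_le_1[of "norm z"] show "h ((z /\<^sub>R norm z) \<bullet> b) * indicator (cball 0 1 - {0}) z =
        G (z \<bullet> b) (sqrt ((norm z)\<^sup>2 - (z \<bullet> b)\<^sup>2))"
      by (simp add: G_def indicator_def dist_norm divide_inverse mult.commute)
  qed
  also have "\<dots> = (\<integral>\<^sup>+t. (\<integral>\<^sup>+\<rho>. G t \<rho> * w \<rho> \<partial>lborel) \<partial>lborel)"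
    unfolding w_def C_def n_def by (rule nn_integral_lborel_axial[OF b dim G_meas])
  also have "\<dots> = (\<integral>\<^sup>+\<rho>. (\<integral>\<^sup>+t. G t \<rho> * w \<rho> \<partial>lborel) \<partial>lborel)"
    by (rule lborel_pair.Fubini') simp
  also have "\<dots> = (\<integral>\<^sup>+\<rho>. (\<integral>\<^sup>+\<theta>. h (- cos \<theta>) * ennreal (\<rho> / (sin \<theta>)\<^sup>2) *
      (indicator {0<..<pi} \<theta> * indicator {0<..sin \<theta>} \<rho>) * w \<rho> \<partial>lborel) \<partial>lborel)"
  proof (rule nn_integral_cong_AE)
    have "AE \<rho> in lborel. \<rho> \<notin> {0, 1::real}"
      by (intro AE_not_in countable_imp_null_set_lborel) auto
    then show "AE \<rho> in lborel. (\<integral>\<^sup>+t. G t \<rho> * w \<rho> \<partial>lborel) =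
        (\<integral>\<^sup>+\<theta>. h (- cos \<theta>) * ennreal (\<rho> / (sin \<theta>)\<^sup>2) *
      (indicator {0<..<pi} \<theta> * indicator {0<..sin \<theta>} \<rho>) * w \<rho> \<partial>lborel)"
    proof eventually_elim
      case (elim \<rho>)
      consider "\<rho> < 0" | "1 < \<rho>" | "0 < \<rho>" "\<rho> < 1" using elim by fastforce
      then show ?case
      proof cases
        case 1 then show ?thesis by (simp add: w_def)
      next
        case 2
        have "sqrt (t\<^sup>2 + \<rho>\<^sup>2) \<notin> {0<..1}" for t
        proof -
          have "1 < \<rho>\<^sup>2" using 2 by (simp add: one_less_power)
          then have "1 < t\<^sup>2 + \<rho>\<^sup>2" using zero_le_power2[of t] by linarith
          then show ?thesis by simp
        qed
        moreover have "indicator {0<..sin \<theta>} \<rho> = (0::ennreal)" for \<theta>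
          using 2 sin_le_one[of \<theta>] by (auto simp: indicator_def simp del: sin_le_one)
        ultimately show ?thesis by (simp add: G_def)
      next
        case 3
        have "(\<integral>\<^sup>+t. G t \<rho> * w \<rho> \<partial>lborel) = (\<integral>\<^sup>+t. G t \<rho> \<partial>lborel) * w \<rho>"
          by (rule nn_integral_multc) (simp add: G_def)
        also have "(\<integral>\<^sup>+t. G t \<rho> \<partial>lborel) = (\<integral>\<^sup>+\<theta>. h (- cos \<theta>) * ennreal (\<rho> / (sin \<theta>)\<^sup>2) *
            (indicator {0<..<pi} \<theta> * indicator {..sin \<theta>} \<rho>) \<partial>lborel)"
          unfolding G_def by (rule nn_integral_half_plane_ray[OF h 3])
        also have "\<dots> * w \<rho> = (\<integral>\<^sup>+\<theta>. h (- cos \<theta>) * ennreal (\<rho> / (sin \<theta>)\<^sup>2) *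
            (indicator {0<..<pi} \<theta> * indicator {..sin \<theta>} \<rho>) * w \<rho> \<partial>lborel)"
          by (rule nn_integral_multc[symmetric]) (simp add: indicator_def)
        finally show ?thesis using 3 by (simp add: indicator_def)
      qed
    qed
  qed
  also have "\<dots> = (\<integral>\<^sup>+\<theta>. (\<integral>\<^sup>+\<rho>. h (- cos \<theta>) * ennreal (\<rho> / (sin \<theta>)\<^sup>2) *
      (indicator {0<..<pi} \<theta> * indicator {0<..sin \<theta>} \<rho>) * w \<rho> \<partial>lborel) \<partial>lborel)"
    by (rule lborel_pair.Fubini'[symmetric]) (simp add: indicator_def case_prod_beta')
  also have "\<dots> = (\<integral>\<^sup>+\<theta>. h (- cos \<theta>) * ennreal (C / n * sin \<theta> ^ (n - 2)) * indicator {0<..<pi} \<theta> \<partial>lborel)"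
  proof (rule nn_integral_cong)
    fix \<theta> :: real
    show "(\<integral>\<^sup>+\<rho>. h (- cos \<theta>) * ennreal (\<rho> / (sin \<theta>)\<^sup>2) *
        (indicator {0<..<pi} \<theta> * indicator {0<..sin \<theta>} \<rho>) * w \<rho> \<partial>lborel) =
      h (- cos \<theta>) * ennreal (C / n * sin \<theta> ^ (n - 2)) * indicator {0<..<pi} \<theta>"
    proof (cases "\<theta> \<in> {0<..<pi}")
      case True
      then have s: "0 < sin \<theta>" by (intro sin_gt_zero) auto
      have "(\<integral>\<^sup>+\<rho>. h (- cos \<theta>) * ennreal (\<rho> / (sin \<theta>)\<^sup>2) *
          (indicator {0<..<pi} \<theta> * indicator {0<..sin \<theta>} \<rho>) * w \<rho> \<partial>lborel) =
        (\<integral>\<^sup>+\<rho>. h (- cos \<theta>) * (ennreal (C / (sin \<theta>)\<^sup>2 * \<rho> ^ (n - 1)) * indicator {0..sin \<theta>} \<rho>) \<partial>lborel)"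
      proof (rule nn_integral_cong_AE)
        have "AE \<rho> in lborel. \<rho> \<noteq> (0::real)" by (rule AE_lborel_singleton)
        then show "AE \<rho> in lborel. h (- cos \<theta>) * ennreal (\<rho> / (sin \<theta>)\<^sup>2) *
          (indicator {0<..<pi} \<theta> * indicator {0<..sin \<theta>} \<rho>) * w \<rho> =
          h (- cos \<theta>) * (ennreal (C / (sin \<theta>)\<^sup>2 * \<rho> ^ (n - 1)) * indicator {0..sin \<theta>} \<rho>)"
        proof eventually_elim
          case (elim \<rho>)
          show ?case
          proof (cases "0 < \<rho> \<and> \<rho> \<le> sin \<theta>")
            case T: True
            have "\<rho> / (sin \<theta>)\<^sup>2 * (C * \<rho> ^ (n - 2)) = C / (sin \<theta>)\<^sup>2 * \<rho> ^ (n - 1)"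
              using n by (simp add: power_Suc[symmetric] Suc_diff_Suc numeral_2_eq_2 del: power_Suc)
            then have "ennreal (\<rho> / (sin \<theta>)\<^sup>2) * ennreal (C * \<rho> ^ (n - 2)) = ennreal (C / (sin \<theta>)\<^sup>2 * \<rho> ^ (n - 1))"
              using T s C by (simp flip: ennreal_mult)
            then show ?thesis using T True by (simp add: w_def mult.assoc)
          next
            case False
            then show ?thesis using elim by (auto simp: indicator_def)
          qed
        qed
      qed
      also have "\<dots> = h (- cos \<theta>) * (\<integral>\<^sup>+\<rho>. ennreal (C / (sin \<theta>)\<^sup>2 * \<rho> ^ (n - 1)) * indicator {0..sin \<theta>} \<rho> \<partial>lborel)"
        by (rule nn_integral_cmult) measurable
      also have "(\<integral>\<^sup>+\<rho>. ennreal (C / (sin \<theta>)\<^sup>2 * \<rho> ^ (n - 1)) * indicator {0..sin \<theta>} \<rho> \<partial>lborel) =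
          ennreal (C / (sin \<theta>)\<^sup>2 * (sin \<theta> ^ n / n) - C / (sin \<theta>)\<^sup>2 * (0 ^ n / n))"
        using n C s by (intro nn_integral_FTC_Icc) (auto intro!: derivative_eq_intros)
      also have "C / (sin \<theta>)\<^sup>2 * (sin \<theta> ^ n / n) - C / (sin \<theta>)\<^sup>2 * (0 ^ n / n) = C / n * sin \<theta> ^ (n - 2)"
        using n s by (simp add: power_diff zero_power mult.commute)
      finally show ?thesis using True by simp
    qed simp
  qed
  also have "of_nat n * \<dots> = (\<integral>\<^sup>+\<theta>. ennreal C * (h (- cos \<theta>) * ennreal (sin \<theta> ^ (n - 2)) * indicator {0<..<pi} \<theta>) \<partial>lborel)"
  proof (subst nn_integral_cmult[symmetric])
    show "(\<integral>\<^sup>+\<theta>. of_nat n * (h (- cos \<theta>) * ennreal (C / n * sin \<theta> ^ (n - 2)) * indicator {0<..<pi} \<theta>) \<partial>lborel) =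
      (\<integral>\<^sup>+\<theta>. ennreal C * (h (- cos \<theta>) * ennreal (sin \<theta> ^ (n - 2)) * indicator {0<..<pi} \<theta>) \<partial>lborel)"
    proof (rule nn_integral_cong)
      fix \<theta> :: real
      show "of_nat n * (h (- cos \<theta>) * ennreal (C / n * sin \<theta> ^ (n - 2)) * indicator {0<..<pi} \<theta>) =
          ennreal C * (h (- cos \<theta>) * ennreal (sin \<theta> ^ (n - 2)) * indicator {0<..<pi} \<theta>)"
      proof (cases "\<theta> \<in> {0<..<pi}")
        case True
        then have s: "0 < sin \<theta>" by (intro sin_gt_zero) auto
        have "of_nat n * ennreal (C / n * sin \<theta> ^ (n - 2)) = ennreal (n * (C / n * sin \<theta> ^ (n - 2)))"
          using s C by (subst ennreal_mult) (auto simp: ennreal_of_nat_eq_real_of_nat)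
        also have "real n * (C / n * sin \<theta> ^ (n - 2)) = C * sin \<theta> ^ (n - 2)"
          using n by simp
        also have "ennreal \<dots> = ennreal C * ennreal (sin \<theta> ^ (n - 2))"
          using s C by (intro ennreal_mult) auto
        finally have eq: "of_nat n * ennreal (C / n * sin \<theta> ^ (n - 2)) = ennreal C * ennreal (sin \<theta> ^ (n - 2))" .
        have "of_nat n * (h (- cos \<theta>) * ennreal (C / n * sin \<theta> ^ (n - 2)) * indicator {0<..<pi} \<theta>) =
            h (- cos \<theta>) * (of_nat n * ennreal (C / n * sin \<theta> ^ (n - 2))) * indicator {0<..<pi} \<theta>"
          by (simp only: mult_ac)
        also have "\<dots> = ennreal C * (h (- cos \<theta>) * ennreal (sin \<theta> ^ (n - 2)) * indicator {0<..<pi} \<theta>)"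
          unfolding eq by (simp only: mult_ac)
        finally show ?thesis .
      qed simp
    qed
  qed measurable
  also have "\<dots> = ennreal C * (\<integral>\<^sup>+\<theta>. h (- cos \<theta>) * ennreal (sin \<theta> ^ (n - 2)) * indicator {0<..<pi} \<theta> \<partial>lborel)"
    by (rule nn_integral_cmult) measurable
  also have "(\<integral>\<^sup>+\<theta>. h (- cos \<theta>) * ennreal (sin \<theta> ^ (n - 2)) * indicator {0<..<pi} \<theta> \<partial>lborel) =
      (\<integral>\<^sup>+\<theta>. h (cos \<theta>) * ennreal (sin \<theta> ^ (n - 2)) * indicator {0<..<pi} \<theta> \<partial>lborel)"
    by (subst nn_integral_real_affine[where c = "-1" and t = pi])
      (auto intro!: nn_integral_cong simp: indicator_def)
  finally show ?thesis by (simp add: C_def n_def)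
qed

text \<open>
  By rotation invariance the axis may be any unit vector.
\<close>

lemma nn_integral_zonal:
  fixes e :: "'a::euclidean_space" and h :: "real \<Rightarrow> ennreal"
  assumes e: "norm e = 1" and dim: "2 \<le> DIM('a)" and h [measurable]: "h \<in> borel_measurable borel"
  shows "(\<integral>\<^sup>+x. h (e \<bullet> x) \<partial>(sph :: 'a measure)) =
    ennreal (sphere_area (DIM('a) - 1)) *
      (\<integral>\<^sup>+\<theta>. h (cos \<theta>) * ennreal (sin \<theta> ^ (DIM('a) - 2)) * indicator {0<..<pi} \<theta> \<partial>lborel)"
proof -
  obtain b :: 'a where b: "b \<in> Basis" using nonempty_Basis by blast
  obtain f where f: "orthogonal_transformation f" "f b = e"
  proof (cases "b = e")
    case True
    then show ?thesis using that[of id] by (simp add: id_def)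
  next
    case False
    then obtain v where "norm v = 1" "reflection v b = e"
      using b e by (auto elim: reflection_exchanges[rotated])
    then show ?thesis using that orthogonal_reflection by blast
  qed
  have [measurable]: "(\<lambda>x. e \<bullet> x) \<in> borel_measurable (sph :: 'a measure)"
    by (rule borel_measurable_inner[OF _ measurable_ident_sphere]) simp
  have ef: "e \<bullet> f x = x \<bullet> b" for x
    using f by (metis inner_commute orthogonal_transformation_def)
  have "(\<integral>\<^sup>+x. h (e \<bullet> x) \<partial>sph) = (\<integral>\<^sup>+x. h (e \<bullet> x) \<partial>distr sph sph f)"
    by (simp add: distr_sphere_orthogonal[OF f(1)])
  also have "\<dots> = (\<integral>\<^sup>+x. h (x \<bullet> b) \<partial>sph)"
    by (subst nn_integral_distr[OF measurable_orthogonal_sphere[OF f(1)]])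
      (simp_all add: ef)
  finally show ?thesis using nn_integral_zonal_Basis[OF b dim h] by simp
qed

section \<open>Zonal convolution operators\<close>

definition zonal_conv :: "(real \<Rightarrow> real) \<Rightarrow> ('a::euclidean_space \<Rightarrow> real) \<Rightarrow> 'a \<Rightarrow> real" where
  "zonal_conv \<phi> f x = (\<integral>y. f y * \<phi> (x \<bullet> y) \<partial>sph)"

text \<open>
  Bounds are required on \<open>[-1, 1]\<close> only, the range of \<open>x \<bullet> y\<close> on the sphere; so \<open>exp\<close> is a bounded kernel.
\<close>

definition zonal_kernel :: "real \<Rightarrow> (real \<Rightarrow> real) \<Rightarrow> bool" where
  "zonal_kernel B \<phi> \<longleftrightarrow> \<phi> \<in> borel_measurable borel \<and> (\<forall>t. \<bar>t\<bar> \<le> 1 \<longrightarrow> \<bar>\<phi> t\<bar> \<le> B)"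

lemma zonal_kernelD:
  assumes "zonal_kernel B \<phi>"
  shows zonal_kernel_measurable: "\<phi> \<in> borel_measurable borel"
    and zonal_kernel_le: "\<bar>t\<bar> \<le> 1 \<Longrightarrow> \<bar>\<phi> t\<bar> \<le> B"
    and zonal_kernel_nonneg: "0 \<le> B"
  using assms order_trans[OF abs_ge_zero, of "\<phi> 0" B] by (auto simp: zonal_kernel_def)

lemma abs_inner_sphere: "\<lbrakk>norm x = 1; norm y = 1\<rbrakk> \<Longrightarrow> \<bar>x \<bullet> y\<bar> \<le> 1"
  using Cauchy_Schwarz_ineq2[of x y] by simp

lemma zonal_kernel_mult_le:
  assumes \<phi>: "zonal_kernel B \<phi>" and x: "norm x = 1" and y: "norm y = 1"
  shows "\<bar>a * \<phi> (x \<bullet> y)\<bar> \<le> B * \<bar>a\<bar>"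
proof -
  have "\<bar>a\<bar> * \<bar>\<phi> (x \<bullet> y)\<bar> \<le> \<bar>a\<bar> * B"
    by (intro mult_left_mono zonal_kernel_le[OF \<phi>] abs_inner_sphere x y) simp
  then show ?thesis by (simp add: abs_mult mult.commute)
qed

lemma measurable_zonal [measurable (raw)]:
  assumes "\<phi> \<in> borel_measurable borel"
  shows "(\<lambda>y. \<phi> (x \<bullet> y)) \<in> borel_measurable (sph :: 'a::euclidean_space measure)"
  using assms measurable_ident_sphere by measurable

lemma measurable_zonal_pair:
  assumes [measurable]: "\<phi> \<in> borel_measurable borel"
  shows "(\<lambda>(x, y). \<phi> (x \<bullet> y)) \<in> borel_measurable (sph \<Otimes>\<^sub>M (sph :: 'a::euclidean_space measure))"
proof -
  note measurable_ident_sphere [measurable]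
  have [measurable]: "(\<lambda>p. fst p) \<in> borel_measurable (sph \<Otimes>\<^sub>M (sph :: 'a measure))"
    by (rule measurable_compose[OF measurable_fst measurable_ident_sphere])
  have [measurable]: "(\<lambda>p. snd p) \<in> borel_measurable (sph \<Otimes>\<^sub>M (sph :: 'a measure))"
    by (rule measurable_compose[OF measurable_snd measurable_ident_sphere])
  show ?thesis unfolding case_prod_beta' by measurable
qed

text \<open>
  Integrability on the product, for the use of Fubini's theorem with a zonal kernel.
\<close>

lemma integrable_zonal_product:
  fixes f g :: "'a::euclidean_space \<Rightarrow> real"
  assumes \<phi>: "zonal_kernel B \<phi>" and f: "integrable sph f" and g: "integrable sph g"
  shows "integrable (sph \<Otimes>\<^sub>M sph) (\<lambda>(x, y). g x * f y * \<phi> (x \<bullet> y))"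
proof -
  note zonal_kernelD(1)[OF \<phi>, measurable] measurable_zonal_pair[measurable]
  have [measurable]: "f \<in> borel_measurable sph" "g \<in> borel_measurable sph" using f g by auto
  have m [measurable]: "(\<lambda>(x, y). g x * f y * \<phi> (x \<bullet> y)) \<in> borel_measurable (sph \<Otimes>\<^sub>M sph)"
    by measurable
  have i: "integrable sph (\<lambda>y. g x * f y * \<phi> (x \<bullet> y))" if x: "norm x = 1" for x
  proof (rule Bochner_Integration.integrable_bound)
    show "integrable sph (\<lambda>y. B * \<bar>g x\<bar> * f y)" using f by simp
    show "AE y in sph. norm (g x * f y * \<phi> (x \<bullet> y)) \<le> norm (B * \<bar>g x\<bar> * f y)"
    proof (rule AE_I2)
      fix y :: 'a assume "y \<in> space sph"
      then show "norm (g x * f y * \<phi> (x \<bullet> y)) \<le> norm (B * \<bar>g x\<bar> * f y)"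
        using zonal_kernel_mult_le[OF \<phi> x, of y "g x * f y"] zonal_kernel_nonneg[OF \<phi>] by (simp add: abs_mult mult_ac)
    qed
  qed simp
  show ?thesis
  proof (rule sph2.Fubini_integrable)
    show "integrable sph (\<lambda>x. LINT y|sph. norm (case (x, y) of (x, y) \<Rightarrow> g x * f y * \<phi> (x \<bullet> y)))"
    proof (rule Bochner_Integration.integrable_bound)
      show "integrable sph (\<lambda>x. (B * (\<integral>y. \<bar>f y\<bar> \<partial>sph)) * g x)" using g by simp
      show "(\<lambda>x. LINT y|sph. norm (case (x, y) of (x, y) \<Rightarrow> g x * f y * \<phi> (x \<bullet> y))) \<in> borel_measurable sph"
        by (rule sph.borel_measurable_lebesgue_integral) measurable
      show "AE x in sph. norm (LINT y|sph. norm (case (x, y) of (x, y) \<Rightarrow> g x * f y * \<phi> (x \<bullet> y))) \<le>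
          norm ((B * (\<integral>y. \<bar>f y\<bar> \<partial>sph)) * g x)"
      proof (rule AE_I2)
        fix x :: 'a assume "x \<in> space sph"
        then have x: "norm x = 1" by simp
        have "(\<integral>y. \<bar>g x * f y * \<phi> (x \<bullet> y)\<bar> \<partial>sph) \<le> (\<integral>y. (B * \<bar>g x\<bar>) * \<bar>f y\<bar> \<partial>sph)"
        proof (rule integral_mono)
          show "integrable sph (\<lambda>y. \<bar>g x * f y * \<phi> (x \<bullet> y)\<bar>)" using i[OF x] by simp
          show "integrable sph (\<lambda>y. (B * \<bar>g x\<bar>) * \<bar>f y\<bar>)" using f by simp
          fix y :: 'a assume "y \<in> space sph"
          then show "\<bar>g x * f y * \<phi> (x \<bullet> y)\<bar> \<le> (B * \<bar>g x\<bar>) * \<bar>f y\<bar>"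
            using zonal_kernel_mult_le[OF \<phi> x, of y "g x * f y"] by (simp add: abs_mult mult_ac)
        qed
        then show "norm (LINT y|sph. norm (case (x, y) of (x, y) \<Rightarrow> g x * f y * \<phi> (x \<bullet> y))) \<le>
          norm ((B * (\<integral>y. \<bar>f y\<bar> \<partial>sph)) * g x)"
          using zonal_kernel_nonneg[OF \<phi>] by (simp add: abs_mult mult_ac)
      qed
    qed
    show "AE x in sph. integrable sph (\<lambda>y. case (x, y) of (x, y) \<Rightarrow> g x * f y * \<phi> (x \<bullet> y))"
      using i by (intro AE_I2) simp
  qed measurable
qed

lemma integrable_zonal_integrand:
  fixes f :: "'a::euclidean_space \<Rightarrow> real"
  assumes \<phi>: "zonal_kernel B \<phi>" and f: "integrable sph f" and x: "norm x = 1"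
  shows "integrable sph (\<lambda>y. f y * \<phi> (x \<bullet> y))"
proof (rule Bochner_Integration.integrable_bound)
  note zonal_kernelD(1)[OF \<phi>, measurable]
  have [measurable]: "f \<in> borel_measurable sph" using f by auto
  show "integrable sph (\<lambda>y. B * f y)" using f by simp
  show "AE y in sph. norm (f y * \<phi> (x \<bullet> y)) \<le> norm (B * f y)"
  proof (rule AE_I2)
    fix y :: 'a assume "y \<in> space sph"
    then show "norm (f y * \<phi> (x \<bullet> y)) \<le> norm (B * f y)"
      using zonal_kernel_mult_le[OF \<phi> x, of y "f y"] zonal_kernel_nonneg[OF \<phi>] by (simp add: abs_mult)
  qed
  show "(\<lambda>y. f y * \<phi> (x \<bullet> y)) \<in> borel_measurable sph" by measurable
qed

lemma zonal_conv_measurable: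
  fixes f :: "'a::euclidean_space \<Rightarrow> real"
  assumes [measurable]: "\<phi> \<in> borel_measurable borel" "f \<in> borel_measurable sph"
  shows "zonal_conv \<phi> f \<in> borel_measurable sph"
proof -
  note measurable_zonal_pair[measurable]
  show ?thesis unfolding zonal_conv_def[abs_def]
    by (rule sph.borel_measurable_lebesgue_integral) measurable
qed

lemma zonal_conv_bound:
  fixes f :: "'a::euclidean_space \<Rightarrow> real"
  assumes \<phi>: "zonal_kernel B \<phi>" and f: "integrable sph f" and x: "norm x = 1"
  shows "\<bar>zonal_conv \<phi> f x\<bar> \<le> B * (\<integral>y. \<bar>f y\<bar> \<partial>sph)"
proof -
  have "\<bar>zonal_conv \<phi> f x\<bar> \<le> (\<integral>y. \<bar>f y * \<phi> (x \<bullet> y)\<bar> \<partial>sph)"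
    unfolding zonal_conv_def by (rule integral_abs_bound)
  also have "\<dots> \<le> (\<integral>y. B * \<bar>f y\<bar> \<partial>sph)"
  proof (rule integral_mono)
    show "integrable sph (\<lambda>y. \<bar>f y * \<phi> (x \<bullet> y)\<bar>)"
      using integrable_zonal_integrand[OF assms] by simp
    show "integrable sph (\<lambda>y. B * \<bar>f y\<bar>)" using f by simp
    fix y :: 'a assume "y \<in> space sph"
    then show "\<bar>f y * \<phi> (x \<bullet> y)\<bar> \<le> B * \<bar>f y\<bar>"
      by (intro zonal_kernel_mult_le[OF \<phi> x]) simp
  qed
  finally show ?thesis by simp
qed

lemma integrable_bounded_sphere:
  fixes f :: "'a::euclidean_space \<Rightarrow> real"
  assumes "f \<in> borel_measurable sph" "\<And>x. norm x = 1 \<Longrightarrow> \<bar>f x\<bar> \<le> L"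
  shows "integrable sph f"
  by (rule sph.integrable_const_bound[where B = L]) (use assms in auto)

lemma integrable_zonal_conv:
  fixes f :: "'a::euclidean_space \<Rightarrow> real"
  assumes \<phi>: "zonal_kernel B \<phi>" and f: "integrable sph f"
  shows "integrable sph (zonal_conv \<phi> f)"
  using zonal_conv_measurable[OF zonal_kernelD(1)[OF \<phi>], of f] zonal_conv_bound[OF assms] f
  by (intro integrable_bounded_sphere) auto

lemma zonal_conv_cong:
  assumes "\<And>y. norm y = 1 \<Longrightarrow> f y = g y"
  shows "zonal_conv \<phi> f x = zonal_conv \<phi> g x"
  unfolding zonal_conv_def using assms by (intro Bochner_Integration.integral_cong) auto

lemma zonal_conv_diff:
  fixes f :: "'a::euclidean_space \<Rightarrow> real"
  assumes \<phi>: "zonal_kernel B \<phi>" and f: "integrable sph f" "integrable sph g" and x: "norm x = 1"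
  shows "zonal_conv \<phi> (\<lambda>y. f y - g y) x = zonal_conv \<phi> f x - zonal_conv \<phi> g x"
  unfolding zonal_conv_def
  using integrable_zonal_integrand[OF \<phi> f(1) x] integrable_zonal_integrand[OF \<phi> f(2) x]
  by (simp add: left_diff_distrib)

lemma zonal_conv_symmetric:
  fixes f g :: "'a::euclidean_space \<Rightarrow> real"
  assumes \<phi>: "zonal_kernel B \<phi>" and f: "integrable sph f" and g: "integrable sph g"
  shows "(\<integral>x. zonal_conv \<phi> f x * g x \<partial>sph) = (\<integral>x. f x * zonal_conv \<phi> g x \<partial>sph)"
proof -
  have "(\<integral>x. zonal_conv \<phi> f x * g x \<partial>sph) = (\<integral>x. (\<integral>y. g x * f y * \<phi> (x \<bullet> y) \<partial>sph) \<partial>sph)"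
    unfolding zonal_conv_def by (simp add: mult.assoc mult.commute[of _ "g _"])
  also have "\<dots> = (\<integral>y. (\<integral>x. g x * f y * \<phi> (x \<bullet> y) \<partial>sph) \<partial>sph)"
    using sph2.Fubini_integral[OF integrable_zonal_product[OF assms]] by simp
  also have "\<dots> = (\<integral>x. f x * zonal_conv \<phi> g x \<partial>sph)"
    unfolding zonal_conv_def
    by (simp add: inner_commute mult.assoc mult.left_commute[of _ "f _"])
  finally show ?thesis .
qed

lemma zonal_conv_reflection:
  fixes f :: "'a::euclidean_space \<Rightarrow> real"
  assumes "\<phi> \<in> borel_measurable borel" "f \<in> borel_measurable sph" and v: "norm v = 1"
  shows "zonal_conv \<phi> f (reflection v x) = zonal_conv \<phi> (\<lambda>y. f (reflection v y)) x"
proof -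
  note orth = orthogonal_reflection[OF v]
  note assms(1,2)[measurable]
  have "zonal_conv \<phi> (\<lambda>y. f (reflection v y)) x =
      (\<integral>y. f (reflection v y) * \<phi> (reflection v x \<bullet> reflection v y) \<partial>sph)"
    using orth unfolding zonal_conv_def orthogonal_transformation_def by simp
  also have "\<dots> = zonal_conv \<phi> f (reflection v x)"
    unfolding zonal_conv_def using assms
    by (intro integral_sphere_orthogonal[OF orth, of "\<lambda>y. f y * \<phi> (reflection v x \<bullet> y)"]) measurable
  finally show ?thesis by simp
qed

text \<open>
  The kernel of the composition is \<open>\<integral>z. \<phi> (x \<bullet> z) * \<psi> (z \<bullet> y)\<close>. It is symmetric in \<open>x\<close> and \<open>y\<close>, because
  the reflection that exchanges \<open>x\<close> and \<open>y\<close> preserves the measure; and exchanging \<open>x\<close> with \<open>y\<close> amounts to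
  exchanging \<open>\<phi>\<close> with \<open>\<psi>\<close>.
\<close>

lemma zonal_conv_commute:
  fixes f :: "'a::euclidean_space \<Rightarrow> real"
  assumes \<phi>: "zonal_kernel B \<phi>" and \<psi>: "zonal_kernel B' \<psi>" and f: "integrable sph f" and x: "norm x = 1"
  shows "zonal_conv \<phi> (zonal_conv \<psi> f) x = zonal_conv \<psi> (zonal_conv \<phi> f) x"
proof -
  note zonal_kernelD(1)[OF \<phi>, measurable] zonal_kernelD(1)[OF \<psi>, measurable]
  have [measurable]: "f \<in> borel_measurable sph" using f by auto
  define A where "A = (\<lambda>(\<phi> :: real \<Rightarrow> real) (\<psi> :: real \<Rightarrow> real) y. \<integral>z. \<phi> (x \<bullet> z) * \<psi> (z \<bullet> y) \<partial>(sph :: 'a measure))"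
  have rep: "zonal_conv \<phi> (zonal_conv \<psi> f) x = (\<integral>y. f y * A \<phi> \<psi> y \<partial>sph)"
    if \<phi>: "zonal_kernel B \<phi>" and \<psi>: "zonal_kernel B' \<psi>" for B B' \<phi> \<psi>
  proof -
    have g: "integrable sph (\<lambda>z. \<phi> (x \<bullet> z))"
      using integrable_zonal_integrand[OF \<phi>, of "\<lambda>_. 1"] x by simp
    have "zonal_conv \<phi> (zonal_conv \<psi> f) x = (\<integral>z. (\<integral>y. \<phi> (x \<bullet> z) * f y * \<psi> (z \<bullet> y) \<partial>sph) \<partial>sph)"
      unfolding zonal_conv_def by (simp add: mult.assoc mult.commute[of _ "\<phi> _"])
    also have "\<dots> = (\<integral>y. (\<integral>z. \<phi> (x \<bullet> z) * f y * \<psi> (z \<bullet> y) \<partial>sph) \<partial>sph)"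
      using sph2.Fubini_integral[OF integrable_zonal_product[OF \<psi> f g]] by simp
    also have "\<dots> = (\<integral>y. f y * A \<phi> \<psi> y \<partial>sph)"
      unfolding A_def by (simp add: mult.assoc mult.left_commute[of _ "f _"])
    finally show ?thesis .
  qed
  have "A \<phi> \<psi> y = A \<psi> \<phi> y" if y: "norm y = 1" for y
  proof (cases "x = y")
    case True
    then show ?thesis unfolding A_def by (simp add: inner_commute mult.commute)
  next
    case False
    then obtain v where v: "norm v = 1" "reflection v x = y"
      using x y by (auto elim: reflection_exchanges[rotated])
    have v': "reflection v y = x" using reflection_reflection[OF v(1), of x] v(2) by simp
    have "A \<phi> \<psi> y = (\<integral>z. \<phi> (x \<bullet> reflection v z) * \<psi> (reflection v z \<bullet> y) \<partial>(sph :: 'a measure))"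
      unfolding A_def
      by (rule integral_sphere_orthogonal[OF orthogonal_reflection[OF v(1)],
            of "\<lambda>z. \<phi> (x \<bullet> z) * \<psi> (z \<bullet> y)", symmetric])
        (simp add: inner_commute[of _ y])
    also have "\<dots> = (\<integral>z. \<phi> (y \<bullet> z) * \<psi> (z \<bullet> x) \<partial>(sph :: 'a measure))"
      by (simp add: inner_reflection[OF v(1)] inner_reflection[OF v(1), symmetric] v v')
    also have "\<dots> = A \<psi> \<phi> y" unfolding A_def by (simp add: inner_commute mult.commute)
    finally show ?thesis .
  qed
  then show ?thesis
    unfolding rep[OF \<phi> \<psi>] rep[OF \<psi> \<phi>]
    by (intro Bochner_Integration.integral_cong) auto
qed

lemma zonal_integral_indep:
  fixes x e :: "'a::euclidean_space"
  assumes [measurable]: "\<phi> \<in> borel_measurable borel" and x: "norm x = 1" and e: "norm e = 1"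
  shows "(\<integral>y. \<phi> (x \<bullet> y) \<partial>sph) = (\<integral>y. (\<phi> (e \<bullet> y) :: real) \<partial>sph)"
proof (cases "x = e")
  case False
  then obtain v where v: "norm v = 1" "reflection v x = e"
    using x e by (auto elim: reflection_exchanges[rotated])
  have "(\<integral>y. \<phi> (x \<bullet> y) \<partial>sph) = (\<integral>y. \<phi> (x \<bullet> reflection v y) \<partial>sph)"
    by (rule integral_sphere_orthogonal[OF orthogonal_reflection[OF v(1)],
          of "\<lambda>y. \<phi> (x \<bullet> y)", symmetric]) simp
  then show ?thesis by (simp add: inner_reflection[OF v(1), symmetric] v)
qed simp

lemma integral_zonal:
  fixes e :: "'a::euclidean_space"
  assumes [measurable]: "\<phi> \<in> borel_measurable borel" and e: "norm e = 1" and dim: "2 \<le> DIM('a)"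
    and nonneg: "\<And>t. \<bar>t\<bar> \<le> 1 \<Longrightarrow> 0 \<le> \<phi> t"
  shows "(\<integral>y. \<phi> (e \<bullet> y) \<partial>(sph :: 'a measure)) = sphere_area (DIM('a) - 1) *
     (LINT \<theta>:{0..pi}|lborel. \<phi> (cos \<theta>) * sin \<theta> ^ (DIM('a) - 2))"
proof -
  have C: "0 \<le> sphere_area (DIM('a) - 1)" by (simp add: sphere_area_def)
  have "(\<integral>y. \<phi> (e \<bullet> y) \<partial>(sph :: 'a measure)) = enn2real (\<integral>\<^sup>+y. ennreal (\<phi> (e \<bullet> y)) \<partial>(sph :: 'a measure))"
    using nonneg abs_inner_sphere[OF e] by (intro integral_eq_nn_integral) auto
  also have "(\<integral>\<^sup>+y. ennreal (\<phi> (e \<bullet> y)) \<partial>(sph :: 'a measure)) = ennreal (sphere_area (DIM('a) - 1)) *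
      (\<integral>\<^sup>+\<theta>. ennreal (\<phi> (cos \<theta>)) * ennreal (sin \<theta> ^ (DIM('a) - 2)) * indicator {0<..<pi} \<theta> \<partial>lborel)"
    by (rule nn_integral_zonal[OF e dim]) simp
  also have "(\<integral>\<^sup>+\<theta>. ennreal (\<phi> (cos \<theta>)) * ennreal (sin \<theta> ^ (DIM('a) - 2)) * indicator {0<..<pi} \<theta> \<partial>lborel) =
     (\<integral>\<^sup>+\<theta>. ennreal (indicator {0..pi} \<theta> * (\<phi> (cos \<theta>) * sin \<theta> ^ (DIM('a) - 2))) \<partial>lborel)"
  proof (rule nn_integral_cong_AE)
    have "AE \<theta> in lborel. \<theta> \<notin> {0, pi}"
      by (intro AE_not_in countable_imp_null_set_lborel) auto
    then show "AE \<theta> in lborel. ennreal (\<phi> (cos \<theta>)) * ennreal (sin \<theta> ^ (DIM('a) - 2)) * indicator {0<..<pi} \<theta> =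
       ennreal (indicator {0..pi} \<theta> * (\<phi> (cos \<theta>) * sin \<theta> ^ (DIM('a) - 2)))"
    proof eventually_elim
      case (elim \<theta>)
      show ?case
      proof (cases "\<theta> \<in> {0<..<pi}")
        case True
        then show ?thesis using nonneg[of "cos \<theta>"] by (simp add: ennreal_mult sin_ge_zero)
      next
        case False
        with elim have "\<theta> \<notin> {0..pi}" by auto
        with False show ?thesis by simp
      qed
    qed
  qed
  also have "enn2real (ennreal (sphere_area (DIM('a) - 1)) * \<dots>) = sphere_area (DIM('a) - 1) * enn2real \<dots>"
    using C by (simp add: enn2real_mult)
  also have "enn2real (\<integral>\<^sup>+\<theta>. ennreal (indicator {0..pi} \<theta> * (\<phi> (cos \<theta>) * sin \<theta> ^ (DIM('a) - 2))) \<partial>lborel) =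
      (LINT \<theta>:{0..pi}|lborel. \<phi> (cos \<theta>) * sin \<theta> ^ (DIM('a) - 2))"
    unfolding set_lebesgue_integral_def real_scaleR_def
    by (rule integral_eq_nn_integral[symmetric])
      (auto simp: indicator_def nonneg sin_ge_zero)
  finally show ?thesis .
qed

section \<open>The Dirichlet form of a zonal kernel\<close>

definition bounded_on_sphere :: "('a::euclidean_space \<Rightarrow> real) \<Rightarrow> bool" where
  "bounded_on_sphere H \<longleftrightarrow> H \<in> borel_measurable sph \<and> (\<exists>L. \<forall>x. norm x = 1 \<longrightarrow> \<bar>H x\<bar> \<le> L)"

lemma bounded_on_sphereI:
  "\<lbrakk>H \<in> borel_measurable sph; \<And>x. norm x = 1 \<Longrightarrow> \<bar>H x\<bar> \<le> L\<rbrakk> \<Longrightarrow> bounded_on_sphere H"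
  by (auto simp: bounded_on_sphere_def)

lemma bounded_on_sphere_integrable: "bounded_on_sphere H \<Longrightarrow> integrable sph H"
  by (auto simp: bounded_on_sphere_def intro: integrable_bounded_sphere)

lemma bounded_on_sphere_measurable: "bounded_on_sphere H \<Longrightarrow> H \<in> borel_measurable sph"
  by (simp add: bounded_on_sphere_def)

lemma bounded_on_sphere_const: "bounded_on_sphere (\<lambda>_. c)"
  by (rule bounded_on_sphereI[where L = "\<bar>c\<bar>"]) auto

lemma bounded_on_sphere_diff:
  assumes "bounded_on_sphere H" "bounded_on_sphere G"
  shows "bounded_on_sphere (\<lambda>x. H x - G x)"
proof -
  obtain L L' where "\<And>x. norm x = 1 \<Longrightarrow> \<bar>H x\<bar> \<le> L" "\<And>x. norm x = 1 \<Longrightarrow> \<bar>G x\<bar> \<le> L'"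
    using assms by (auto simp: bounded_on_sphere_def)
  then have "\<bar>H x - G x\<bar> \<le> L + L'" if "norm x = 1" for x using that by (smt (verit))
  with assms show ?thesis by (intro bounded_on_sphereI[where L = "L + L'"]) (auto simp: bounded_on_sphere_def)
qed

lemma bounded_on_sphere_mult:
  assumes "bounded_on_sphere H" "bounded_on_sphere G"
  shows "bounded_on_sphere (\<lambda>x. H x * G x)"
proof -
  obtain L L' where *: "\<And>x. norm x = 1 \<Longrightarrow> \<bar>H x\<bar> \<le> L" "\<And>x. norm x = 1 \<Longrightarrow> \<bar>G x\<bar> \<le> L'"
    using assms by (auto simp: bounded_on_sphere_def)
  have "\<bar>H x * G x\<bar> \<le> L * L'" if "norm x = 1" for x
    unfolding abs_mult using *(1)[OF that] *(2)[OF that] by (intro mult_mono) auto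
  with assms show ?thesis by (intro bounded_on_sphereI[where L = "L * L'"]) (auto simp: bounded_on_sphere_def)
qed

lemma bounded_on_sphere_power2:
  "bounded_on_sphere H \<Longrightarrow> bounded_on_sphere (\<lambda>x. (H x)\<^sup>2)"
  unfolding power2_eq_square by (rule bounded_on_sphere_mult)

lemma bounded_on_sphere_inner: "bounded_on_sphere (\<lambda>x. v \<bullet> x)"
proof (rule bounded_on_sphereI)
  show "(\<lambda>x. v \<bullet> x) \<in> borel_measurable sph"
    by (rule borel_measurable_inner[OF _ measurable_ident_sphere]) simp
  show "\<bar>v \<bullet> x\<bar> \<le> norm v" if "norm x = 1" for x
    using Cauchy_Schwarz_ineq2[of v x] that by simp
qed

lemma bounded_on_sphere_zonal_conv:
  assumes "zonal_kernel B \<phi>" "integrable sph f"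
  shows "bounded_on_sphere (zonal_conv \<phi> f)"
  using zonal_conv_measurable[OF zonal_kernelD(1)[OF assms(1)], of f] zonal_conv_bound[OF assms] assms(2)
  by (intro bounded_on_sphereI) auto

lemmas bounded_on_sphere_intros =
  bounded_on_sphere_const bounded_on_sphere_diff bounded_on_sphere_mult bounded_on_sphere_power2
  bounded_on_sphere_zonal_conv bounded_on_sphere_integrable bounded_on_sphere_inner

definition dirichlet :: "(real \<Rightarrow> real) \<Rightarrow> ('a::euclidean_space \<Rightarrow> real) \<Rightarrow> real" where
  "dirichlet \<phi> H = (\<integral>x. (\<integral>y. (H x - H y)\<^sup>2 * \<phi> (x \<bullet> y) \<partial>sph) \<partial>sph)"

text \<open>
  By rotation invariance every kernel has such an \<open>m\<close>; naming it avoids a choice of base point.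
\<close>

definition zonal_mass :: "'a::euclidean_space itself \<Rightarrow> (real \<Rightarrow> real) \<Rightarrow> real \<Rightarrow> bool" where
  "zonal_mass TYPE('a) \<phi> m \<longleftrightarrow> (\<forall>x::'a. norm x = 1 \<longrightarrow> (\<integral>y. \<phi> (x \<bullet> y) \<partial>sph) = m)"

lemma zonal_massD: "\<lbrakk>zonal_mass TYPE('a) \<phi> m; norm (x::'a::euclidean_space) = 1\<rbrakk> \<Longrightarrow> (\<integral>y. \<phi> (x \<bullet> y) \<partial>sph) = m"
  by (simp add: zonal_mass_def)

lemma integral_zonal_conv:
  fixes f :: "'a::euclidean_space \<Rightarrow> real"
  assumes \<phi>: "zonal_kernel B \<phi>" and m: "zonal_mass TYPE('a) \<phi> m" and f: "integrable sph f"
  shows "(\<integral>x. zonal_conv \<phi> f x \<partial>sph) = m * (\<integral>x. f x \<partial>sph)"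
proof -
  have "(\<integral>x. zonal_conv \<phi> f x \<partial>sph) = (\<integral>x. f x * zonal_conv \<phi> (\<lambda>_. 1) x \<partial>sph)"
    using zonal_conv_symmetric[OF \<phi> f, of "\<lambda>_. 1"] by simp
  also have "\<dots> = (\<integral>x. f x * m \<partial>sph)"
    by (intro Bochner_Integration.integral_cong refl) (simp add: zonal_conv_def zonal_massD[OF m])
  finally show ?thesis by simp
qed

lemma dirichlet_inner:
  fixes H :: "'a::euclidean_space \<Rightarrow> real"
  assumes \<phi>: "zonal_kernel B \<phi>" and m: "zonal_mass TYPE('a) \<phi> m" and H: "bounded_on_sphere H"
    and x: "norm x = 1"
  shows "(\<integral>y. (H x - H y)\<^sup>2 * \<phi> (x \<bullet> y) \<partial>sph) =
    (H x)\<^sup>2 * m - 2 * (zonal_conv \<phi> H x * H x) + zonal_conv \<phi> (\<lambda>y. (H y)\<^sup>2) x"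
proof -
  note i = integrable_zonal_integrand[OF \<phi> _ x]
  have i1: "integrable sph (\<lambda>y. \<phi> (x \<bullet> y))" using i[of "\<lambda>_. 1"] by simp
  have i2: "integrable sph (\<lambda>y. H y * \<phi> (x \<bullet> y))" by (intro i bounded_on_sphere_intros H)
  have i3: "integrable sph (\<lambda>y. (H y)\<^sup>2 * \<phi> (x \<bullet> y))" by (intro i bounded_on_sphere_intros H)
  have "(\<integral>y. (H x - H y)\<^sup>2 * \<phi> (x \<bullet> y) \<partial>sph) =
      (\<integral>y. (H x)\<^sup>2 * \<phi> (x \<bullet> y) - 2 * H x * (H y * \<phi> (x \<bullet> y)) + (H y)\<^sup>2 * \<phi> (x \<bullet> y) \<partial>sph)"
    by (intro Bochner_Integration.integral_cong refl) (simp add: power2_eq_square algebra_simps)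
  also have "\<dots> = (H x)\<^sup>2 * m - 2 * H x * zonal_conv \<phi> H x + zonal_conv \<phi> (\<lambda>y. (H y)\<^sup>2) x"
    using i1 i2 i3 zonal_massD[OF m x] by (simp add: zonal_conv_def)
  finally show ?thesis by simp
qed

text \<open>
  Expanding the square; for a kernel of mass \<open>1\<close> the form is twice the quadratic form of the identity minus the
  convolution operator.
\<close>

lemma dirichlet_eq:
  fixes H :: "'a::euclidean_space \<Rightarrow> real"
  assumes \<phi>: "zonal_kernel B \<phi>" and m: "zonal_mass TYPE('a) \<phi> m" and H: "bounded_on_sphere H"
  shows "dirichlet \<phi> H = 2 * (m * (\<integral>x. (H x)\<^sup>2 \<partial>sph) - (\<integral>x. zonal_conv \<phi> H x * H x \<partial>sph))"
proof -
  have i1: "integrable sph (\<lambda>x. (H x)\<^sup>2)" by (intro bounded_on_sphere_intros H)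
  have i2: "integrable sph (\<lambda>x. zonal_conv \<phi> H x * H x)"
    by (intro bounded_on_sphere_intros bounded_on_sphere_zonal_conv[OF \<phi>] H)
  have i3: "integrable sph (zonal_conv \<phi> (\<lambda>y. (H y)\<^sup>2))"
    by (intro bounded_on_sphere_intros bounded_on_sphere_zonal_conv[OF \<phi>] H)
  have "dirichlet \<phi> H = (\<integral>x. (H x)\<^sup>2 * m - 2 * (zonal_conv \<phi> H x * H x) + zonal_conv \<phi> (\<lambda>y. (H y)\<^sup>2) x \<partial>sph)"
    unfolding dirichlet_def
    by (intro Bochner_Integration.integral_cong refl) (simp add: dirichlet_inner[OF \<phi> m H])
  also have "\<dots> = (\<integral>x. (H x)\<^sup>2 \<partial>sph) * m - 2 * (\<integral>x. zonal_conv \<phi> H x * H x \<partial>sph) + m * (\<integral>x. (H x)\<^sup>2 \<partial>sph)"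
    using i1 i2 i3 integral_zonal_conv[OF \<phi> m i1] by simp
  finally show ?thesis by (simp add: algebra_simps)
qed

lemma integrable_dirichlet:
  fixes H :: "'a::euclidean_space \<Rightarrow> real"
  assumes \<phi>: "zonal_kernel B \<phi>" and H: "bounded_on_sphere H"
  shows "integrable sph (\<lambda>x. \<integral>y. (H x - H y)\<^sup>2 * \<phi> (x \<bullet> y) \<partial>sph)"
    and "norm x = 1 \<Longrightarrow> integrable sph (\<lambda>y. (H x - H y)\<^sup>2 * \<phi> (x \<bullet> y))"
proof -
  obtain e :: 'a where e: "norm e = 1" using vector_choose_size[of 1] by auto
  define m where "m = (\<integral>y. \<phi> (e \<bullet> y) \<partial>sph)"
  have m: "zonal_mass TYPE('a) \<phi> m"
    unfolding m_def zonal_mass_def using zonal_integral_indep[OF zonal_kernelD(1)[OF \<phi>] _ e] by auto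
  have "integrable sph (\<lambda>x. (H x)\<^sup>2 * m - (2 * (zonal_conv \<phi> H x * H x) - zonal_conv \<phi> (\<lambda>y. (H y)\<^sup>2) x))"
    by (intro bounded_on_sphere_intros bounded_on_sphere_zonal_conv[OF \<phi>] H)
  then show "integrable sph (\<lambda>x. \<integral>y. (H x - H y)\<^sup>2 * \<phi> (x \<bullet> y) \<partial>sph)"
    by (subst Bochner_Integration.integrable_cong[OF refl]) (auto simp: dirichlet_inner[OF \<phi> m H])
  show "integrable sph (\<lambda>y. (H x - H y)\<^sup>2 * \<phi> (x \<bullet> y))" if "norm x = 1"
    by (intro integrable_zonal_integrand[OF \<phi> _ that] bounded_on_sphere_intros H)
qed

text \<open>
  On the sphere \<open>x \<bullet> y = 1\<close> means \<open>x = y\<close>, where the integrand of the Dirichlet form vanishes. So the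
  kernels need not be compared at \<open>t = 1\<close>, which matters because there the quotient of sines
  takes the conventional value \<open>0\<close>.
\<close>

lemma dirichlet_mono:
  fixes H :: "'a::euclidean_space \<Rightarrow> real"
  assumes \<phi>: "zonal_kernel B \<phi>" and \<psi>: "zonal_kernel B' \<psi>" and H: "bounded_on_sphere H"
    and le: "\<And>t. \<lbrakk>-1 \<le> t; t < 1\<rbrakk> \<Longrightarrow> c * \<psi> t \<le> \<phi> t"
  shows "c * dirichlet \<psi> H \<le> dirichlet \<phi> H"
proof -
  have "(\<integral>x. c * (\<integral>y. (H x - H y)\<^sup>2 * \<psi> (x \<bullet> y) \<partial>sph) \<partial>sph) \<le>
      (\<integral>x. (\<integral>y. (H x - H y)\<^sup>2 * \<phi> (x \<bullet> y) \<partial>sph) \<partial>sph)"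
  proof (rule integral_mono)
    show "integrable sph (\<lambda>x. c * (\<integral>y. (H x - H y)\<^sup>2 * \<psi> (x \<bullet> y) \<partial>sph))"
      using integrable_dirichlet(1)[OF \<psi> H] by simp
    show "integrable sph (\<lambda>x. (\<integral>y. (H x - H y)\<^sup>2 * \<phi> (x \<bullet> y) \<partial>sph))"
      by (rule integrable_dirichlet(1)[OF \<phi> H])
    fix x :: 'a assume "x \<in> space sph"
    then have x: "norm x = 1" by simp
    have "(\<integral>y. c * ((H x - H y)\<^sup>2 * \<psi> (x \<bullet> y)) \<partial>sph) \<le> (\<integral>y. (H x - H y)\<^sup>2 * \<phi> (x \<bullet> y) \<partial>sph)"
    proof (rule integral_mono)
      fix y :: 'a assume "y \<in> space sph"
      then have y: "norm y = 1" by simp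
      show "c * ((H x - H y)\<^sup>2 * \<psi> (x \<bullet> y)) \<le> (H x - H y)\<^sup>2 * \<phi> (x \<bullet> y)"
      proof (cases "x = y")
        case False
        have "x \<bullet> y \<noteq> 1"
        proof
          assume "x \<bullet> y = 1"
          then have "(norm (x - y))\<^sup>2 = 0"
            using x y by (simp add: power2_norm_eq_inner inner_diff_left inner_diff_right inner_commute norm_eq_1)
          with False show False by simp
        qed
        then have "c * \<psi> (x \<bullet> y) \<le> \<phi> (x \<bullet> y)"
          using abs_inner_sphere[OF x y] by (intro le) auto
        then have "(H x - H y)\<^sup>2 * (c * \<psi> (x \<bullet> y)) \<le> (H x - H y)\<^sup>2 * \<phi> (x \<bullet> y)"
          by (intro mult_left_mono) auto
        then show ?thesis by (simp add: mult.left_commute)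
      qed simp
    qed (use integrable_dirichlet(2)[OF \<psi> H x] integrable_dirichlet(2)[OF \<phi> H x] in auto)
    then show "c * (\<integral>y. (H x - H y)\<^sup>2 * \<psi> (x \<bullet> y) \<partial>sph) \<le> (\<integral>y. (H x - H y)\<^sup>2 * \<phi> (x \<bullet> y) \<partial>sph)"
      by simp
  qed
  then show ?thesis by (simp add: dirichlet_def)
qed

lemma dirichlet_le:
  fixes H :: "'a::euclidean_space \<Rightarrow> real"
  assumes \<phi>: "zonal_kernel B \<phi>" and m: "zonal_mass TYPE('a) \<phi> m" and H: "bounded_on_sphere H"
    and nonneg: "\<And>t. \<bar>t\<bar> \<le> 1 \<Longrightarrow> 0 \<le> \<phi> t"
  shows "dirichlet \<phi> H \<le> 4 * m * (\<integral>x. (H x)\<^sup>2 \<partial>sph)"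
proof -
  have i2: "integrable sph (\<lambda>x. (H x)\<^sup>2)" by (intro bounded_on_sphere_intros H)
  have i3: "integrable sph (zonal_conv \<phi> (\<lambda>y. (H y)\<^sup>2))"
    by (intro bounded_on_sphere_intros bounded_on_sphere_zonal_conv[OF \<phi>] H)
  have "dirichlet \<phi> H \<le> (\<integral>x. 2 * m * (H x)\<^sup>2 + 2 * zonal_conv \<phi> (\<lambda>y. (H y)\<^sup>2) x \<partial>sph)"
    unfolding dirichlet_def
  proof (rule integral_mono)
    show "integrable sph (\<lambda>x. \<integral>y. (H x - H y)\<^sup>2 * \<phi> (x \<bullet> y) \<partial>sph)"
      by (rule integrable_dirichlet(1)[OF \<phi> H])
    show "integrable sph (\<lambda>x. 2 * m * (H x)\<^sup>2 + 2 * zonal_conv \<phi> (\<lambda>y. (H y)\<^sup>2) x)"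
      using i2 i3 by simp
    fix x :: 'a assume "x \<in> space sph"
    then have x: "norm x = 1" by simp
    have i1: "integrable sph (\<lambda>y. \<phi> (x \<bullet> y))" using integrable_zonal_integrand[OF \<phi> _ x, of "\<lambda>_. 1"] by simp
    have i4: "integrable sph (\<lambda>y. (H y)\<^sup>2 * \<phi> (x \<bullet> y))" by (rule integrable_zonal_integrand[OF \<phi> i2 x])
    have "(\<integral>y. (H x - H y)\<^sup>2 * \<phi> (x \<bullet> y) \<partial>sph) \<le>
        (\<integral>y. 2 * (H x)\<^sup>2 * \<phi> (x \<bullet> y) + 2 * ((H y)\<^sup>2 * \<phi> (x \<bullet> y)) \<partial>sph)"
    proof (rule integral_mono)
      fix y :: 'a assume "y \<in> space sph"
      then have "0 \<le> \<phi> (x \<bullet> y)" using abs_inner_sphere[OF x, of y] nonneg by simp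
      moreover have "(H x - H y)\<^sup>2 \<le> 2 * (H x)\<^sup>2 + 2 * (H y)\<^sup>2"
        using zero_le_power2[of "H x + H y"] by (simp add: power2_eq_square algebra_simps)
      ultimately have "(H x - H y)\<^sup>2 * \<phi> (x \<bullet> y) \<le> (2 * (H x)\<^sup>2 + 2 * (H y)\<^sup>2) * \<phi> (x \<bullet> y)"
        by (intro mult_right_mono)
      then show "(H x - H y)\<^sup>2 * \<phi> (x \<bullet> y) \<le> 2 * (H x)\<^sup>2 * \<phi> (x \<bullet> y) + 2 * ((H y)\<^sup>2 * \<phi> (x \<bullet> y))"
        by (simp add: algebra_simps)
    qed (use i1 i4 integrable_dirichlet(2)[OF \<phi> H x] in auto)
    also have "\<dots> = 2 * m * (H x)\<^sup>2 + 2 * zonal_conv \<phi> (\<lambda>y. (H y)\<^sup>2) x"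
      using i1 i4 zonal_massD[OF m x] by (simp add: zonal_conv_def)
    finally show "(\<integral>y. (H x - H y)\<^sup>2 * \<phi> (x \<bullet> y) \<partial>sph) \<le> 2 * m * (H x)\<^sup>2 + 2 * zonal_conv \<phi> (\<lambda>y. (H y)\<^sup>2) x" .
  qed
  also have "\<dots> = 4 * m * (\<integral>x. (H x)\<^sup>2 \<partial>sph)"
    using i2 i3 integral_zonal_conv[OF \<phi> m i2] by simp
  finally show ?thesis .
qed

text \<open>
  On functions of mean zero, convolution with \<open>g\<close> and with \<open>g - 1\<close> agree. The kernel \<open>1 - g\<close> is nonnegative,
  so its operator norm is at most its mass, the total area minus \<open>m\<close>. The bound is useful when \<open>g\<close> fills more than half of the sphere.
\<close>

lemma dirichlet_mean_zero:
  fixes H :: "'a::euclidean_space \<Rightarrow> real"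
  assumes g: "zonal_kernel B g" and m: "zonal_mass TYPE('a) g m" and H: "bounded_on_sphere H"
    and le1: "\<And>t. \<bar>t\<bar> \<le> 1 \<Longrightarrow> g t \<le> 1" and mean: "(\<integral>x. H x \<partial>sph) = 0"
  shows "2 * (2 * m - measure (sph :: 'a measure) (sphere 0 1)) * (\<integral>x. (H x)\<^sup>2 \<partial>sph) \<le> dirichlet g H"
proof -
  let ?A = "measure (sph :: 'a measure) (sphere 0 1)"
  \<comment> \<open>Splitting the constant kernel, which annihilates \<open>H\<close>, into \<open>g\<close> and its complement.\<close>
  define g' where "g' = (\<lambda>t. 1 - g t)"
  have g': "zonal_kernel (1 + B) g'"
    using zonal_kernelD[OF g] unfolding zonal_kernel_def g'_def
    by (auto intro!: borel_measurable_diff) (smt (verit))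
  have i1: "integrable sph (\<lambda>y. g (x \<bullet> y))" if "norm x = 1" for x :: 'a
    using integrable_zonal_integrand[OF g _ that, of "\<lambda>_. 1"] by simp
  have m': "zonal_mass TYPE('a) g' (?A - m)"
    unfolding zonal_mass_def g'_def using i1 zonal_massD[OF m] by simp
  have conv: "zonal_conv g' H x = - zonal_conv g H x" if "norm x = 1" for x
    using integrable_zonal_integrand[OF g _ that, of H] bounded_on_sphere_integrable[OF H] mean
    by (simp add: zonal_conv_def g'_def right_diff_distrib)
  have "(\<integral>x. zonal_conv g' H x * H x \<partial>sph) = (\<integral>x. - (zonal_conv g H x * H x) \<partial>sph)"
    by (intro Bochner_Integration.integral_cong refl) (simp add: conv)
  then have "(\<integral>x. zonal_conv g' H x * H x \<partial>sph) = - (\<integral>x. zonal_conv g H x * H x \<partial>sph)" by simp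
  moreover have "dirichlet g' H \<le> 4 * (?A - m) * (\<integral>x. (H x)\<^sup>2 \<partial>sph)"
    by (rule dirichlet_le[OF g' m' H]) (simp add: g'_def le1)
  ultimately show ?thesis
    unfolding dirichlet_eq[OF g m H] dirichlet_eq[OF g' m' H] by (simp add: algebra_simps)
qed

text \<open>
  Linear functions are eigenfunctions: split \<open>v\<close> into a multiple of \<open>x\<close> and a vector \<open>u\<close> orthogonal to \<open>x\<close>;
  reflecting along \<open>u\<close> fixes \<open>x\<close> and shows that \<open>u\<close> contributes nothing.
\<close>

lemma zonal_conv_linear:
  fixes v e x :: "'a::euclidean_space"
  assumes \<phi>: "zonal_kernel B \<phi>" and x: "norm x = 1" and e: "norm e = 1"
  shows "zonal_conv \<phi> (\<lambda>y. v \<bullet> y) x = (\<integral>y. (e \<bullet> y) * \<phi> (e \<bullet> y) \<partial>sph) * (v \<bullet> x)"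
proof -
  note zonal_kernelD(1)[OF \<phi>, measurable]
  define u where "u = v - (v \<bullet> x) *\<^sub>R x"
  have ux: "u \<bullet> x = 0" using x by (simp add: u_def inner_diff_left dot_square_norm)
  have int: "integrable sph (\<lambda>y. (w \<bullet> y) * \<phi> (x \<bullet> y))" for w
    by (intro integrable_zonal_integrand[OF \<phi> _ x] bounded_on_sphere_intros)
  have u0: "(\<integral>y. (u \<bullet> y) * \<phi> (x \<bullet> y) \<partial>sph) = 0"
  proof (cases "u = 0")
    case False
    define w where "w = u /\<^sub>R norm u"
    have w: "norm w = 1" using False by (simp add: w_def)
    have "reflection w x = x" using ux by (simp add: reflection_def w_def)
    moreover have "reflection w u = - u"
      using False by (simp add: reflection_def w_def dot_square_norm power2_eq_square algebra_simps)
        (simp add: scaleR_2[symmetric])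
    ultimately have "(\<integral>y. (u \<bullet> reflection w y) * \<phi> (x \<bullet> reflection w y) \<partial>sph) =
        - (\<integral>y. (u \<bullet> y) * \<phi> (x \<bullet> y) \<partial>sph)"
      by (simp add: inner_reflection[OF w, symmetric])
    moreover have "(\<lambda>y. (u \<bullet> y) * \<phi> (x \<bullet> y)) \<in> borel_measurable sph" using int by blast
    ultimately show ?thesis
      using integral_sphere_orthogonal[OF orthogonal_reflection[OF w], of "\<lambda>y. (u \<bullet> y) * \<phi> (x \<bullet> y)"] by simp
  qed simp
  have "zonal_conv \<phi> (\<lambda>y. v \<bullet> y) x = (\<integral>y. (v \<bullet> x) * ((x \<bullet> y) * \<phi> (x \<bullet> y)) + (u \<bullet> y) * \<phi> (x \<bullet> y) \<partial>sph)"
    unfolding zonal_conv_def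
    by (intro Bochner_Integration.integral_cong refl) (simp add: u_def inner_diff_left algebra_simps)
  also have "\<dots> = (v \<bullet> x) * (\<integral>y. (x \<bullet> y) * \<phi> (x \<bullet> y) \<partial>sph)"
    using int[of x] int[of u] u0 by simp
  also have "(\<integral>y. (x \<bullet> y) * \<phi> (x \<bullet> y) \<partial>sph) = (\<integral>y. (e \<bullet> y) * \<phi> (e \<bullet> y) \<partial>sph)"
    by (rule zonal_integral_indep[OF _ x e, of "\<lambda>t. t * \<phi> t"]) simp
  finally show ?thesis by simp
qed

section \<open>The spectral gap on odd functions\<close>

lemma odd_integral_zero:
  fixes H :: "'a::euclidean_space \<Rightarrow> real"
  assumes H: "integrable sph H" and v: "norm v = 1"
    and odd: "\<And>x. norm x = 1 \<Longrightarrow> H (reflection v x) = - H x"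
  shows "(\<integral>x. H x \<partial>sph) = 0"
proof -
  have "(\<integral>x. H x \<partial>sph) = (\<integral>x. H (reflection v x) \<partial>sph)"
    using integral_sphere_orthogonal[OF orthogonal_reflection[OF v]] H by force
  also have "\<dots> = (\<integral>x. - H x \<partial>sph)"
    by (intro Bochner_Integration.integral_cong) (auto simp: odd)
  finally show ?thesis by simp
qed

text \<open>
  On functions that are odd under a reflection a zonal operator is given by the antisymmetrised kernel.
\<close>

lemma zonal_conv_odd:
  fixes H :: "'a::euclidean_space \<Rightarrow> real"
  assumes \<psi>: "zonal_kernel B \<psi>" and H: "integrable sph H" and v: "norm v = 1"
    and odd: "\<And>x. norm x = 1 \<Longrightarrow> H (reflection v x) = - H x" and x: "norm x = 1"
  shows "(\<integral>y. (\<psi> (x \<bullet> y) - \<psi> (x \<bullet> reflection v y)) * H y \<partial>sph) = 2 * zonal_conv \<psi> H x"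
    and "integrable sph (\<lambda>y. (\<psi> (x \<bullet> y) - \<psi> (x \<bullet> reflection v y)) * H y)"
proof -
  have Rx: "norm (reflection v x) = 1" using norm_reflection[OF v] x by simp
  note i = integrable_zonal_integrand[OF \<psi> H]
  have eq: "x \<bullet> reflection v y = reflection v x \<bullet> y" for y by (simp add: inner_reflection[OF v])
  have "zonal_conv \<psi> H (reflection v x) = zonal_conv \<psi> (\<lambda>y. H (reflection v y)) x"
    using zonal_kernelD(1)[OF \<psi>] H by (intro zonal_conv_reflection v) auto
  also have "\<dots> = zonal_conv \<psi> (\<lambda>y. - H y) x" by (rule zonal_conv_cong) (simp add: odd)
  also have "\<dots> = - zonal_conv \<psi> H x" by (simp add: zonal_conv_def)
  finally show "(\<integral>y. (\<psi> (x \<bullet> y) - \<psi> (x \<bullet> reflection v y)) * H y \<partial>sph) = 2 * zonal_conv \<psi> H x"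
    using i[OF x] i[OF Rx] unfolding eq by (simp add: zonal_conv_def algebra_simps)
  show "integrable sph (\<lambda>y. (\<psi> (x \<bullet> y) - \<psi> (x \<bullet> reflection v y)) * H y)"
    using i[OF x] i[OF Rx] unfolding eq by (simp add: algebra_simps)
qed

text \<open>
  Among odd functions, the linear function \<open>w x = v \<bullet> x\<close> has the largest eigenvalue \<open>\<xi>\<close>. For increasing \<open>\<psi>\<close> the
  antisymmetrised kernel \<open>Q x y\<close> has the sign of \<open>w x * w y\<close>, so \<open>w\<close> is a positive eigenfunction
  of a positive kernel on the half-sphere \<open>w > 0\<close>. Schur's test, that is the inequality of means applied to
  \<open>H x / w x\<close> and \<open>H y / w y\<close> with the weight \<open>Q x y * w x * w y\<close>, then bounds the quadratic form by \<open>\<xi>\<close>.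
  The quotients cause no trouble: where \<open>w\<close> vanishes the reflection fixes the point, and the odd function \<open>H\<close> vanishes too.
\<close>

lemma zonal_form_odd_le:
  fixes H :: "'a::euclidean_space \<Rightarrow> real" and e :: 'a
  assumes \<psi>: "zonal_kernel B \<psi>" and mono: "\<And>s t. \<lbrakk>-1 \<le> s; s \<le> t; t \<le> 1\<rbrakk> \<Longrightarrow> \<psi> s \<le> \<psi> t"
    and H: "bounded_on_sphere H" and v: "norm v = 1"
    and odd: "\<And>x. norm x = 1 \<Longrightarrow> H (reflection v x) = - H x" and e: "norm e = 1"
  shows "(\<integral>x. zonal_conv \<psi> H x * H x \<partial>sph) \<le> (\<integral>y. (e \<bullet> y) * \<psi> (e \<bullet> y) \<partial>sph) * (\<integral>x. (H x)\<^sup>2 \<partial>sph)"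
proof -
  define \<xi> where "\<xi> = (\<integral>y. (e \<bullet> y) * \<psi> (e \<bullet> y) \<partial>sph)"
  define w where "w = (\<lambda>x. v \<bullet> x)"
  define Q where "Q = (\<lambda>x y. \<psi> (x \<bullet> y) - \<psi> (x \<bullet> reflection v y))"
  define T where "T = (\<lambda>x y. Q x y * w y * ((H x)\<^sup>2 / w x))"
  have vv: "v \<bullet> v = 1" using v by (simp add: dot_square_norm)
  have inner_refl: "x \<bullet> reflection v y = x \<bullet> y - 2 * w x * w y" for x y
    by (simp add: reflection_def w_def inner_diff_right inner_commute mult_ac)
  have Qsym: "Q x y = Q y x" for x y
    unfolding Q_def inner_refl by (simp add: inner_commute mult_ac)
  obtain L where L: "\<And>x. norm x = 1 \<Longrightarrow> \<bar>H x\<bar> \<le> L"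
    using H by (auto simp: bounded_on_sphere_def)
  have H0: "H x = 0" if "norm x = 1" "w x = 0" for x
    using odd[OF that(1)] that by (simp add: reflection_def w_def)
  have sgn: "0 \<le> Q x y * (w x * w y)" if x: "norm x = 1" and y: "norm y = 1" for x y
  proof -
    have b: "\<bar>x \<bullet> y\<bar> \<le> 1" "\<bar>x \<bullet> reflection v y\<bar> \<le> 1"
      using abs_inner_sphere[OF x y] abs_inner_sphere[OF x, of "reflection v y"] norm_reflection[OF v, of y] y
      by auto
    show ?thesis
    proof (cases "0 \<le> w x * w y")
      case True
      then have "0 \<le> Q x y" using mono[of "x \<bullet> reflection v y" "x \<bullet> y"] b
        by (auto simp: Q_def inner_refl)
      with True show ?thesis by simp
    next
      case False
      then have "Q x y \<le> 0" using mono[of "x \<bullet> y" "x \<bullet> reflection v y"] b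
        by (auto simp: Q_def inner_refl)
      with False show ?thesis by (intro mult_nonpos_nonpos) auto
    qed
  qed
  have pointwise: "Q x y * (H x * H y) \<le> (T x y + T y x) / 2" if x: "norm x = 1" and y: "norm y = 1" for x y
  proof (cases "w x = 0 \<or> w y = 0")
    case True
    then show ?thesis using H0[OF x] H0[OF y] by (auto simp: T_def)
  next
    case False
    have "2 * (H x / w x) * (H y / w y) \<le> (H x / w x)\<^sup>2 + (H y / w y)\<^sup>2"
      by (rule sum_squares_bound)
    then have "(Q x y * (w x * w y)) * (2 * (H x / w x) * (H y / w y)) \<le>
        (Q x y * (w x * w y)) * ((H x / w x)\<^sup>2 + (H y / w y)\<^sup>2)"
      by (rule mult_left_mono[OF _ sgn[OF x y]])
    also have "(Q x y * (w x * w y)) * ((H x / w x)\<^sup>2 + (H y / w y)\<^sup>2) = T x y + T y x"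
      using False Qsym[of y x] by (simp add: T_def field_simps power2_eq_square)
    also have "(Q x y * (w x * w y)) * (2 * (H x / w x) * (H y / w y)) = 2 * (Q x y * (H x * H y))"
      using False by (simp add: field_simps)
    finally show ?thesis by simp
  qed
  note [measurable] = zonal_kernelD(1)[OF \<psi>] bounded_on_sphere_measurable[OF H]
  have [measurable]: "(\<lambda>p. fst p) \<in> borel_measurable (sph \<Otimes>\<^sub>M (sph :: 'a measure))"
    by (rule measurable_compose[OF measurable_fst measurable_ident_sphere])
  have [measurable]: "(\<lambda>p. snd p) \<in> borel_measurable (sph \<Otimes>\<^sub>M (sph :: 'a measure))"
    by (rule measurable_compose[OF measurable_snd measurable_ident_sphere])
  have Q_meas [measurable]: "(\<lambda>(x, y). Q x y) \<in> borel_measurable (sph \<Otimes>\<^sub>M (sph :: 'a measure))"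
    unfolding Q_def inner_refl w_def case_prod_beta' by measurable
  have [measurable]: "w \<in> borel_measurable sph"
    unfolding w_def by (rule bounded_on_sphere_measurable[OF bounded_on_sphere_inner])
  have T_meas [measurable]: "(\<lambda>(x, y). T x y) \<in> borel_measurable (sph \<Otimes>\<^sub>M (sph :: 'a measure))"
    unfolding T_def by measurable
  have w_odd: "w (reflection v x) = - w x" for x
    by (simp add: w_def reflection_def inner_diff_right vv)
  have w_int: "integrable sph w" unfolding w_def by (intro bounded_on_sphere_intros)
  \<comment> \<open>As \<open>w\<close> is an eigenfunction, the factor \<open>w x\<close> cancels the denominator in \<open>T x y\<close>.\<close>
  have Tx: "(\<integral>y. T x y \<partial>sph) = 2 * \<xi> * (H x)\<^sup>2" "integrable sph (T x)" if x: "norm x = 1" for x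
  proof -
    have "(\<integral>y. T x y \<partial>sph) = (2 * zonal_conv \<psi> w x) * ((H x)\<^sup>2 / w x)"
      unfolding T_def Q_def using zonal_conv_odd[OF \<psi> w_int v w_odd x] by simp
    also have "zonal_conv \<psi> w x = \<xi> * w x"
      unfolding w_def \<xi>_def by (rule zonal_conv_linear[OF \<psi> x e])
    finally show "(\<integral>y. T x y \<partial>sph) = 2 * \<xi> * (H x)\<^sup>2" using H0[OF x] by (cases "w x = 0") auto
    show "integrable sph (T x)"
      unfolding T_def Q_def using zonal_conv_odd(2)[OF \<psi> w_int v w_odd x] by simp
  qed
  have Tpos: "0 \<le> T x y" if "norm x = 1" "norm y = 1" for x y
  proof (cases "w x = 0")
    case False
    have "T x y = (Q x y * (w x * w y)) * (H x / w x)\<^sup>2"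
      using False by (simp add: T_def field_simps power2_eq_square)
    then show ?thesis using sgn[OF that] by simp
  qed (simp add: T_def)
  have H2: "integrable sph (\<lambda>x. (H x)\<^sup>2)" by (intro bounded_on_sphere_intros H)
  have T_int: "integrable (sph \<Otimes>\<^sub>M sph) (\<lambda>(x, y). T x y)"
  proof (rule sph2.Fubini_integrable)
    have "(LINT y|sph. norm (case (x, y) of (x, y) \<Rightarrow> T x y)) = 2 * \<xi> * (H x)\<^sup>2" if x: "norm x = 1" for x
    proof -
      have "(LINT y|sph. norm (case (x, y) of (x, y) \<Rightarrow> T x y)) = (LINT y|sph. T x y)"
        using Tpos[OF x] by (intro Bochner_Integration.integral_cong) auto
      then show ?thesis using Tx[OF x] by simp
    qed
    then show "integrable sph (\<lambda>x. LINT y|sph. norm (case (x, y) of (x, y) \<Rightarrow> T x y))"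
      using H2 by (subst Bochner_Integration.integrable_cong[OF refl, where g = "\<lambda>x. 2 * \<xi> * (H x)\<^sup>2"]) auto
    show "AE x in sph. integrable sph (\<lambda>y. case (x, y) of (x, y) \<Rightarrow> T x y)"
      using Tx(2) by (intro AE_I2) simp
  qed measurable
  have T_val: "(\<integral>p. (case p of (x, y) \<Rightarrow> T x y) \<partial>(sph \<Otimes>\<^sub>M sph)) = 2 * \<xi> * (\<integral>x. (H x)\<^sup>2 \<partial>sph)"
  proof -
    have "(\<integral>p. (case p of (x, y) \<Rightarrow> T x y) \<partial>(sph \<Otimes>\<^sub>M sph)) = (\<integral>x. (\<integral>y. T x y \<partial>sph) \<partial>sph)"
      using sph2.integral_fst'[OF T_int] by simp
    also have "\<dots> = (\<integral>x. 2 * \<xi> * (H x)\<^sup>2 \<partial>sph)"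
      by (intro Bochner_Integration.integral_cong refl Tx) simp
    finally show ?thesis by simp
  qed
  have T_swap: "integrable (sph \<Otimes>\<^sub>M sph) (\<lambda>(x, y). T y x)"
    using sph2.integrable_product_swap[OF T_int] by simp
  have T_swap_val: "(\<integral>p. (case p of (x, y) \<Rightarrow> T y x) \<partial>(sph \<Otimes>\<^sub>M sph)) = 2 * \<xi> * (\<integral>x. (H x)\<^sup>2 \<partial>sph)"
    using sph2.integral_product_swap[of "\<lambda>(x, y). T x y"] T_val by simp
  interpret P: finite_measure "sph \<Otimes>\<^sub>M (sph :: 'a measure)"
    by (rule finite_measure_pair_measure[OF finite_measure_sphere finite_measure_sphere])
  have Q_int: "integrable (sph \<Otimes>\<^sub>M sph) (\<lambda>(x, y). Q x y * (H x * H y))"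
  proof (rule P.integrable_const_bound)
    show "AE p in sph \<Otimes>\<^sub>M sph. norm (case p of (x, y) \<Rightarrow> Q x y * (H x * H y)) \<le> 2 * B * (L * L)"
    proof (rule AE_I2, clarsimp simp: space_pair_measure)
      fix x y :: 'a assume xy: "norm x = 1" "norm y = 1"
      have "\<bar>\<psi> (x \<bullet> y)\<bar> \<le> B" "\<bar>\<psi> (x \<bullet> reflection v y)\<bar> \<le> B"
        using xy norm_reflection[OF v] by (auto intro!: zonal_kernel_le[OF \<psi>] abs_inner_sphere)
      then have "\<bar>Q x y\<bar> \<le> 2 * B" unfolding Q_def by linarith
      then show "\<bar>Q x y * (H x * H y)\<bar> \<le> 2 * B * (L * L)"
        unfolding abs_mult using L[OF xy(1)] L[OF xy(2)] by (intro mult_mono) auto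
    qed
  qed measurable
  have "2 * (\<integral>x. zonal_conv \<psi> H x * H x \<partial>sph) = (\<integral>x. 2 * zonal_conv \<psi> H x * H x \<partial>sph)"
    by (simp add: mult.assoc)
  also have "\<dots> = (\<integral>x. (\<integral>y. Q x y * (H x * H y) \<partial>sph) \<partial>sph)"
  proof (intro Bochner_Integration.integral_cong refl)
    fix x :: 'a assume "x \<in> space sph"
    then have "2 * zonal_conv \<psi> H x = (\<integral>y. Q x y * H y \<partial>sph)"
      unfolding Q_def using zonal_conv_odd(1)[OF \<psi> bounded_on_sphere_integrable[OF H] v odd] by simp
    then have "2 * zonal_conv \<psi> H x * H x = (\<integral>y. Q x y * H y * H x \<partial>sph)" by simp
    then show "2 * zonal_conv \<psi> H x * H x = (\<integral>y. Q x y * (H x * H y) \<partial>sph)"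
      by (simp add: mult_ac)
  qed
  also have "\<dots> = (\<integral>p. (case p of (x, y) \<Rightarrow> Q x y * (H x * H y)) \<partial>(sph \<Otimes>\<^sub>M sph))"
    using sph2.integral_fst'[OF Q_int] by simp
  also have "\<dots> \<le> (\<integral>p. ((case p of (x, y) \<Rightarrow> T x y) + (case p of (x, y) \<Rightarrow> T y x)) / 2 \<partial>(sph \<Otimes>\<^sub>M sph))"
  proof (rule integral_mono[OF Q_int])
    show "integrable (sph \<Otimes>\<^sub>M sph) (\<lambda>p. ((case p of (x, y) \<Rightarrow> T x y) + (case p of (x, y) \<Rightarrow> T y x)) / 2)"
      using T_int T_swap by simp
    fix p :: "'a \<times> 'a" assume "p \<in> space (sph \<Otimes>\<^sub>M sph)"
    then show "(case p of (x, y) \<Rightarrow> Q x y * (H x * H y)) \<le> ((case p of (x, y) \<Rightarrow> T x y) + (case p of (x, y) \<Rightarrow> T y x)) / 2"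
      using pointwise by (auto simp: space_pair_measure)
  qed
  also have "\<dots> = 2 * \<xi> * (\<integral>x. (H x)\<^sup>2 \<partial>sph)"
    using T_int T_swap T_val T_swap_val by simp
  finally show ?thesis by (simp add: \<xi>_def)
qed

text \<open>
  The spectral gap of an increasing kernel on odd functions is the gap at the linear functions.
\<close>

lemma dirichlet_odd:
  fixes H :: "'a::euclidean_space \<Rightarrow> real" and e :: 'a
  assumes \<psi>: "zonal_kernel B \<psi>" and mono: "\<And>s t. \<lbrakk>-1 \<le> s; s \<le> t; t \<le> 1\<rbrakk> \<Longrightarrow> \<psi> s \<le> \<psi> t"
    and H: "bounded_on_sphere H" and v: "norm v = 1"
    and odd: "\<And>x. norm x = 1 \<Longrightarrow> H (reflection v x) = - H x" and e: "norm e = 1"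
  shows "2 * (\<integral>y. (1 - e \<bullet> y) * \<psi> (e \<bullet> y) \<partial>sph) * (\<integral>x. (H x)\<^sup>2 \<partial>sph) \<le> dirichlet \<psi> H"
proof -
  define m where "m = (\<integral>y. \<psi> (e \<bullet> y) \<partial>sph)"
  have m: "zonal_mass TYPE('a) \<psi> m"
    unfolding m_def zonal_mass_def using zonal_integral_indep[OF zonal_kernelD(1)[OF \<psi>] _ e] by auto
  have "integrable sph (\<lambda>y. (e \<bullet> y) * \<psi> (e \<bullet> y))" "integrable sph (\<lambda>y. 1 * \<psi> (e \<bullet> y))"
    by (intro integrable_zonal_integrand[OF \<psi> _ e] bounded_on_sphere_intros)+
  then have eq: "(\<integral>y. (1 - e \<bullet> y) * \<psi> (e \<bullet> y) \<partial>sph) = m - (\<integral>y. (e \<bullet> y) * \<psi> (e \<bullet> y) \<partial>sph)"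
    by (simp add: m_def left_diff_distrib)
  then show ?thesis
    unfolding dirichlet_eq[OF \<psi> m H] eq using zonal_form_odd_le[OF assms] by (simp add: algebra_simps)
qed

text \<open>
  From \<open>\<delta> * \<parallel>H\<parallel>\<^sup>2 \<le> \<langle>D, H\<rangle>\<close> with \<open>D = H - zonal_conv \<phi> H\<close>, expanding \<open>0 \<le> \<parallel>D - \<delta> * H\<parallel>\<^sup>2\<close> gives
  \<open>\<delta> * \<parallel>H\<parallel> \<le> \<parallel>D\<parallel>\<close>. Unlike the gap itself, this form of it can be iterated.
\<close>

lemma norm_defect_lower_bound:
  fixes H :: "'a::euclidean_space \<Rightarrow> real"
  assumes \<phi>: "zonal_kernel B \<phi>" and mass: "zonal_mass TYPE('a) \<phi> 1" and H: "bounded_on_sphere H"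
    and \<delta>: "0 \<le> \<delta>" and gap: "2 * \<delta> * (\<integral>x. (H x)\<^sup>2 \<partial>sph) \<le> dirichlet \<phi> H"
  shows "\<delta>\<^sup>2 * (\<integral>x. (H x)\<^sup>2 \<partial>sph) \<le> (\<integral>x. (H x - zonal_conv \<phi> H x)\<^sup>2 \<partial>sph)"
proof -
  let ?D = "\<lambda>x. H x - zonal_conv \<phi> H x"
  have D: "bounded_on_sphere ?D"
    by (intro bounded_on_sphere_intros bounded_on_sphere_zonal_conv[OF \<phi>] H)
  have i: "integrable sph (\<lambda>x. (?D x)\<^sup>2)" "integrable sph (\<lambda>x. ?D x * H x)" "integrable sph (\<lambda>x. (H x)\<^sup>2)"
    "integrable sph (\<lambda>x. zonal_conv \<phi> H x * H x)"
    by (intro bounded_on_sphere_intros bounded_on_sphere_zonal_conv[OF \<phi>] H D)+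
  have "\<delta> * (\<integral>x. (H x)\<^sup>2 \<partial>sph) \<le> (\<integral>x. (H x)\<^sup>2 \<partial>sph) - (\<integral>x. zonal_conv \<phi> H x * H x \<partial>sph)"
    using gap unfolding dirichlet_eq[OF \<phi> mass H] by simp
  also have "\<dots> = (\<integral>x. (H x)\<^sup>2 - zonal_conv \<phi> H x * H x \<partial>sph)"
    using i by simp
  also have "\<dots> = (\<integral>x. ?D x * H x \<partial>sph)"
    by (simp add: power2_eq_square left_diff_distrib)
  finally have 1: "\<delta> * (\<integral>x. (H x)\<^sup>2 \<partial>sph) \<le> (\<integral>x. ?D x * H x \<partial>sph)" .
  have "0 \<le> (\<integral>x. (?D x - \<delta> * H x)\<^sup>2 \<partial>sph)" by (rule integral_nonneg_AE) simp
  also have "\<dots> = (\<integral>x. (?D x)\<^sup>2 - 2 * \<delta> * (?D x * H x) + \<delta>\<^sup>2 * (H x)\<^sup>2 \<partial>sph)"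
    by (intro Bochner_Integration.integral_cong refl) (simp add: power2_eq_square algebra_simps)
  also have "\<dots> = (\<integral>x. (?D x)\<^sup>2 \<partial>sph) - 2 * \<delta> * (\<integral>x. ?D x * H x \<partial>sph) + \<delta>\<^sup>2 * (\<integral>x. (H x)\<^sup>2 \<partial>sph)"
    using i by simp
  finally have 2: "2 * \<delta> * (\<integral>x. ?D x * H x \<partial>sph) \<le> (\<integral>x. (?D x)\<^sup>2 \<partial>sph) + \<delta>\<^sup>2 * (\<integral>x. (H x)\<^sup>2 \<partial>sph)" by simp
  have "2 * \<delta> * (\<delta> * (\<integral>x. (H x)\<^sup>2 \<partial>sph)) \<le> 2 * \<delta> * (\<integral>x. ?D x * H x \<partial>sph)"
    using 1 \<delta> by (intro mult_left_mono) auto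
  with 2 show ?thesis by (simp add: power2_eq_square)
qed

section \<open>Estimates for the Jackson kernel\<close>

definition sine_quotient :: "nat \<Rightarrow> real \<Rightarrow> real" where
  "sine_quotient k \<theta> = sin (real k * \<theta> / 2) / sin (\<theta> / 2)"

text \<open>
  Jordan's inequality, from concavity of the sine.
\<close>

lemma sine_ge_linear:
  assumes "0 \<le> u" "u \<le> pi / 2"
  shows "2 * u / pi \<le> sin u"
proof -
  have "concave_on {0..pi/2} sin"
    unfolding concave_on_def
  proof (rule f''_ge0_imp_convex)
    show "((\<lambda>x. - sin x) has_real_derivative - cos x) (at x)" for x by (auto intro!: derivative_eq_intros)
    show "((\<lambda>x. - cos x) has_real_derivative sin x) (at x)" for x by (auto intro!: derivative_eq_intros)
  qed (auto intro!: sin_ge_zero)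
  from concave_onD[OF this, of "2 * u / pi" 0 "pi / 2"] assms show ?thesis by simp
qed

lemma abs_sin_nat_mult_le: "\<bar>sin (real k * x)\<bar> \<le> real k * \<bar>sin x\<bar>"
proof (induction k)
  case (Suc k)
  have "\<bar>sin (real (Suc k) * x)\<bar> = \<bar>sin (real k * x) * cos x + cos (real k * x) * sin x\<bar>"
    using sin_add[of "real k * x" x] by (simp add: distrib_right add.commute)
  also have "\<dots> \<le> \<bar>sin (real k * x)\<bar> * \<bar>cos x\<bar> + \<bar>cos (real k * x)\<bar> * \<bar>sin x\<bar>"
    using abs_triangle_ineq by (simp add: abs_mult[symmetric])
  also have "\<dots> \<le> \<bar>sin (real k * x)\<bar> * 1 + 1 * \<bar>sin x\<bar>"
    by (intro add_mono mult_mono) auto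
  finally show ?case using Suc by (simp add: algebra_simps)
qed simp

lemma abs_sine_quotient_le: "\<bar>sine_quotient k \<theta>\<bar> \<le> real k"
proof (cases "sin (\<theta> / 2) = 0")
  case False
  then show ?thesis
    using abs_sin_nat_mult_le[of k "\<theta> / 2"] by (simp add: sine_quotient_def field_simps)
qed (simp add: sine_quotient_def)

lemma sine_quotient_mult_le:
  assumes "0 \<le> \<theta>" "\<theta> \<le> pi"
  shows "\<bar>sine_quotient k \<theta>\<bar> * \<theta> \<le> pi"
proof (cases "\<theta> = 0")
  case False
  have s: "\<theta> / pi \<le> sin (\<theta> / 2)" using sine_ge_linear[of "\<theta> / 2"] assms by simp
  have t: "0 < \<theta> / pi" using False assms by simp
  have pos: "0 < sin (\<theta> / 2)" using s t by linarith
  have "\<bar>sine_quotient k \<theta>\<bar> * \<theta> \<le> 1 / sin (\<theta> / 2) * \<theta>"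
    using pos assms by (intro mult_right_mono) (auto simp: sine_quotient_def field_simps)
  also have "\<dots> \<le> pi" using s pos by (simp add: field_simps)
  finally show ?thesis .
qed simp

lemma sine_quotient_ge:
  assumes "0 < \<theta>" "real k * \<theta> \<le> 1"
  shows "real k / 2 \<le> sine_quotient k \<theta>"
proof (cases "k = 0")
  case False
  have "1 * \<theta> \<le> real k * \<theta>" using False assms by (intro mult_right_mono) auto
  then have "\<theta> \<le> 1" using assms by linarith
  have "1 < pi / 2" using pi_gt3 by simp
  have "0 < sin (\<theta> / 2)" using assms \<open>\<theta> \<le> 1\<close> pi_gt3 by (intro sin_gt_zero) auto
  have "sin (\<theta> / 2) \<le> \<theta> / 2" using assms by (intro sin_x_le_x) auto
  have "real k / 2 * (\<theta> / 2) \<le> real k * \<theta> / pi"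
    using assms pi_less_4 mult_left_mono[of pi 4 "real k * \<theta>"] by (simp add: field_simps)
  also have "\<dots> \<le> sin (real k * \<theta> / 2)"
    using sine_ge_linear[of "real k * \<theta> / 2"] assms \<open>1 < pi / 2\<close> by simp
  finally have "real k / 2 * (\<theta> / 2) \<le> sin (real k * \<theta> / 2)" .
  moreover have "real k / 2 * sin (\<theta> / 2) \<le> real k / 2 * (\<theta> / 2)"
    using \<open>sin (\<theta> / 2) \<le> \<theta> / 2\<close> by (intro mult_left_mono) auto
  ultimately show ?thesis
    using \<open>0 < sin (\<theta> / 2)\<close> by (simp add: sine_quotient_def pos_le_divide_eq)
qed (simp add: sine_quotient_def)

lemma sine_quotient_measurable [measurable]: "sine_quotient k \<in> borel_measurable borel"
  unfolding sine_quotient_def[abs_def] by measurable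

lemma set_integrable_bounded:
  fixes f :: "real \<Rightarrow> real"
  assumes [measurable]: "f \<in> borel_measurable borel" and "\<And>x. a \<le> x \<Longrightarrow> x \<le> b \<Longrightarrow> \<bar>f x\<bar> \<le> B"
  shows "set_integrable lborel {a..b} f"
  unfolding set_integrable_def
proof (rule Bochner_Integration.integrable_bound)
  show "integrable lborel (\<lambda>x. B * indicator {a..b} x)"
    by (intro integrable_mult_right integrable_real_indicator) (auto simp: emeasure_lborel_Icc_eq)
  show "AE x in lborel. norm (indicator {a..b} x *\<^sub>R f x) \<le> norm (B * indicator {a..b} x)"
  proof (rule AE_I2)
    fix x show "norm (indicator {a..b} x *\<^sub>R f x) \<le> norm (B * indicator {a..b} x)"
      using assms(2)[of x] by (cases "x \<in> {a..b}") auto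
  qed
qed simp

lemma set_integral_FTC:
  fixes f F :: "real \<Rightarrow> real"
  assumes "a \<le> b" "\<And>x. DERIV F x :> f x" "continuous_on {a..b} f"
  shows "(LINT x:{a..b}|lborel. f x) = F b - F a"
  unfolding set_lebesgue_integral_def
  by (rule integral_FTC_atLeastAtMost)
    (use assms in \<open>auto simp: has_real_derivative_iff_has_vector_derivative[symmetric]
      intro: has_field_derivative_at_within\<close>)

lemma jackson_integrand_bound:
  assumes "0 \<le> \<theta>" "\<theta> \<le> pi"
  shows "\<bar>sine_quotient k \<theta> ^ (2 * s) * sin \<theta> ^ m\<bar> \<le> real k ^ (2 * s)"
proof -
  have "\<bar>sine_quotient k \<theta>\<bar> ^ (2 * s) \<le> real k ^ (2 * s)"
    by (intro power_mono abs_sine_quotient_le) auto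
  moreover have "\<bar>sin \<theta>\<bar> ^ m \<le> 1" by (intro power_le_one) auto
  ultimately have "\<bar>sine_quotient k \<theta>\<bar> ^ (2 * s) * \<bar>sin \<theta>\<bar> ^ m \<le> real k ^ (2 * s) * 1"
    by (intro mult_mono) auto
  then show ?thesis by (simp add: abs_mult power_abs)
qed

lemma jackson_integrable:
  "set_integrable lborel {0..pi} (\<lambda>\<theta>. sine_quotient k \<theta> ^ (2 * s) * sin \<theta> ^ m)"
  by (rule set_integrable_bounded[where B = "real k ^ (2 * s)"]) (auto intro: jackson_integrand_bound)

lemma jackson_const_eq:
  assumes "3 \<le> n"
  shows "jackson_const n k s = (LINT \<theta>:{0..pi}|lborel. sine_quotient k \<theta> ^ (2 * s) * sin \<theta> ^ (n - 2))"
  unfolding jackson_const_def sine_quotient_def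
proof (rule set_lebesgue_integral_cong)
  show "\<forall>\<theta>. \<theta> \<in> {0..pi} \<longrightarrow> (sin (real k * \<theta> / 2) / sin (\<theta> / 2)) ^ (2 * s) * sin \<theta> powr (2 * lam n) =
      (sin (real k * \<theta> / 2) / sin (\<theta> / 2)) ^ (2 * s) * sin \<theta> ^ (n - 2)"
  proof (intro allI impI)
    fix \<theta> :: real assume "\<theta> \<in> {0..pi}"
    then have "0 \<le> sin \<theta>" by (intro sin_ge_zero) auto
    have "2 * lam n = real (n - 2)" using assms by (simp add: lam_def of_nat_diff)
    then have "sin \<theta> powr (2 * lam n) = sin \<theta> powr real (n - 2)" by simp
    also have "\<dots> = sin \<theta> ^ (n - 2)"
    proof (cases "sin \<theta> = 0")
      case False
      with \<open>0 \<le> sin \<theta>\<close> show ?thesis by (intro powr_realpow) simp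
    qed (use assms in \<open>simp add: zero_power\<close>)
    finally have "sin \<theta> powr (2 * lam n) = sin \<theta> ^ (n - 2)" .
    then show "(sin (real k * \<theta> / 2) / sin (\<theta> / 2)) ^ (2 * s) * sin \<theta> powr (2 * lam n) =
      (sin (real k * \<theta> / 2) / sin (\<theta> / 2)) ^ (2 * s) * sin \<theta> ^ (n - 2)" by simp
  qed
qed simp

lemma small_angle_integral:
  assumes "1 \<le> k"
  shows "(LINT \<theta>:{0..pi}|lborel. indicator {0..1 / real k} \<theta> * (\<theta> / pi) ^ m) =
    1 / (pi ^ m * real (m + 1) * real k ^ (m + 1))"
proof -
  have "1 / real k \<le> 1" using assms by simp
  then have "1 / real k \<le> pi" using pi_gt3 by linarith
  then have "(LINT \<theta>:{0..pi}|lborel. indicator {0..1 / real k} \<theta> * (\<theta> / pi) ^ m) =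
      (LINT \<theta>:{0..1 / real k}|lborel. (\<theta> / pi) ^ m)"
    unfolding set_lebesgue_integral_def
    by (intro Bochner_Integration.integral_cong refl) (auto simp: indicator_def)
  also have "\<dots> = (1 / real k) ^ (m + 1) / (pi ^ m * real (m + 1)) - 0 ^ (m + 1) / (pi ^ m * real (m + 1))"
  proof (rule set_integral_FTC)
    show "DERIV (\<lambda>\<theta>. \<theta> ^ (m + 1) / (pi ^ m * real (m + 1))) \<theta> :> (\<theta> / pi) ^ m" for \<theta>
      by (rule derivative_eq_intros refl)+ (simp_all add: power_divide)
  qed (auto intro!: continuous_intros)
  finally show ?thesis by (simp add: power_divide)
qed

lemma small_angle_sin:
  assumes "1 \<le> k" "0 \<le> \<theta>" "\<theta> \<le> 1 / real k"
  shows "\<theta> / pi \<le> sin \<theta>"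
proof -
  have "1 / real k \<le> 1" using assms by simp
  then have "\<theta> \<le> pi / 2" using assms pi_gt3 by linarith
  then have "2 * \<theta> / pi \<le> sin \<theta>" using assms by (intro sine_ge_linear) auto
  moreover have "\<theta> / pi \<le> 2 * \<theta> / pi" using assms by (simp add: divide_right_mono)
  ultimately show ?thesis by linarith
qed

text \<open>
  At angles up to \<open>1 / k\<close> the quotient of sines is at least \<open>k / 2\<close>.
\<close>

lemma jackson_const_pos:
  assumes n: "3 \<le> n" and k: "1 \<le> k"
  shows "0 < jackson_const n k s"
proof -
  let ?m = "n - 2"
  have "0 < (real k / 2) ^ (2 * s) * (1 / (pi ^ ?m * real (?m + 1) * real k ^ (?m + 1)))"
    using k by simp
  also have "\<dots> = (LINT \<theta>:{0..pi}|lborel. (real k / 2) ^ (2 * s) * (indicator {0..1 / real k} \<theta> * (\<theta> / pi) ^ ?m))"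
    by (simp add: small_angle_integral[OF k])
  also have "\<dots> \<le> (LINT \<theta>:{0..pi}|lborel. sine_quotient k \<theta> ^ (2 * s) * sin \<theta> ^ ?m)"
  proof (rule set_integral_mono)
    show "set_integrable lborel {0..pi} (\<lambda>\<theta>. (real k / 2) ^ (2 * s) * (indicator {0..1 / real k} \<theta> * (\<theta> / pi) ^ ?m))"
    proof (rule set_integrable_bounded[where B = "(real k / 2) ^ (2 * s)"])
      fix \<theta> :: real assume "0 \<le> \<theta>" "\<theta> \<le> pi"
      then have "(\<theta> / pi) ^ ?m \<le> 1" "0 \<le> (\<theta> / pi) ^ ?m" by (auto intro!: power_le_one)
      then have "\<bar>indicator {0..1 / real k} \<theta> * (\<theta> / pi) ^ ?m\<bar> \<le> 1"
        by (simp add: abs_mult indicator_def)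
      then have "(real k / 2) ^ (2 * s) * \<bar>indicator {0..1 / real k} \<theta> * (\<theta> / pi) ^ ?m\<bar> \<le> (real k / 2) ^ (2 * s) * 1"
        by (rule mult_left_mono) simp
      then show "\<bar>(real k / 2) ^ (2 * s) * (indicator {0..1 / real k} \<theta> * (\<theta> / pi) ^ ?m)\<bar> \<le> (real k / 2) ^ (2 * s)"
        by (simp add: abs_mult)
    qed measurable
    show "set_integrable lborel {0..pi} (\<lambda>\<theta>. sine_quotient k \<theta> ^ (2 * s) * sin \<theta> ^ ?m)"
      by (rule jackson_integrable)
    fix \<theta> :: real assume \<theta>: "\<theta> \<in> {0..pi}"
    show "(real k / 2) ^ (2 * s) * (indicator {0..1 / real k} \<theta> * (\<theta> / pi) ^ ?m) \<le> sine_quotient k \<theta> ^ (2 * s) * sin \<theta> ^ ?m"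
    proof (cases "0 < \<theta> \<and> \<theta> \<le> 1 / real k")
      case True
      then have "real k / 2 \<le> sine_quotient k \<theta>"
        using k by (intro sine_quotient_ge) (auto simp: field_simps)
      moreover have "\<theta> / pi \<le> sin \<theta>" using True by (intro small_angle_sin[OF k]) auto
      ultimately show ?thesis using True k
        by (auto intro!: mult_mono power_mono zero_le_power)
    next
      case False
      then have eq: "indicator {0..1 / real k} \<theta> * (\<theta> / pi) ^ ?m = (0::real)"
        using \<theta> n by (auto simp: indicator_def zero_power)
      have "0 \<le> sin \<theta>" using \<theta> by (intro sin_ge_zero) auto
      then have "0 \<le> sine_quotient k \<theta> ^ (2 * s) * sin \<theta> ^ ?m"
        by (intro mult_nonneg_nonneg zero_le_even_power zero_le_power) auto
      then show ?thesis by (simp only: eq mult_zero_right)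
    qed
  qed
  finally show ?thesis unfolding jackson_const_eq[OF n] .
qed

text \<open>
  The quotient of sines is at most \<open>k\<close> and at most \<open>\<pi> / \<theta>\<close>. For \<open>n \<le> 2 * s\<close>, all but \<open>n\<close> of its factors are bounded by \<open>k\<close>,
  another \<open>n - 2\<close> are absorbed by \<open>sin \<theta> ^ (n - 2)\<close>, and the square that remains is
  dominated by a multiple of \<open>k\<^sup>2 / (1 + (k * \<theta>)\<^sup>2)\<close>, whose integral is of order \<open>k\<close>.
\<close>

lemma jackson_const_le_concentrated:
  assumes n: "3 \<le> n" "n \<le> 2 * s" and k: "1 \<le> k"
  shows "jackson_const n k s \<le> pi ^ (n - 2) * (1 + pi\<^sup>2) * (pi / 2) * real k ^ (2 * s - n + 1)"
proof -
  define C where "C = pi ^ (n - 2) * (1 + pi\<^sup>2)"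
  have C: "0 \<le> C" by (simp add: C_def)
  define K where "K = real k"
  have K: "1 \<le> K" using k by (simp add: K_def)
  have den: "0 < 1 + (K * \<theta>)\<^sup>2" for \<theta> by (simp add: add_pos_nonneg)
  have "jackson_const n k s \<le> (LINT \<theta>:{0..pi}|lborel. C * K ^ (2 * s - n) * (K\<^sup>2 / (1 + (K * \<theta>)\<^sup>2)))"
    unfolding jackson_const_eq[OF n(1)]
  proof (rule set_integral_mono)
    show "set_integrable lborel {0..pi} (\<lambda>\<theta>. C * K ^ (2 * s - n) * (K\<^sup>2 / (1 + (K * \<theta>)\<^sup>2)))"
      using den by (intro borel_integrable_atLeastAtMost' continuous_intros) (auto simp: less_imp_neq[symmetric])
    show "set_integrable lborel {0..pi} (\<lambda>\<theta>. sine_quotient k \<theta> ^ (2 * s) * sin \<theta> ^ (n - 2))"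
      by (rule jackson_integrable)
    fix \<theta> :: real assume "\<theta> \<in> {0..pi}"
    then have \<theta>: "0 \<le> \<theta>" "\<theta> \<le> pi" by auto
    define a where "a = \<bar>sine_quotient k \<theta>\<bar>"
    have a: "0 \<le> a" "a \<le> K" "a * \<theta> \<le> pi"
      using abs_sine_quotient_le[of k \<theta>] sine_quotient_mult_le[OF \<theta>] by (auto simp: a_def K_def)
    have s: "0 \<le> sin \<theta>" "sin \<theta> \<le> \<theta>" using \<theta> by (auto intro: sin_ge_zero sin_x_le_x)
    have e: "2 * s = (2 * s - n) + (n - 2) + 2" using n by simp
    have "sine_quotient k \<theta> ^ (2 * s) = a ^ (2 * s)" by (simp add: a_def power_even_abs)
    then have "sine_quotient k \<theta> ^ (2 * s) * sin \<theta> ^ (n - 2) = a ^ (2 * s - n) * ((a * sin \<theta>) ^ (n - 2) * a\<^sup>2)"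
      by (subst (asm) e) (simp only: power_add power_mult_distrib mult_ac)
    also have "\<dots> \<le> K ^ (2 * s - n) * (pi ^ (n - 2) * ((1 + pi\<^sup>2) * (K\<^sup>2 / (1 + (K * \<theta>)\<^sup>2))))"
    proof (intro mult_mono power_mono)
      have "a * sin \<theta> \<le> a * \<theta>" using a s by (intro mult_left_mono)
      then show "a * sin \<theta> \<le> pi" using a by linarith
      have "a\<^sup>2 * (1 + (K * \<theta>)\<^sup>2) = a\<^sup>2 + K\<^sup>2 * (a * \<theta>)\<^sup>2" by (simp add: power_mult_distrib algebra_simps)
      also have "\<dots> \<le> K\<^sup>2 + K\<^sup>2 * pi\<^sup>2"
        using a \<theta> by (intro add_mono mult_left_mono power_mono) auto
      also have "\<dots> = (1 + pi\<^sup>2) * K\<^sup>2" by (simp add: algebra_simps)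
      finally show "a\<^sup>2 \<le> (1 + pi\<^sup>2) * (K\<^sup>2 / (1 + (K * \<theta>)\<^sup>2))"
        using den[of \<theta>] by (simp add: pos_le_divide_eq)
    qed (use a s K in auto)
    finally show "sine_quotient k \<theta> ^ (2 * s) * sin \<theta> ^ (n - 2) \<le> C * K ^ (2 * s - n) * (K\<^sup>2 / (1 + (K * \<theta>)\<^sup>2))"
      by (simp add: C_def mult_ac)
  qed
  also have "\<dots> = C * K ^ (2 * s - n) * (LINT \<theta>:{0..pi}|lborel. K\<^sup>2 / (1 + (K * \<theta>)\<^sup>2))"
    by (rule set_integral_mult_right)
  also have "(LINT \<theta>:{0..pi}|lborel. K\<^sup>2 / (1 + (K * \<theta>)\<^sup>2)) = K * arctan (K * pi) - K * arctan (K * 0)"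
    using den by (intro set_integral_FTC)
      (auto intro!: derivative_eq_intros continuous_intros simp: less_imp_neq[symmetric] divide_inverse power2_eq_square)
  also have "\<dots> \<le> K * (pi / 2)"
    using arctan_ubound[of "K * pi"] K by simp
  finally have "jackson_const n k s \<le> C * K ^ (2 * s - n) * (K * (pi / 2))"
    using C K by (simp add: mult_left_mono)
  then show ?thesis by (simp add: C_def K_def mult_ac)
qed

text \<open>
  For \<open>2 * s < n\<close> the power of the sine absorbs all but two factors of the quotient, so the
  normalising integral is at most of order \<open>k\<^sup>2\<close>.
\<close>

lemma jackson_const_le_spread:
  assumes n: "3 \<le> n" "2 * s < n" and s: "1 \<le> s"
  shows "jackson_const n k s \<le> pi ^ (2 * s - 2) * pi ^ (n - 2 * s) * pi * (real k)\<^sup>2"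
proof -
  define C where "C = pi ^ (2 * s - 2) * pi ^ (n - 2 * s)"
  have "jackson_const n k s \<le> (LINT \<theta>:{0..pi}|lborel. C * (real k)\<^sup>2)"
    unfolding jackson_const_eq[OF n(1)]
  proof (rule set_integral_mono)
    show "set_integrable lborel {0..pi} (\<lambda>\<theta>. C * (real k)\<^sup>2)"
      by (intro borel_integrable_atLeastAtMost' continuous_intros)
    show "set_integrable lborel {0..pi} (\<lambda>\<theta>. sine_quotient k \<theta> ^ (2 * s) * sin \<theta> ^ (n - 2))"
      by (rule jackson_integrable)
    fix \<theta> :: real assume "\<theta> \<in> {0..pi}"
    then have \<theta>: "0 \<le> \<theta>" "\<theta> \<le> pi" by auto
    define a where "a = \<bar>sine_quotient k \<theta>\<bar>"
    have a: "0 \<le> a" "a \<le> real k" "a * \<theta> \<le> pi"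
      using abs_sine_quotient_le[of k \<theta>] sine_quotient_mult_le[OF \<theta>] by (auto simp: a_def)
    have sn: "0 \<le> sin \<theta>" "sin \<theta> \<le> \<theta>" using \<theta> by (auto intro: sin_ge_zero sin_x_le_x)
    have "2 * s = (2 * s - 2) + 2" using s by simp
    then have "a ^ (2 * s) = a ^ (2 * s - 2) * a\<^sup>2"
      by (metis power_add)
    moreover have "sin \<theta> ^ (n - 2) = sin \<theta> ^ (2 * s - 2) * sin \<theta> ^ (n - 2 * s)"
      using n s power_add[of "sin \<theta>" "2 * s - 2" "n - 2 * s"] by simp
    moreover have "sine_quotient k \<theta> ^ (2 * s) = a ^ (2 * s)" by (simp add: a_def power_even_abs)
    ultimately have "sine_quotient k \<theta> ^ (2 * s) * sin \<theta> ^ (n - 2) =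
        (a * sin \<theta>) ^ (2 * s - 2) * (sin \<theta> ^ (n - 2 * s)) * a\<^sup>2"
      by (simp add: power_mult_distrib)
    also have "\<dots> \<le> pi ^ (2 * s - 2) * pi ^ (n - 2 * s) * (real k)\<^sup>2"
    proof (intro mult_mono power_mono)
      have "a * sin \<theta> \<le> a * \<theta>" using a sn by (intro mult_left_mono)
      then show "a * sin \<theta> \<le> pi" using a by linarith
    qed (use a sn \<theta> in auto)
    finally show "sine_quotient k \<theta> ^ (2 * s) * sin \<theta> ^ (n - 2) \<le> C * (real k)\<^sup>2"
      by (simp add: C_def)
  qed
  also have "\<dots> = C * (real k)\<^sup>2 * pi"
    by (simp add: set_lebesgue_integral_def)
  finally show ?thesis by (simp add: C_def mult_ac)
qed

section \<open>The Jackson operators as zonal convolutions\<close>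

text \<open>
  Makes the arc cosine continuous on the whole line.
\<close>

definition clamp1 :: "real \<Rightarrow> real" where
  "clamp1 t = max (-1) (min 1 t)"

lemma clamp1_eq: "\<bar>t\<bar> \<le> 1 \<Longrightarrow> clamp1 t = t"
  by (auto simp: clamp1_def)

lemma arccos_clamp1_measurable [measurable]: "(\<lambda>t. arccos (clamp1 t)) \<in> borel_measurable borel"
proof (rule borel_measurable_continuous_onI)
  show "continuous_on UNIV (\<lambda>t. arccos (clamp1 t))"
    unfolding clamp1_def by (intro continuous_intros) auto
qed

lemma arccos_clamp1_cos: "\<lbrakk>0 \<le> \<theta>; \<theta> \<le> pi\<rbrakk> \<Longrightarrow> arccos (clamp1 (cos \<theta>)) = \<theta>"
  by (simp add: clamp1_eq arccos_cos)

definition jackson_zonal :: "nat \<Rightarrow> nat \<Rightarrow> nat \<Rightarrow> real \<Rightarrow> real" where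
  "jackson_zonal n k s t = sine_quotient k (arccos (clamp1 t)) ^ (2 * s) / (sphere_area (n - 1) * jackson_const n k s)"

lemma sphere_area_pos: "0 < m \<Longrightarrow> 0 < sphere_area m"
  by (simp add: sphere_area_def)

lemma jackson_zonal_nonneg: "\<lbrakk>3 \<le> n; 1 \<le> k\<rbrakk> \<Longrightarrow> 0 \<le> jackson_zonal n k s t"
  using jackson_const_pos[of n k s] sphere_area_pos[of "n - 1"]
  by (auto simp: jackson_zonal_def intro!: divide_nonneg_nonneg)

lemma zonal_kernel_jackson:
  assumes "3 \<le> n" "1 \<le> k"
  shows "zonal_kernel (real k ^ (2 * s) / (sphere_area (n - 1) * jackson_const n k s)) (jackson_zonal n k s)"
  unfolding zonal_kernel_def
proof (intro conjI allI impI)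
  show "jackson_zonal n k s \<in> borel_measurable borel"
    unfolding jackson_zonal_def[abs_def] by measurable
  fix t :: real
  have pos: "0 < sphere_area (n - 1) * jackson_const n k s"
    using jackson_const_pos[OF assms] sphere_area_pos[of "n - 1"] assms by simp
  have "\<bar>sine_quotient k (arccos (clamp1 t))\<bar> ^ (2 * s) \<le> real k ^ (2 * s)"
    by (intro power_mono abs_sine_quotient_le) auto
  then show "\<bar>jackson_zonal n k s t\<bar> \<le> real k ^ (2 * s) / (sphere_area (n - 1) * jackson_const n k s)"
    using pos by (simp add: jackson_zonal_def abs_divide power_abs divide_right_mono)
qed

lemma jackson_eq_zonal_conv:
  fixes f :: "'a::euclidean_space \<Rightarrow> real"
  assumes x: "norm x = 1"
  shows "jackson k s f x = zonal_conv (jackson_zonal DIM('a) k s) f x"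
proof -
  have "zonal_conv (jackson_zonal DIM('a) k s) f x =
      (\<integral>y. 1 / sphere_area (DIM('a) - 1) * (f y * jackson_kernel DIM('a) k s (arccos (x \<bullet> y))) \<partial>sph)"
    unfolding zonal_conv_def
  proof (intro Bochner_Integration.integral_cong refl)
    fix y :: 'a assume "y \<in> space sph"
    then have "clamp1 (x \<bullet> y) = x \<bullet> y" using abs_inner_sphere[OF x] by (intro clamp1_eq) simp
    then show "f y * jackson_zonal DIM('a) k s (x \<bullet> y) =
        1 / sphere_area (DIM('a) - 1) * (f y * jackson_kernel DIM('a) k s (arccos (x \<bullet> y)))"
      by (simp add: jackson_zonal_def jackson_kernel_def sine_quotient_def inverse_eq_divide)
  qed
  then show ?thesis by (simp add: jackson_def)
qed

text \<open>
  Here the normalisations of the kernel and of the operator combine: the zonal integral formula contributes exactly the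
  factor \<open>sphere_area (n - 1)\<close> by which the operator is divided. Hence constants are reproduced.
\<close>

lemma zonal_mass_jackson:
  assumes n: "3 \<le> DIM('a::euclidean_space)" and k: "1 \<le> k"
  shows "zonal_mass TYPE('a) (jackson_zonal DIM('a) k s) 1"
  unfolding zonal_mass_def
proof (intro allI impI)
  fix x :: 'a assume x: "norm x = 1"
  let ?n = "DIM('a)"
  have pos: "0 < sphere_area (?n - 1)" "0 < jackson_const ?n k s"
    using jackson_const_pos[OF n k] sphere_area_pos[of "?n - 1"] n by auto
  have "(\<integral>y. jackson_zonal ?n k s (x \<bullet> y) \<partial>sph) =
      sphere_area (?n - 1) * (LINT \<theta>:{0..pi}|lborel. jackson_zonal ?n k s (cos \<theta>) * sin \<theta> ^ (?n - 2))"
    using n by (intro integral_zonal zonal_kernelD(1)[OF zonal_kernel_jackson[OF n k]] x jackson_zonal_nonneg[OF n k]) auto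
  also have "(LINT \<theta>:{0..pi}|lborel. jackson_zonal ?n k s (cos \<theta>) * sin \<theta> ^ (?n - 2)) =
      (LINT \<theta>:{0..pi}|lborel. 1 / (sphere_area (?n - 1) * jackson_const ?n k s) *
        (sine_quotient k \<theta> ^ (2 * s) * sin \<theta> ^ (?n - 2)))"
    by (rule set_lebesgue_integral_cong) (auto simp: jackson_zonal_def arccos_clamp1_cos)
  also have "\<dots> = 1 / (sphere_area (?n - 1) * jackson_const ?n k s) * jackson_const ?n k s"
    unfolding jackson_const_eq[OF n] by (rule set_integral_mult_right)
  finally show "(\<integral>y. jackson_zonal ?n k s (x \<bullet> y) \<partial>sph) = 1" using pos by simp
qed

lemma measure_sphere_eq:
  assumes "2 \<le> DIM('a::euclidean_space)"
  shows "measure (sph :: 'a measure) (sphere 0 1) = sphere_area (DIM('a) - 1) * (LINT \<theta>:{0..pi}|lborel. sin \<theta> ^ (DIM('a) - 2))"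
proof -
  obtain e :: 'a where e: "norm e = 1" using vector_choose_size[of 1] by auto
  show ?thesis using integral_zonal[OF _ e assms, of "\<lambda>_. 1"] by simp
qed

section \<open>The spectral gap of the Jackson operators\<close>

text \<open>
  For \<open>n \<le> 2 * s\<close> the Jackson kernel is bounded below by a multiple of the indicator \<open>\<psi>\<close> of the cap of radius \<open>1 / k\<close>,
  of height about \<open>k ^ (2 * s) / jackson_const n k s\<close>. That indicator is increasing in \<open>x \<bullet> y\<close>,
  so the gap on odd functions is at least this height times the integral of \<open>1 - cos \<theta>\<close> over the cap, which
  is of order \<open>1 / k ^ (n + 1)\<close>. The bound on the normalising constant makes the product at least of order \<open>1 / k\<^sup>2\<close>.
\<close>

lemma dirichlet_jackson_concentrated:
  fixes H :: "'a::euclidean_space \<Rightarrow> real"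
  assumes n: "3 \<le> DIM('a)" "DIM('a) \<le> 2 * s" and k: "1 \<le> k"
    and c: "c = 2 / (4 ^ s * pi ^ DIM('a) * real (DIM('a) + 1) * (pi ^ (DIM('a) - 2) * (1 + pi\<^sup>2) * (pi / 2)))"
    and H: "bounded_on_sphere H" and v: "norm v = 1"
    and odd: "\<And>x. norm x = 1 \<Longrightarrow> H (reflection v x) = - H x"
  shows "2 * (c / (real k)\<^sup>2) * (\<integral>x. (H x)\<^sup>2 \<partial>sph) \<le> dirichlet (jackson_zonal DIM('a) k s) H"
proof -
  let ?n = "DIM('a)"
  define A where "A = jackson_const ?n k s"
  define \<sigma> where "\<sigma> = sphere_area (?n - 1)"
  have pos: "0 < \<sigma>" "0 < A"
    using jackson_const_pos[OF n(1) k] sphere_area_pos[of "?n - 1"] n by (auto simp: A_def \<sigma>_def)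
  define \<psi> :: "real \<Rightarrow> real" where "\<psi> = indicator {cos (1 / real k)..}"
  have \<psi>: "zonal_kernel 1 \<psi>" by (auto simp: zonal_kernel_def \<psi>_def indicator_def)
  have k1: "0 < 1 / real k" "1 / real k \<le> 1" using k by auto
  then have kpi: "1 / real k \<le> pi" using pi_gt3 by linarith
  obtain e :: 'a where e: "norm e = 1" using vector_choose_size[of 1] by auto
  define M where "M = (\<integral>y. (1 - e \<bullet> y) * \<psi> (e \<bullet> y) \<partial>sph)"
  define q where "q = (real k / 2) ^ (2 * s) / (\<sigma> * A)"
  have M: "\<sigma> * (2 / (pi ^ ?n * real (?n + 1) * real k ^ (?n + 1))) \<le> M"
  proof -
    have "M = \<sigma> * (LINT \<theta>:{0..pi}|lborel. (1 - cos \<theta>) * \<psi> (cos \<theta>) * sin \<theta> ^ (?n - 2))"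
      unfolding M_def \<sigma>_def using n e by (intro integral_zonal) (auto simp: \<psi>_def indicator_def)
    moreover have "2 / (pi ^ ?n * real (?n + 1) * real k ^ (?n + 1)) =
        (LINT \<theta>:{0..pi}|lborel. 2 * (indicator {0..1 / real k} \<theta> * (\<theta> / pi) ^ ?n))"
      unfolding set_integral_mult_right small_angle_integral[OF k] by simp
    moreover have "(LINT \<theta>:{0..pi}|lborel. 2 * (indicator {0..1 / real k} \<theta> * (\<theta> / pi) ^ ?n)) \<le>
        (LINT \<theta>:{0..pi}|lborel. (1 - cos \<theta>) * \<psi> (cos \<theta>) * sin \<theta> ^ (?n - 2))"
    proof (rule set_integral_mono)
      show "set_integrable lborel {0..pi} (\<lambda>\<theta>. 2 * (indicator {0..1 / real k} \<theta> * (\<theta> / pi) ^ ?n))"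
      proof (rule set_integrable_bounded[where B = 2])
        fix \<theta> :: real assume "0 \<le> \<theta>" "\<theta> \<le> pi"
        then have "(\<theta> / pi) ^ ?n \<le> 1" "0 \<le> (\<theta> / pi) ^ ?n" by (auto intro!: power_le_one)
        then show "\<bar>2 * (indicator {0..1 / real k} \<theta> * (\<theta> / pi) ^ ?n)\<bar> \<le> 2"
          by (simp add: abs_mult indicator_def)
      qed measurable
      show "set_integrable lborel {0..pi} (\<lambda>\<theta>. (1 - cos \<theta>) * \<psi> (cos \<theta>) * sin \<theta> ^ (?n - 2))"
      proof (rule set_integrable_bounded[where B = "2 * 1 * 1"])
        fix \<theta> :: real
        have "\<bar>1 - cos \<theta>\<bar> \<le> 2" using cos_ge_minus_one[of \<theta>] cos_le_one[of \<theta>] by linarith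
        moreover have "\<bar>\<psi> (cos \<theta>)\<bar> \<le> 1" by (simp add: \<psi>_def indicator_def)
        moreover have "\<bar>sin \<theta> ^ (?n - 2)\<bar> \<le> 1" unfolding power_abs by (intro power_le_one) auto
        ultimately show "\<bar>(1 - cos \<theta>) * \<psi> (cos \<theta>) * sin \<theta> ^ (?n - 2)\<bar> \<le> 2 * 1 * 1"
          unfolding abs_mult by (intro mult_mono) auto
      qed (simp add: \<psi>_def)
      fix \<theta> :: real assume "\<theta> \<in> {0..pi}"
      then have \<theta>: "0 \<le> \<theta>" "\<theta> \<le> pi" by auto
      show "2 * (indicator {0..1 / real k} \<theta> * (\<theta> / pi) ^ ?n) \<le> (1 - cos \<theta>) * \<psi> (cos \<theta>) * sin \<theta> ^ (?n - 2)"
      proof (cases "\<theta> \<le> 1 / real k")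
        case True
        have "cos (1 / real k) \<le> cos \<theta>" by (rule cos_monotone_0_pi_le[OF \<theta>(1) True kpi])
        then have 1: "\<psi> (cos \<theta>) = 1" by (simp add: \<psi>_def)
        have 2: "\<theta> / pi \<le> sin \<theta>" by (rule small_angle_sin[OF k \<theta>(1) True])
        have "\<theta> / pi \<le> sin (\<theta> / 2)" using sine_ge_linear[of "\<theta> / 2"] \<theta> by simp
        then have "(\<theta> / pi)\<^sup>2 \<le> (sin (\<theta> / 2))\<^sup>2" using \<theta> by (intro power_mono) auto
        then have 3: "2 * (\<theta> / pi)\<^sup>2 \<le> 1 - cos \<theta>" using cos_double_sin[of "\<theta> / 2"] by simp
        have "2 * (\<theta> / pi)\<^sup>2 * (\<theta> / pi) ^ (?n - 2) \<le> (1 - cos \<theta>) * sin \<theta> ^ (?n - 2)"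
          using 2 3 \<theta> by (intro mult_mono power_mono) auto
        moreover have "?n = 2 + (?n - 2)" using n by simp
        then have "(\<theta> / pi)\<^sup>2 * (\<theta> / pi) ^ (?n - 2) = (\<theta> / pi) ^ ?n"
          by (metis power_add)
        ultimately show ?thesis using True \<theta> 1 by (simp add: mult.assoc)
      next
        case False
        then have "indicator {0..1 / real k} \<theta> = (0::real)" by simp
        moreover have "0 \<le> (1 - cos \<theta>) * \<psi> (cos \<theta>) * sin \<theta> ^ (?n - 2)"
          using \<theta> by (intro mult_nonneg_nonneg zero_le_power sin_ge_zero) (auto simp: \<psi>_def)
        ultimately show ?thesis by (simp del: indicator_simps)
      qed
    qed
    ultimately show ?thesis
      using pos(1) by (simp only: mult_left_mono less_imp_le)
  qed
  have "q * dirichlet \<psi> H \<le> dirichlet (jackson_zonal ?n k s) H"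
  proof (rule dirichlet_mono[OF zonal_kernel_jackson[OF n(1) k] \<psi> H])
    fix t :: real assume t: "-1 \<le> t" "t < 1"
    show "q * \<psi> t \<le> jackson_zonal ?n k s t"
    proof (cases "cos (1 / real k) \<le> t")
      case True
      define \<theta> where "\<theta> = arccos t"
      have \<theta>: "0 < \<theta>" "\<theta> \<le> 1 / real k"
      proof -
        show "0 < \<theta>" using t arccos_less_arccos[of t 1] by (simp add: \<theta>_def)
        have "arccos t \<le> arccos (cos (1 / real k))"
          using True t by (intro arccos_le_arccos) auto
        also have "\<dots> = 1 / real k" using k1 kpi by (intro arccos_cos) (simp_all only: less_imp_le)
        finally show "\<theta> \<le> 1 / real k" by (simp add: \<theta>_def)
      qed
      then have "real k / 2 \<le> sine_quotient k \<theta>" using k by (intro sine_quotient_ge) (auto simp: field_simps)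
      then have "(real k / 2) ^ (2 * s) \<le> sine_quotient k \<theta> ^ (2 * s)" by (intro power_mono) auto
      then show ?thesis
        using pos True t by (simp add: q_def \<psi>_def jackson_zonal_def clamp1_eq \<theta>_def A_def \<sigma>_def divide_right_mono)
    next
      case False
      then show ?thesis using jackson_zonal_nonneg[OF n(1) k] by (simp add: \<psi>_def)
    qed
  qed
  moreover have "2 * M * (\<integral>x. (H x)\<^sup>2 \<partial>sph) \<le> dirichlet \<psi> H"
    unfolding M_def
  proof (rule dirichlet_odd[OF \<psi> _ H v odd e])
    show "\<psi> a \<le> \<psi> b" if "a \<le> b" for a b using that by (auto simp: \<psi>_def indicator_def)
  qed
  moreover have "0 \<le> q" using pos by (simp add: q_def)
  ultimately have 1: "q * (2 * M * (\<integral>x. (H x)\<^sup>2 \<partial>sph)) \<le> dirichlet (jackson_zonal ?n k s) H"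
    by (meson mult_left_mono order_trans)
  have "c / (real k)\<^sup>2 \<le> q * M"
  proof -
    define D where "D = pi ^ (?n - 2) * (1 + pi\<^sup>2) * (pi / 2)"
    have D: "0 < D" by (simp add: D_def add_pos_nonneg)
    have A_le: "A \<le> D * real k ^ (2 * s - ?n + 1)"
      unfolding A_def D_def by (rule jackson_const_le_concentrated[OF n k])
    define E where "E = 2 / (pi ^ ?n * real (?n + 1))"
    have E: "0 < E" by (simp add: E_def)
    have c': "c = E / (4 ^ s * D)" by (simp add: c D_def E_def mult_ac)
    have kp: "real k ^ (2 * s) * (real k)\<^sup>2 = real k ^ (2 * s - ?n + 1) * real k ^ (?n + 1)"
      using n by (simp only: power_add[symmetric]) simp
    have "c / (real k)\<^sup>2 = (real k / 2) ^ (2 * s) * E / (D * real k ^ (2 * s - ?n + 1) * real k ^ (?n + 1))"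
    proof -
      have "(2::real) ^ (2 * s) = 4 ^ s" by (simp add: power_mult)
      then have "(real k / 2) ^ (2 * s) * E / (D * real k ^ (2 * s - ?n + 1) * real k ^ (?n + 1)) =
          real k ^ (2 * s) * E / (4 ^ s * (D * (real k ^ (2 * s - ?n + 1) * real k ^ (?n + 1))))"
        by (simp add: power_divide)
      also have "\<dots> = c / (real k)\<^sup>2"
        unfolding kp[symmetric] c' using k D by (simp add: field_simps)
      finally show ?thesis by simp
    qed
    also have "\<dots> \<le> (real k / 2) ^ (2 * s) * E / (A * real k ^ (?n + 1))"
      using A_le pos E k by (intro divide_left_mono mult_right_mono) (auto intro!: mult_pos_pos mult_nonneg_nonneg D)
    also have "\<dots> = q * (\<sigma> * (2 / (pi ^ ?n * real (?n + 1) * real k ^ (?n + 1))))"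
      using pos by (simp add: q_def E_def)
    also have "\<dots> \<le> q * M" using M \<open>0 \<le> q\<close> by (rule mult_left_mono)
    finally show ?thesis .
  qed
  then have "(c / (real k)\<^sup>2) * (2 * (\<integral>x. (H x)\<^sup>2 \<partial>sph)) \<le> q * M * (2 * (\<integral>x. (H x)\<^sup>2 \<partial>sph))"
    by (rule mult_right_mono) simp
  with 1 show ?thesis by (simp add: mult_ac)
qed

text \<open>
  Integration by parts.
\<close>

lemma integral_cos_sin_power:
  assumes m: "1 \<le> m" and j: "0 < j"
  shows "\<bar>LINT \<theta>:{0..pi}|lborel. cos (j * \<theta>) * sin \<theta> ^ m\<bar> \<le> real m * pi / j"
proof -
  let ?f = "\<lambda>\<theta>. cos (j * \<theta>) * sin \<theta> ^ m" and ?g = "\<lambda>\<theta>. sin (j * \<theta>) / j * (real m * sin \<theta> ^ (m - 1) * cos \<theta>)"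
  have i: "set_integrable lborel {0..pi} ?f" "set_integrable lborel {0..pi} ?g"
    using j by (auto intro!: borel_integrable_atLeastAtMost' continuous_intros)
  have "(LINT \<theta>:{0..pi}|lborel. ?f \<theta> + ?g \<theta>) = sin (j * pi) / j * sin pi ^ m - sin (j * 0) / j * sin 0 ^ m"
  proof (rule set_integral_FTC)
    show "((\<lambda>\<theta>. sin (j * \<theta>) / j * sin \<theta> ^ m) has_real_derivative ?f \<theta> + ?g \<theta>) (at \<theta>)" for \<theta>
      using j by (auto intro!: derivative_eq_intros simp: field_simps)
  qed (use j in \<open>auto intro!: continuous_intros\<close>)
  also have "\<dots> = 0" using m by simp
  finally have "(LINT \<theta>:{0..pi}|lborel. ?f \<theta>) = - (LINT \<theta>:{0..pi}|lborel. ?g \<theta>)"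
    using i by (simp add: set_integral_add)
  then have "\<bar>LINT \<theta>:{0..pi}|lborel. ?f \<theta>\<bar> = \<bar>LINT \<theta>:{0..pi}|lborel. ?g \<theta>\<bar>" by simp
  also have "\<dots> \<le> (LINT \<theta>:{0..pi}|lborel. real m / j)"
  proof -
    have bound: "\<bar>?g \<theta>\<bar> \<le> real m / j" for \<theta>
    proof -
      have "\<bar>sin \<theta>\<bar> ^ (m - 1) \<le> 1" by (intro power_le_one) auto
      then have "\<bar>sin (j * \<theta>)\<bar> * (\<bar>sin \<theta>\<bar> ^ (m - 1) * \<bar>cos \<theta>\<bar>) \<le> 1 * (1 * 1)"
        by (intro mult_mono) auto
      then have "real m / j * (\<bar>sin (j * \<theta>)\<bar> * (\<bar>sin \<theta>\<bar> ^ (m - 1) * \<bar>cos \<theta>\<bar>)) \<le> real m / j * (1 * (1 * 1))"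
        using j by (intro mult_left_mono) auto
      then show ?thesis using j by (simp add: abs_mult power_abs mult_ac)
    qed
    have c: "set_integrable lborel {0..pi} (\<lambda>\<theta>. real m / j)"
      by (intro borel_integrable_atLeastAtMost' continuous_intros)
    have "(LINT \<theta>:{0..pi}|lborel. ?g \<theta>) \<le> (LINT \<theta>:{0..pi}|lborel. real m / j)"
      by (rule set_integral_mono[OF i(2) c]) (use bound abs_le_D1 in blast)
    moreover have "(LINT \<theta>:{0..pi}|lborel. - (real m / j)) \<le> (LINT \<theta>:{0..pi}|lborel. ?g \<theta>)"
    proof (rule set_integral_mono[OF _ i(2)])
      show "set_integrable lborel {0..pi} (\<lambda>\<theta>. - (real m / j))"
        by (intro borel_integrable_atLeastAtMost' continuous_intros)
      show "- (real m / j) \<le> ?g \<theta>" for \<theta>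
        using abs_le_D2[OF bound[of \<theta>]] by (simp only: minus_le_iff)
    qed
    moreover have "(LINT \<theta>:{0..pi}|lborel. - (real m / j)) = - (LINT \<theta>:{0..pi}|lborel. real m / j)"
      by (simp add: set_lebesgue_integral_def)
    ultimately show ?thesis by linarith
  qed
  also have "\<dots> = real m * pi / j" by (simp add: set_lebesgue_integral_def)
  finally show ?thesis .
qed

text \<open>
  The mean of \<open>cos ^ 4\<close> over a period is \<open>3 / 8\<close>; the oscillating remainder is small for large \<open>k\<close>.
\<close>

lemma integral_cos_power4:
  assumes n: "3 \<le> n" and k: "1 \<le> k"
  shows "(LINT \<theta>:{0..pi}|lborel. cos (real k * \<theta> / 2) ^ 4 * sin \<theta> ^ (n - 2)) \<le>
    3 / 8 * (LINT \<theta>:{0..pi}|lborel. sin \<theta> ^ (n - 2)) + real n * pi / real k"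
proof -
  let ?m = "n - 2"
  let ?I = "\<lambda>f. LINT \<theta>:{0..pi}|lborel. f \<theta> * sin \<theta> ^ ?m"
  have i: "set_integrable lborel {0..pi} (\<lambda>\<theta>. cos (j * \<theta>) * sin \<theta> ^ ?m)" for j
    by (intro borel_integrable_atLeastAtMost' continuous_intros)
  have i0: "set_integrable lborel {0..pi} (\<lambda>\<theta>. sin \<theta> ^ ?m)"
    by (intro borel_integrable_atLeastAtMost' continuous_intros)
  have j0: "set_integrable lborel {0..pi} (\<lambda>\<theta>. 3 / 8 * sin \<theta> ^ ?m)"
    and j1: "set_integrable lborel {0..pi} (\<lambda>\<theta>. 1 / 2 * (cos (real k * \<theta>) * sin \<theta> ^ ?m))"
    and j2: "set_integrable lborel {0..pi} (\<lambda>\<theta>. 1 / 8 * (cos (2 * real k * \<theta>) * sin \<theta> ^ ?m))"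
    by (intro set_integrable_mult_right i i0)+
  have cos4: "cos (real k * \<theta> / 2) ^ 4 = 3 / 8 + cos (real k * \<theta>) / 2 + cos (2 * real k * \<theta>) / 8" for \<theta>
  proof -
    have a: "(cos (real k * \<theta> / 2))\<^sup>2 = (1 + cos (real k * \<theta>)) / 2"
      using cos_double_cos[of "real k * \<theta> / 2"] by simp
    have b: "(cos (real k * \<theta>))\<^sup>2 = (1 + cos (2 * real k * \<theta>)) / 2"
      using cos_double_cos[of "real k * \<theta>"] by (simp add: mult.assoc)
    have "cos (real k * \<theta> / 2) ^ 4 = ((cos (real k * \<theta> / 2))\<^sup>2)\<^sup>2" by simp
    also have "\<dots> = (1 + 2 * cos (real k * \<theta>) + (cos (real k * \<theta>))\<^sup>2) / 4"
      unfolding a by (simp add: power_divide power2_sum)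
    finally show ?thesis unfolding b by (simp add: field_simps)
  qed
  have "?I (\<lambda>\<theta>. cos (real k * \<theta> / 2) ^ 4) = (LINT \<theta>:{0..pi}|lborel.
      3 / 8 * sin \<theta> ^ ?m + 1 / 2 * (cos (real k * \<theta>) * sin \<theta> ^ ?m) + 1 / 8 * (cos (2 * real k * \<theta>) * sin \<theta> ^ ?m))"
    unfolding cos4 by (simp add: algebra_simps)
  also have "\<dots> = 3 / 8 * (LINT \<theta>:{0..pi}|lborel. sin \<theta> ^ ?m) +
      1 / 2 * ?I (\<lambda>\<theta>. cos (real k * \<theta>)) + 1 / 8 * ?I (\<lambda>\<theta>. cos (2 * real k * \<theta>))"
    using j0 j1 j2 by (simp only: set_integral_add set_integral_mult_right)
  finally have eq: "?I (\<lambda>\<theta>. cos (real k * \<theta> / 2) ^ 4) = 3 / 8 * (LINT \<theta>:{0..pi}|lborel. sin \<theta> ^ ?m) +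
      1 / 2 * ?I (\<lambda>\<theta>. cos (real k * \<theta>)) + 1 / 8 * ?I (\<lambda>\<theta>. cos (2 * real k * \<theta>))" .
  define Z where "Z = real n * pi / real k"
  have "?I (\<lambda>\<theta>. cos (real k * \<theta>)) \<le> real ?m * pi / real k"
    by (rule order_trans[OF abs_ge_self integral_cos_sin_power]) (use n k in auto)
  also have "\<dots> \<le> Z" unfolding Z_def by (intro divide_right_mono mult_right_mono) auto
  finally have 1: "?I (\<lambda>\<theta>. cos (real k * \<theta>)) \<le> Z" .
  have "?I (\<lambda>\<theta>. cos (2 * real k * \<theta>)) \<le> real ?m * pi / (2 * real k)"
    by (rule order_trans[OF abs_ge_self integral_cos_sin_power]) (use n k in auto)
  also have "\<dots> \<le> Z" unfolding Z_def using k by (intro frac_le mult_right_mono) auto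
  finally have 2: "?I (\<lambda>\<theta>. cos (2 * real k * \<theta>)) \<le> Z" .
  have "0 \<le> Z" by (simp add: Z_def)
  with 1 2 show ?thesis unfolding eq Z_def[symmetric] by linarith
qed

text \<open>
  For \<open>2 * s < n\<close> the kernel need not concentrate at \<open>\<theta> = 0\<close>, and its zeros rule out a comparison with an increasing
  kernel. Instead it is bounded below by \<open>20 ^ - s / jackson_const n k s\<close>, up to a constant factor,
  at the good angles, those with \<open>(sin (k * \<theta> / 2))\<^sup>2 \<ge> 1 / 20\<close>. These fill more than half of the sphere: at bad angles
  \<open>(cos (k * \<theta> / 2)) ^ 4 \<ge> 361 / 400\<close>, and since the mean of this power is close to \<open>3 / 8\<close>, Chebyshev's inequality bounds the
  proportion of bad angles by \<open>400 / 361 * (3 / 8 + 1 / 20) < 19 / 40\<close>. So the gap for functions of mean zero applies.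
\<close>

lemma dirichlet_jackson_spread:
  fixes H :: "'a::euclidean_space \<Rightarrow> real"
  assumes n: "3 \<le> DIM('a)" "2 * s < DIM('a)" and s: "1 \<le> s" and k: "1 \<le> k"
    and W: "W = (LINT \<theta>:{0..pi}|lborel. sin \<theta> ^ (DIM('a) - 2))"
    and large: "real DIM('a) * pi / real k \<le> W / 20"
    and c: "c = W / (20 * 20 ^ s * (pi ^ (2 * s - 2) * pi ^ (DIM('a) - 2 * s) * pi))"
    and H: "bounded_on_sphere H" and mean: "(\<integral>x. H x \<partial>sph) = 0"
  shows "2 * (c / (real k)\<^sup>2) * (\<integral>x. (H x)\<^sup>2 \<partial>sph) \<le> dirichlet (jackson_zonal DIM('a) k s) H"
proof -
  let ?n = "DIM('a)"
  let ?S = "measure (sph :: 'a measure) (sphere 0 1)"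
  define A where "A = jackson_const ?n k s"
  define \<sigma> where "\<sigma> = sphere_area (?n - 1)"
  have pos: "0 < \<sigma>" "0 < A"
    using jackson_const_pos[OF n(1) k] sphere_area_pos[of "?n - 1"] n by (auto simp: A_def \<sigma>_def)
  have S: "?S = \<sigma> * W" using measure_sphere_eq[where 'a = 'a] n by (simp add: W \<sigma>_def)
  have "0 \<le> real ?n * pi / real k" by simp
  with large have W0: "0 \<le> W" by linarith
  \<comment> \<open>The threshold is small enough for the good angles to fill more than half of the sphere.\<close>
  define good where "good = (\<lambda>\<theta>. 1 / 20 \<le> (sin (real k * \<theta> / 2))\<^sup>2)"
  define g :: "real \<Rightarrow> real" where "g = (\<lambda>t. indicator {\<theta>. good \<theta>} (arccos (clamp1 t)))"
  have [measurable]: "{\<theta>. good \<theta>} \<in> sets borel" unfolding good_def by measurable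
  have g_meas [measurable]: "g \<in> borel_measurable borel" unfolding g_def by measurable
  have g_le: "g t \<le> 1" for t by (simp add: g_def indicator_def)
  have g: "zonal_kernel 1 g"
    unfolding zonal_kernel_def using g_meas by (intro conjI) (auto simp: g_def indicator_def)
  obtain e :: 'a where e: "norm e = 1" using vector_choose_size[of 1] by auto
  define m where "m = (\<integral>y. g (e \<bullet> y) \<partial>sph)"
  have m: "zonal_mass TYPE('a) g m"
    unfolding m_def zonal_mass_def using zonal_integral_indep[OF g_meas _ e] by auto
  have m_ge: "?S / 20 \<le> 2 * m - ?S"
  proof -
    have ig: "integrable sph (\<lambda>y. g (e \<bullet> y))" using integrable_zonal_integrand[OF g _ e, of "\<lambda>_. 1"] by simp
    have "?S - m = (\<integral>y. 1 - g (e \<bullet> y) \<partial>sph)" using ig by (simp add: m_def)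
    also have "\<dots> = \<sigma> * (LINT \<theta>:{0..pi}|lborel. (1 - g (cos \<theta>)) * sin \<theta> ^ (?n - 2))"
      unfolding \<sigma>_def using n g_le by (intro integral_zonal[of "\<lambda>t. 1 - g t"] e) auto
    also have "\<dots> \<le> \<sigma> * (LINT \<theta>:{0..pi}|lborel. 400 / 361 * (cos (real k * \<theta> / 2) ^ 4 * sin \<theta> ^ (?n - 2)))"
    proof (intro mult_left_mono set_integral_mono)
      show "set_integrable lborel {0..pi} (\<lambda>\<theta>. (1 - g (cos \<theta>)) * sin \<theta> ^ (?n - 2))"
      proof (rule set_integrable_bounded[where B = "1 * 1"])
        fix \<theta> :: real
        have "\<bar>1 - g (cos \<theta>)\<bar> \<le> 1" by (simp add: g_def indicator_def)
        moreover have "\<bar>sin \<theta> ^ (?n - 2)\<bar> \<le> 1" unfolding power_abs by (intro power_le_one) auto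
        ultimately show "\<bar>(1 - g (cos \<theta>)) * sin \<theta> ^ (?n - 2)\<bar> \<le> 1 * 1"
          unfolding abs_mult by (intro mult_mono) auto
      qed measurable
      show "set_integrable lborel {0..pi} (\<lambda>\<theta>. 400 / 361 * (cos (real k * \<theta> / 2) ^ 4 * sin \<theta> ^ (?n - 2)))"
        by (intro borel_integrable_atLeastAtMost' continuous_intros) auto
      fix \<theta> :: real assume \<theta>: "\<theta> \<in> {0..pi}"
      have gc: "g (cos \<theta>) = indicator {\<theta>. good \<theta>} \<theta>" using \<theta> by (simp add: g_def arccos_clamp1_cos)
      have "1 - g (cos \<theta>) \<le> 400 / 361 * cos (real k * \<theta> / 2) ^ 4"
      proof (cases "good \<theta>")
        case False
        then have "19 / 20 \<le> (cos (real k * \<theta> / 2))\<^sup>2" by (simp add: good_def cos_squared_eq)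
        then have "(19 / 20)\<^sup>2 \<le> ((cos (real k * \<theta> / 2))\<^sup>2)\<^sup>2" by (intro power_mono) auto
        then have "361 / 400 \<le> cos (real k * \<theta> / 2) ^ 4" by (simp add: power_divide)
        then show ?thesis using False unfolding gc by simp
      qed (simp add: gc)
      then have "(1 - g (cos \<theta>)) * sin \<theta> ^ (?n - 2) \<le> 400 / 361 * cos (real k * \<theta> / 2) ^ 4 * sin \<theta> ^ (?n - 2)"
        using \<theta> by (intro mult_right_mono zero_le_power sin_ge_zero) auto
      then show "(1 - g (cos \<theta>)) * sin \<theta> ^ (?n - 2) \<le> 400 / 361 * (cos (real k * \<theta> / 2) ^ 4 * sin \<theta> ^ (?n - 2))"
        by (simp add: mult.assoc)
    qed (use pos in auto)
    also have "(LINT \<theta>:{0..pi}|lborel. 400 / 361 * (cos (real k * \<theta> / 2) ^ 4 * sin \<theta> ^ (?n - 2))) =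
        400 / 361 * (LINT \<theta>:{0..pi}|lborel. cos (real k * \<theta> / 2) ^ 4 * sin \<theta> ^ (?n - 2))"
      by (rule set_integral_mult_right)
    also have "\<sigma> * \<dots> \<le> \<sigma> * (19 / 40 * W)"
      using integral_cos_power4[OF n(1) k] large W0 pos unfolding W[symmetric] by (intro mult_left_mono) auto
    finally show ?thesis unfolding S by (simp add: algebra_simps)
  qed
  define q where "q = (1 / 20) ^ s / (\<sigma> * A)"
  have q: "0 \<le> q" using pos by (simp add: q_def)
  have "q * dirichlet g H \<le> dirichlet (jackson_zonal ?n k s) H"
  proof (rule dirichlet_mono[OF zonal_kernel_jackson[OF n(1) k] g H])
    fix t :: real
    show "q * g t \<le> jackson_zonal ?n k s t"
    proof (cases "good (arccos (clamp1 t))")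
      case True
      define \<theta> where "\<theta> = arccos (clamp1 t)"
      have "(1 / 20) ^ s \<le> ((sin (real k * \<theta> / 2))\<^sup>2) ^ s"
        using True by (intro power_mono) (auto simp: good_def \<theta>_def)
      also have "\<dots> \<le> ((sine_quotient k \<theta>)\<^sup>2) ^ s"
      proof (rule power_mono)
        have sn: "sin (\<theta> / 2) \<noteq> 0"
        proof
          assume "sin (\<theta> / 2) = 0"
          then have "sin (real k * (\<theta> / 2)) = 0" using abs_sin_nat_mult_le[of k "\<theta> / 2"] by simp
          then show False using True by (simp add: good_def \<theta>_def)
        qed
        have "\<bar>sin (real k * \<theta> / 2)\<bar> * \<bar>sin (\<theta> / 2)\<bar> \<le> \<bar>sin (real k * \<theta> / 2)\<bar> * 1"
          by (intro mult_left_mono) auto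
        then have "\<bar>sin (real k * \<theta> / 2)\<bar> \<le> \<bar>sine_quotient k \<theta>\<bar>"
          using sn by (simp add: sine_quotient_def pos_le_divide_eq)
        then show "(sin (real k * \<theta> / 2))\<^sup>2 \<le> (sine_quotient k \<theta>)\<^sup>2" by (simp add: abs_le_square_iff)
      qed auto
      also have "\<dots> = sine_quotient k \<theta> ^ (2 * s)" by (simp add: power_mult)
      finally show ?thesis
        using pos True by (simp add: q_def g_def jackson_zonal_def \<theta>_def A_def \<sigma>_def divide_right_mono)
    next
      case False
      then show ?thesis using jackson_zonal_nonneg[OF n(1) k] by (simp add: g_def)
    qed
  qed
  moreover have "2 * (2 * m - ?S) * (\<integral>x. (H x)\<^sup>2 \<partial>sph) \<le> dirichlet g H"
    by (rule dirichlet_mean_zero[OF g m H _ mean]) (simp add: g_def indicator_def)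
  ultimately have 1: "q * (2 * (2 * m - ?S) * (\<integral>x. (H x)\<^sup>2 \<partial>sph)) \<le> dirichlet (jackson_zonal ?n k s) H"
    using q by (meson mult_left_mono order_trans)
  have "c / (real k)\<^sup>2 \<le> q * (2 * m - ?S)"
  proof -
    define D where "D = pi ^ (2 * s - 2) * pi ^ (?n - 2 * s) * pi"
    have D: "0 < D" by (simp add: D_def)
    have A_le: "A \<le> D * (real k)\<^sup>2" unfolding A_def D_def by (rule jackson_const_le_spread[OF n s])
    have "c / (real k)\<^sup>2 = (1 / 20) ^ s * (W / 20) / (D * (real k)\<^sup>2)"
      by (simp add: c D_def power_divide)
    also have "\<dots> \<le> (1 / 20) ^ s * (W / 20) / A"
      using A_le pos W0 D k by (intro divide_left_mono mult_nonneg_nonneg mult_pos_pos) auto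
    also have "\<dots> = q * (?S / 20)" using pos by (simp add: q_def S)
    also have "\<dots> \<le> q * (2 * m - ?S)" using m_ge q by (rule mult_left_mono)
    finally show ?thesis .
  qed
  then have "(c / (real k)\<^sup>2) * (2 * (\<integral>x. (H x)\<^sup>2 \<partial>sph)) \<le> q * (2 * m - ?S) * (2 * (\<integral>x. (H x)\<^sup>2 \<partial>sph))"
    by (rule mult_right_mono) simp
  with 1 show ?thesis by (simp only: mult_ac)
qed

lemma sin_power_integral_pos:
  assumes "3 \<le> n"
  shows "0 < (LINT \<theta>:{0..pi}|lborel. sin \<theta> ^ (n - 2))"
  using jackson_const_pos[OF assms, of 1 0] unfolding jackson_const_eq[OF assms] by simp

text \<open>
  The spectral gap of order \<open>1 / k\<^sup>2\<close> on odd functions, for every exponent \<open>s\<close>.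
\<close>

lemma jackson_gap:
  fixes s :: nat
  assumes n: "3 \<le> DIM('a::euclidean_space)" and s: "1 \<le> s"
  shows "\<exists>c K. 0 < c \<and> 1 \<le> K \<and> (\<forall>k v (H :: 'a \<Rightarrow> real). K \<le> k \<longrightarrow> norm v = 1 \<longrightarrow> bounded_on_sphere H \<longrightarrow>
      (\<forall>x. norm x = 1 \<longrightarrow> H (reflection v x) = - H x) \<longrightarrow>
      (c / (real k)\<^sup>2)\<^sup>2 * (\<integral>x. (H x)\<^sup>2 \<partial>sph) \<le>
        (\<integral>x. (H x - zonal_conv (jackson_zonal DIM('a) k s) H x)\<^sup>2 \<partial>sph))"
proof -
  let ?n = "DIM('a)"
  have "\<exists>c K. 0 < c \<and> 1 \<le> K \<and> (\<forall>k v (H :: 'a \<Rightarrow> real). K \<le> k \<longrightarrow> norm v = 1 \<longrightarrow> bounded_on_sphere H \<longrightarrow>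
        (\<forall>x. norm x = 1 \<longrightarrow> H (reflection v x) = - H x) \<longrightarrow>
      2 * (c / (real k)\<^sup>2) * (\<integral>x. (H x)\<^sup>2 \<partial>sph) \<le> dirichlet (jackson_zonal ?n k s) H)"
  proof (cases "?n \<le> 2 * s")
    case True
    define c where "c = 2 / (4 ^ s * pi ^ ?n * real (?n + 1) * (pi ^ (?n - 2) * (1 + pi\<^sup>2) * (pi / 2)))"
    have "0 < 1 + pi\<^sup>2" by (simp add: add_pos_nonneg)
    then have "0 < c" unfolding c_def by (intro divide_pos_pos mult_pos_pos) auto
    then show ?thesis
      using dirichlet_jackson_concentrated[OF n True _ c_def]
      by (intro exI[of _ c] exI[of _ 1]) simp
  next
    case False
    then have ns: "2 * s < ?n" by simp
    define W where "W = (LINT \<theta>:{0..pi}|lborel. sin \<theta> ^ (?n - 2))"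
    have W: "0 < W" unfolding W_def by (rule sin_power_integral_pos[OF n])
    define c where "c = W / (20 * 20 ^ s * (pi ^ (2 * s - 2) * pi ^ (?n - 2 * s) * pi))"
    have c: "0 < c" unfolding c_def using W by (intro divide_pos_pos mult_pos_pos) auto
    \<comment> \<open>From here on the oscillating part of the mean of \<open>cos ^ 4\<close> is negligible.\<close>
    define K where "K = nat \<lceil>20 * real ?n * pi / W\<rceil> + 1"
    have large: "real ?n * pi / real k \<le> W / 20" if "K \<le> k" for k
    proof -
      have "20 * real ?n * pi / W \<le> real K" unfolding K_def by linarith
      also have "\<dots> \<le> real k" using that by simp
      finally have "20 * real ?n * pi \<le> real k * W" using W by (simp add: pos_divide_le_eq)
      moreover have "0 < real k" using that by (simp add: K_def)
      ultimately show ?thesis by (simp add: pos_divide_le_eq mult.commute)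
    qed
    have "2 * (c / (real k)\<^sup>2) * (\<integral>x. (H x)\<^sup>2 \<partial>sph) \<le> dirichlet (jackson_zonal ?n k s) H"
      if "K \<le> k" "norm v = 1" "bounded_on_sphere H" "\<And>x. norm x = 1 \<Longrightarrow> H (reflection v x) = - H x"
      for k v and H :: "'a \<Rightarrow> real"
    proof -
      have "1 \<le> k" using that(1) by (simp add: K_def)
      moreover have "(\<integral>x. H x \<partial>sph) = 0"
        using that by (intro odd_integral_zero[of H v] bounded_on_sphere_integrable)
      ultimately show ?thesis
        by (intro dirichlet_jackson_spread[OF n ns s _ W_def large[OF that(1)] c_def that(3)])
    qed
    with c show ?thesis by (intro exI[of _ c] exI[of _ K]) (simp add: K_def)
  qed
  then obtain c K where cK: "0 < c" "1 \<le> K" and gap: "\<And>k v (H :: 'a \<Rightarrow> real). \<lbrakk>K \<le> k; norm v = 1;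
      bounded_on_sphere H; \<forall>x. norm x = 1 \<longrightarrow> H (reflection v x) = - H x\<rbrakk> \<Longrightarrow>
      2 * (c / (real k)\<^sup>2) * (\<integral>x. (H x)\<^sup>2 \<partial>sph) \<le> dirichlet (jackson_zonal ?n k s) H"
    by blast
  show ?thesis
  proof (intro exI[of _ c] exI[of _ K] conjI cK allI impI)
    fix k v and H :: "'a \<Rightarrow> real"
    assume *: "K \<le> k" "norm v = 1" "bounded_on_sphere H" "\<forall>x. norm x = 1 \<longrightarrow> H (reflection v x) = - H x"
    have k: "1 \<le> k" using cK *(1) by simp
    show "(c / (real k)\<^sup>2)\<^sup>2 * (\<integral>x. (H x)\<^sup>2 \<partial>sph) \<le>
        (\<integral>x. (H x - zonal_conv (jackson_zonal ?n k s) H x)\<^sup>2 \<partial>sph)"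
      using cK gap[OF *(1-3)] *(4)
      by (intro norm_defect_lower_bound[OF zonal_kernel_jackson[OF n k] zonal_mass_jackson[OF n k] *(3)]) auto
  qed
qed

section \<open>Powers of the approximation error\<close>

definition residual :: "nat \<Rightarrow> nat \<Rightarrow> nat \<Rightarrow> ('a::euclidean_space \<Rightarrow> real) \<Rightarrow> 'a \<Rightarrow> real" where
  "residual k s j f = ((\<lambda>g y. g y - jackson k s g y) ^^ j) f"

lemma residual_0 [simp]: "residual k s 0 f = f"
  by (simp add: residual_def)

lemma residual_Suc: "residual k s (Suc j) f x = residual k s j f x - jackson k s (residual k s j f) x"
  by (simp add: residual_def)

lemma bounded_on_sphere_jackson:
  fixes f :: "'a::euclidean_space \<Rightarrow> real"
  assumes n: "3 \<le> DIM('a)" and k: "1 \<le> k" and f: "integrable sph f"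
  shows "bounded_on_sphere (jackson k s f)"
proof -
  have b: "bounded_on_sphere (zonal_conv (jackson_zonal DIM('a) k s) f)"
    by (rule bounded_on_sphere_zonal_conv[OF zonal_kernel_jackson[OF n k] f])
  moreover have "jackson k s f \<in> borel_measurable sph"
    using bounded_on_sphere_measurable[OF b]
    by (subst measurable_cong[where g = "zonal_conv (jackson_zonal DIM('a) k s) f"])
      (auto simp: jackson_eq_zonal_conv)
  ultimately show ?thesis by (simp add: bounded_on_sphere_def jackson_eq_zonal_conv)
qed

lemma residual_integrable:
  fixes f :: "'a::euclidean_space \<Rightarrow> real"
  assumes n: "3 \<le> DIM('a)" and k: "1 \<le> k" and f: "integrable sph f"
  shows "integrable sph (residual k s j f)"
proof (induction j)
  case (Suc j)
  have "integrable sph (jackson k s (residual k s j f))"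
    by (intro bounded_on_sphere_integrable bounded_on_sphere_jackson n k Suc)
  with Suc show ?case unfolding residual_Suc[abs_def] by simp
qed (simp add: f)

lemma bounded_on_sphere_diff_residual:
  fixes f :: "'a::euclidean_space \<Rightarrow> real"
  assumes n: "3 \<le> DIM('a)" and k: "1 \<le> k" and f: "integrable sph f"
  shows "bounded_on_sphere (\<lambda>x. f x - residual k s j f x)"
proof (induction j)
  case 0
  show ?case using bounded_on_sphere_const[of 0] by simp
next
  case (Suc j)
  have "bounded_on_sphere (\<lambda>x. (f x - residual k s j f x) - (0 - jackson k s (residual k s j f) x))"
    by (intro bounded_on_sphere_diff bounded_on_sphere_const bounded_on_sphere_jackson Suc n k
        residual_integrable f)
  then show ?case unfolding residual_Suc by (simp add: algebra_simps)
qed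

lemma residual_cong_AE:
  fixes f g :: "'a::euclidean_space \<Rightarrow> real"
  assumes n: "3 \<le> DIM('a)" and k: "1 \<le> k" and f: "integrable sph f" and g: "integrable sph g"
    and eq: "AE x in sph. f x = g x"
  shows "AE x in sph. residual k s j f x = residual k s j g x"
proof (induction j)
  case (Suc j)
  note [measurable] = zonal_kernelD(1)[OF zonal_kernel_jackson[OF n k]]
  have [measurable]: "residual k s j f \<in> borel_measurable sph" "residual k s j g \<in> borel_measurable sph"
    using residual_integrable[OF n k f] residual_integrable[OF n k g] by auto
  have "jackson k s (residual k s j f) x = jackson k s (residual k s j g) x" if "norm x = 1" for x
    unfolding jackson_eq_zonal_conv[OF that] zonal_conv_def
  proof (rule integral_cong_AE)
    show "AE y in sph. residual k s j f y * jackson_zonal DIM('a) k s (x \<bullet> y) =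
        residual k s j g y * jackson_zonal DIM('a) k s (x \<bullet> y)"
      using Suc by eventually_elim simp
  qed measurable
  then have "AE x in sph. jackson k s (residual k s j f) x = jackson k s (residual k s j g) x"
    by (intro AE_I2) simp
  with Suc show ?case unfolding residual_Suc by eventually_elim simp
qed (simp add: eq)

lemma residual_const:
  fixes c :: real
  assumes n: "3 \<le> DIM('a::euclidean_space)" and k: "1 \<le> k" and x: "norm (x :: 'a) = 1"
  shows "residual k s (Suc j) (\<lambda>_. c) x = 0"
  using x
proof (induction j arbitrary: x)
  case 0
  then show ?case
    using zonal_massD[OF zonal_mass_jackson[OF n k]]
    by (simp add: residual_Suc jackson_eq_zonal_conv zonal_conv_def)
next
  case (Suc j)
  have "jackson k s (residual k s (Suc j) (\<lambda>_. c)) x = zonal_conv (jackson_zonal DIM('a) k s) (\<lambda>_. 0) x"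
    unfolding jackson_eq_zonal_conv[OF Suc.prems] by (rule zonal_conv_cong[OF Suc.IH])
  then show ?case using Suc by (simp add: residual_Suc[of k s "Suc j"] zonal_conv_def)
qed

text \<open>
  Smoothing by a bounded kernel \<open>\<phi>\<close> turns a bound on the \<open>L\<^sup>1\<close> norm of a residual into a uniform one, and it
  commutes with the Jackson operator. The odd parts \<open>h j\<close> of the smoothed residuals are therefore the iterates
  of the identity minus the Jackson operator on \<open>h 0\<close>, and each step costs at most the factor \<open>\<delta>\<close> in \<open>L\<^sup>2\<close>.
\<close>

lemma residual_odd_bound:
  fixes f :: "'a::euclidean_space \<Rightarrow> real"
  assumes n: "3 \<le> DIM('a)" and \<phi>: "zonal_kernel B \<phi>" and f: "integrable sph f" and v: "norm v = 1"
    and k: "1 \<le> k"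
    and gap: "\<And>H :: 'a \<Rightarrow> real. \<lbrakk>bounded_on_sphere H; \<And>x. norm x = 1 \<Longrightarrow> H (reflection v x) = - H x\<rbrakk> \<Longrightarrow>
      \<delta>\<^sup>2 * (\<integral>x. (H x)\<^sup>2 \<partial>sph) \<le>
        (\<integral>x. (H x - zonal_conv (jackson_zonal DIM('a) k s) H x)\<^sup>2 \<partial>sph)"
  shows "\<delta> ^ (2 * r) * (\<integral>x. (zonal_conv \<phi> f x - zonal_conv \<phi> f (reflection v x))\<^sup>2 \<partial>sph) \<le>
    measure sph (sphere (0::'a) 1) * (2 * B)\<^sup>2 * (\<integral>x. \<bar>residual k s r f x\<bar> \<partial>sph)\<^sup>2"
proof -
  let ?\<kappa> = "jackson_zonal DIM('a) k s"
  define h where "h = (\<lambda>j x. zonal_conv \<phi> (residual k s j f) x - zonal_conv \<phi> (residual k s j f) (reflection v x))"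
  note \<kappa> = zonal_kernel_jackson[OF n k, of s]
  note u = residual_integrable[OF n k f, of s]
  have R: "norm (reflection v x) = 1" if "norm x = 1" for x using norm_reflection[OF v] that by simp
  have refl_u: "zonal_conv \<phi> g (reflection v x) = zonal_conv \<phi> (\<lambda>y. g (reflection v y)) x"
    if "zonal_kernel B \<phi>" "integrable sph g" for \<phi> B x and g :: "'a \<Rightarrow> real"
    using that zonal_kernelD(1)[OF that(1)] by (intro zonal_conv_reflection v) auto
  have int_refl: "integrable sph (\<lambda>y. g (reflection v y))" if "integrable sph g" for g :: "'a \<Rightarrow> real"
    using integrable_sphere_orthogonal[OF orthogonal_reflection[OF v], of g] that by auto
  have cb: "bounded_on_sphere (zonal_conv \<phi> (residual k s j f))" for j
    by (rule bounded_on_sphere_zonal_conv[OF \<phi> u])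
  have cbR: "bounded_on_sphere (\<lambda>x. zonal_conv \<phi> (residual k s j f) (reflection v x))" for j
    unfolding refl_u[OF \<phi> u] by (rule bounded_on_sphere_zonal_conv[OF \<phi> int_refl[OF u]])
  have h_bdd: "bounded_on_sphere (h j)" for j
    unfolding h_def by (rule bounded_on_sphere_diff[OF cb cbR])
  have h_odd: "h j (reflection v x) = - h j x" for j x
    by (simp add: h_def reflection_reflection[OF v])
  have step: "h (Suc j) x = h j x - zonal_conv ?\<kappa> (h j) x" if x: "norm x = 1" for j x
  proof -
    have one: "zonal_conv \<phi> (residual k s (Suc j) f) x =
        zonal_conv \<phi> (residual k s j f) x - zonal_conv ?\<kappa> (zonal_conv \<phi> (residual k s j f)) x" if x: "norm x = 1" for x
    proof -
      have "zonal_conv \<phi> (residual k s (Suc j) f) x =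
          zonal_conv \<phi> (\<lambda>y. residual k s j f y - zonal_conv ?\<kappa> (residual k s j f) y) x"
        by (rule zonal_conv_cong) (simp add: residual_Suc jackson_eq_zonal_conv)
      also have "\<dots> = zonal_conv \<phi> (residual k s j f) x - zonal_conv \<phi> (zonal_conv ?\<kappa> (residual k s j f)) x"
        by (rule zonal_conv_diff[OF \<phi> u integrable_zonal_conv[OF \<kappa> u] x])
      also have "zonal_conv \<phi> (zonal_conv ?\<kappa> (residual k s j f)) x = zonal_conv ?\<kappa> (zonal_conv \<phi> (residual k s j f)) x"
        by (rule zonal_conv_commute[OF \<phi> \<kappa> u x])
      finally show ?thesis .
    qed
    have "zonal_conv ?\<kappa> (h j) x = zonal_conv ?\<kappa> (zonal_conv \<phi> (residual k s j f)) x -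
        zonal_conv ?\<kappa> (\<lambda>y. zonal_conv \<phi> (residual k s j f) (reflection v y)) x"
      unfolding h_def by (rule zonal_conv_diff[OF \<kappa> bounded_on_sphere_integrable[OF cb] bounded_on_sphere_integrable[OF cbR] x])
    also have "zonal_conv ?\<kappa> (\<lambda>y. zonal_conv \<phi> (residual k s j f) (reflection v y)) x =
        zonal_conv ?\<kappa> (zonal_conv \<phi> (residual k s j f)) (reflection v x)"
      by (rule refl_u[OF \<kappa> bounded_on_sphere_integrable[OF cb], symmetric])
    finally show ?thesis using one[OF x] one[OF R[OF x]] by (simp add: h_def)
  qed
  have "\<delta> ^ (2 * j) * (\<integral>x. (h 0 x)\<^sup>2 \<partial>sph) \<le> (\<integral>x. (h j x)\<^sup>2 \<partial>sph)" for j
  proof (induction j)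
    case (Suc j)
    have "\<delta> ^ (2 * Suc j) * (\<integral>x. (h 0 x)\<^sup>2 \<partial>sph) = \<delta>\<^sup>2 * (\<delta> ^ (2 * j) * (\<integral>x. (h 0 x)\<^sup>2 \<partial>sph))"
      by (simp add: power_add power2_eq_square)
    also have "\<dots> \<le> \<delta>\<^sup>2 * (\<integral>x. (h j x)\<^sup>2 \<partial>sph)"
      by (rule mult_left_mono[OF Suc]) simp
    also have "\<dots> \<le> (\<integral>x. (h j x - zonal_conv ?\<kappa> (h j) x)\<^sup>2 \<partial>sph)"
      by (rule gap[OF h_bdd h_odd])
    also have "\<dots> = (\<integral>x. (h (Suc j) x)\<^sup>2 \<partial>sph)"
      by (intro Bochner_Integration.integral_cong refl) (simp add: step)
    finally show ?case .
  qed simp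
  then have "\<delta> ^ (2 * r) * (\<integral>x. (h 0 x)\<^sup>2 \<partial>sph) \<le> (\<integral>x. (h r x)\<^sup>2 \<partial>sph)" .
  also have "\<dots> \<le> (\<integral>x. (2 * B * (\<integral>x. \<bar>residual k s r f x\<bar> \<partial>sph))\<^sup>2 \<partial>(sph :: 'a measure))"
  proof (rule integral_mono)
    show "integrable sph (\<lambda>x. (h r x)\<^sup>2)"
      by (intro bounded_on_sphere_integrable bounded_on_sphere_power2 h_bdd)
    fix x :: 'a assume "x \<in> space sph"
    then have x: "norm x = 1" by simp
    have "\<bar>h r x\<bar> \<le> 2 * B * (\<integral>x. \<bar>residual k s r f x\<bar> \<partial>sph)"
      using zonal_conv_bound[OF \<phi> u[of r] x] zonal_conv_bound[OF \<phi> u[of r] R[OF x]] unfolding h_def by linarith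
    then show "(h r x)\<^sup>2 \<le> (2 * B * (\<integral>x. \<bar>residual k s r f x\<bar> \<partial>sph))\<^sup>2"
      by (metis abs_ge_zero power2_abs power_mono)
  qed simp
  also have "\<dots> = measure sph (sphere (0::'a) 1) * (2 * B)\<^sup>2 * (\<integral>x. \<bar>residual k s r f x\<bar> \<partial>sph)\<^sup>2"
    by (simp add: power_mult_distrib)
  finally show ?thesis by (simp add: h_def)
qed

section \<open>Uniqueness for exponential transforms on the sphere\<close>

text \<open>
  The cone over a relatively open set contains an open set.
\<close>

lemma open_sphere_not_null:
  fixes x :: "'a::euclidean_space"
  assumes x: "norm x = 1" and U: "open U" "x \<in> U"
  shows "emeasure sph (U \<inter> sphere 0 1) \<noteq> 0"
proof
  assume 0: "emeasure sph (U \<inter> sphere 0 1) = 0"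
  define V where "V = {z. z \<noteq> 0 \<and> norm z < 1 \<and> z /\<^sub>R norm z \<in> U}"
  have eq: "V = (ball 0 1 - {0}) \<inter> (\<lambda>z. z /\<^sub>R norm z) -` U"
    by (auto simp: V_def)
  have V: "open V"
    unfolding eq by (intro continuous_open_preimage U continuous_intros) auto
  have half: "(1 / 2) *\<^sub>R x \<in> V" using x U by (auto simp: V_def)
  have [measurable]: "U \<in> sets borel" "V \<in> sets borel" using U V by auto
  have m [measurable]: "indicator (U \<inter> sphere 0 1) \<in> borel_measurable (sph :: 'a measure)"
    by (rule measurable_compose[OF measurable_ident_sphere]) (auto intro!: borel_measurable_indicator)
  have S: "U \<inter> sphere 0 1 \<in> sets sph" using U by (simp add: sets_restrict_space_iff)
  have "0 = (\<integral>\<^sup>+y. indicator (U \<inter> sphere 0 1) y \<partial>sph)" using 0 S by simp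
  also have "\<dots> = of_nat DIM('a) *
      (\<integral>\<^sup>+z. indicator (U \<inter> sphere 0 1) (z /\<^sub>R norm z) * indicator (cball 0 1 - {0}) z \<partial>lborel)"
    by (rule nn_integral_sphere[OF m])
  finally have "(\<integral>\<^sup>+z. indicator (U \<inter> sphere 0 1) (z /\<^sub>R norm z) * indicator (cball 0 1 - {0}) z \<partial>(lborel :: 'a measure)) = 0"
    by simp
  moreover have "(\<integral>\<^sup>+z. indicator V z \<partial>lborel) \<le>
      (\<integral>\<^sup>+z. indicator (U \<inter> sphere 0 1) (z /\<^sub>R norm z) * indicator (cball 0 1 - {0}) z \<partial>lborel)"
    by (intro nn_integral_mono) (auto simp: V_def indicator_def)
  ultimately have "emeasure lborel V = 0" by simp
  then have "negligible V"
    using V by (auto simp: negligible_iff_null_sets intro!: null_sets_completionI null_setsI)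
  with open_not_negligible[OF V] half show False by blast
qed

lemma zonal_conv_continuous:
  fixes f :: "'a::euclidean_space \<Rightarrow> real"
  assumes \<phi>: "zonal_kernel B \<phi>" and cont: "continuous_on UNIV \<phi>" and f: "integrable sph f"
  shows "continuous_on (sphere 0 1) (zonal_conv \<phi> f)"
proof (rule continuous_on_sequentiallyI)
  fix X and x :: 'a assume X: "\<forall>n. X n \<in> sphere 0 1" "x \<in> sphere 0 1" "X \<longlonglongrightarrow> x"
  note [measurable] = zonal_kernelD(1)[OF \<phi>]
  have [measurable]: "f \<in> borel_measurable sph" using f by auto
  show "(\<lambda>n. zonal_conv \<phi> f (X n)) \<longlonglongrightarrow> zonal_conv \<phi> f x"
    unfolding zonal_conv_def
  proof (rule integral_dominated_convergence)
    show "integrable sph (\<lambda>y. B * \<bar>f y\<bar>)" using f by simp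
    show "AE y in sph. (\<lambda>n. f y * \<phi> (X n \<bullet> y)) \<longlonglongrightarrow> f y * \<phi> (x \<bullet> y)"
    proof (rule AE_I2)
      fix y
      have "(\<lambda>n. \<phi> (X n \<bullet> y)) \<longlonglongrightarrow> \<phi> (x \<bullet> y)"
        by (rule continuous_on_tendsto_compose[OF cont]) (auto intro!: tendsto_intros X)
      then show "(\<lambda>n. f y * \<phi> (X n \<bullet> y)) \<longlonglongrightarrow> f y * \<phi> (x \<bullet> y)" by (intro tendsto_intros)
    qed
    show "AE y in sph. norm (f y * \<phi> (X n \<bullet> y)) \<le> B * \<bar>f y\<bar>" for n
    proof (rule AE_I2)
      fix y :: 'a assume "y \<in> space sph"
      then show "norm (f y * \<phi> (X n \<bullet> y)) \<le> B * \<bar>f y\<bar>"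
        using zonal_kernel_mult_le[OF \<phi>, of "X n" y "f y"] X by simp
    qed
  qed measurable
qed

lemma bounded_on_sphere_continuous:
  fixes g :: "'a::euclidean_space \<Rightarrow> real"
  assumes g: "continuous_on (sphere 0 1) g"
  shows "bounded_on_sphere g"
proof -
  have "bounded (g ` sphere 0 1)"
    by (intro compact_imp_bounded compact_continuous_image compact_sphere g)
  then obtain L where L: "\<forall>z\<in>g ` sphere 0 1. norm z \<le> L" unfolding bounded_iff by blast
  have "g \<in> borel_measurable sph"
    using borel_measurable_continuous_on_restrict[OF g] measurable_cong_sets[OF sets_sphere_measure refl] by blast
  then show ?thesis by (rule bounded_on_sphereI[where L = L]) (use L in auto)
qed

lemma continuous_AE_zero_on_sphere:
  fixes F :: "'a::euclidean_space \<Rightarrow> real"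
  assumes cont: "continuous_on (sphere 0 1) F" and AE: "AE x in sph. F x = 0" and x: "norm x = 1"
  shows "F x = 0"
proof (rule ccontr)
  assume "F x \<noteq> 0"
  have "open (- {0::real})" by (rule open_Compl) simp
  from continuous_on_open_invariant[THEN iffD1, OF cont, rule_format, OF this]
  obtain U where U: "open U" "U \<inter> sphere 0 1 = F -` (- {0}) \<inter> sphere 0 1" by (elim exE conjE)
  have "x \<in> U \<inter> sphere 0 1" unfolding U(2) using \<open>F x \<noteq> 0\<close> x by simp
  then have "x \<in> U" by simp
  then have "emeasure sph (U \<inter> sphere 0 1) \<noteq> 0" by (rule open_sphere_not_null[OF x U(1)])
  moreover have "emeasure sph (U \<inter> sphere 0 1) = 0"
  proof -
    have "AE x in sph. x \<notin> U \<inter> sphere 0 1" using AE U(2) by (auto elim!: eventually_mono)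
    moreover have "U \<inter> sphere 0 1 \<in> sets sph" using U(1) by (simp add: sets_restrict_space_iff)
    ultimately show ?thesis by (metis AE_iff_null_sets null_setsD1)
  qed
  ultimately show False by simp
qed

inductive exponential_sum :: "('a::euclidean_space \<Rightarrow> real) \<Rightarrow> bool" where
  exponential: "exponential_sum (\<lambda>y. c * exp (u \<bullet> y))"
| add: "exponential_sum f \<Longrightarrow> exponential_sum g \<Longrightarrow> exponential_sum (\<lambda>y. f y + g y)"

lemma exponential_sum_mult:
  assumes f: "exponential_sum f" and g: "exponential_sum g"
  shows "exponential_sum (\<lambda>y. f y * g y)"
  using f
proof induction
  case (exponential c u)
  from g show ?case
  proof induction
    case (exponential d w)
    show ?case
      using exponential_sum.exponential[of "c * d" "u + w"]
      by (simp add: inner_add_left exp_add mult_ac)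
  next
    case (add f g)
    then show ?case using exponential_sum.add[OF add(3,4)] by (simp add: distrib_left)
  qed
next
  case (add f h)
  then show ?case using exponential_sum.add[OF add(3,4)] by (simp add: distrib_right)
qed

lemma exponential_sum_continuous: "exponential_sum f \<Longrightarrow> continuous_on A f"
  by (induction rule: exponential_sum.induct) (auto intro!: continuous_intros)

lemma exponential_sum_dense:
  fixes g :: "'a::euclidean_space \<Rightarrow> real"
  assumes "continuous_on (sphere 0 1) g" "0 < e"
  shows "\<exists>h. exponential_sum h \<and> (\<forall>y\<in>sphere 0 1. \<bar>g y - h y\<bar> < e)"
proof (rule Stone_Weierstrass_HOL[OF compact_sphere, where P = exponential_sum])
  show "exponential_sum (\<lambda>x. c)" for c using exponential_sum.exponential[of c 0] by simp
  show "\<exists>f. exponential_sum f \<and> f x \<noteq> f y" if "x \<in> sphere 0 1 \<and> y \<in> sphere 0 1 \<and> x \<noteq> y" for x y :: 'a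
  proof (intro exI conjI)
    show "exponential_sum (\<lambda>z. 1 * exp ((x - y) \<bullet> z))" by (rule exponential_sum.exponential)
    have "(x - y) \<bullet> (x - y) \<noteq> 0" using that by simp
    then show "1 * exp ((x - y) \<bullet> x) \<noteq> 1 * exp ((x - y) \<bullet> y)" by (simp add: inner_diff_right)
  qed
qed (use assms in \<open>auto intro: exponential_sum_continuous exponential_sum_mult exponential_sum.add\<close>)

text \<open>
  The functions \<open>max 0 (1 - j * infdist y C)\<close> decrease to the indicator of a closed set \<open>C\<close>, and the closed sets are a
  generator of the Borel sets that is stable under intersection; so \<open>f\<close> has integral zero over every Borel set.
\<close>

lemma AE_zero_if_orthogonal_to_continuous:
  fixes f :: "'a::euclidean_space \<Rightarrow> real"
  assumes f: "integrable sph f"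
    and cont_zero: "\<And>g. continuous_on UNIV g \<Longrightarrow> (\<integral>y. f y * g y \<partial>sph) = 0"
  shows "AE x in sph. f x = 0"
proof -
  have [measurable]: "f \<in> borel_measurable sph" using f by auto
  have cont_meas: "g \<in> borel_measurable sph" if "continuous_on UNIV g" for g :: "'a \<Rightarrow> real"
    by (rule measurable_compose[OF measurable_ident_sphere borel_measurable_continuous_onI[OF that]])
  have ind_meas: "indicator A \<in> borel_measurable (sph :: 'a measure)" if "A \<in> sets borel" for A :: "'a set"
    by (rule measurable_compose[OF measurable_ident_sphere borel_measurable_indicator[OF that]])
  have int_ind: "integrable sph (\<lambda>y. f y * indicator A y)" if "A \<in> sets borel" for A
  proof (rule Bochner_Integration.integrable_bound[OF f])
    show "(\<lambda>y. f y * indicator A y) \<in> borel_measurable sph"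
      using ind_meas[OF that] by measurable
    show "AE y in sph. norm (f y * indicator A y) \<le> norm (f y)"
      by (rule AE_I2) (simp add: indicator_def)
  qed
  have closed_zero: "(\<integral>y. f y * indicator C y \<partial>sph) = 0" if C: "closed C" for C
  proof (cases "C = {}")
    case False
    define g where "g = (\<lambda>j y. max 0 (1 - real j * infdist y C))"
    have g: "continuous_on UNIV (g j)" for j
      unfolding g_def by (intro continuous_intros)
    have "(\<lambda>j. \<integral>y. f y * g j y \<partial>sph) \<longlonglongrightarrow> (\<integral>y. f y * indicator C y \<partial>sph)"
    proof (rule integral_dominated_convergence)
      show "(\<lambda>y. f y * indicator C y) \<in> borel_measurable sph"
        using ind_meas[OF borel_closed[OF C]] by (intro borel_measurable_times) auto
      show "(\<lambda>y. f y * g j y) \<in> borel_measurable sph" for j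
        using cont_meas[OF g] by (intro borel_measurable_times) auto
      show "integrable sph (\<lambda>y. \<bar>f y\<bar>)" using f by simp
      show "AE y in sph. norm (f y * g j y) \<le> \<bar>f y\<bar>" for j
      proof (rule AE_I2)
        fix y
        have "\<bar>g j y\<bar> \<le> 1" using infdist_nonneg[of y C] by (simp add: g_def)
        then have "\<bar>f y\<bar> * \<bar>g j y\<bar> \<le> \<bar>f y\<bar> * 1" by (intro mult_left_mono) auto
        then show "norm (f y * g j y) \<le> \<bar>f y\<bar>" by (simp add: abs_mult)
      qed
      show "AE y in sph. (\<lambda>j. f y * g j y) \<longlonglongrightarrow> f y * indicator C y"
      proof (rule AE_I2)
        fix y
        have "(\<lambda>j. g j y) \<longlonglongrightarrow> indicator C y"
        proof (cases "y \<in> C")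
          case True
          then show ?thesis by (simp add: g_def)
        next
          case False
          then have pos: "0 < infdist y C"
            using in_closed_iff_infdist_zero[OF C \<open>C \<noteq> {}\<close>, of y] infdist_nonneg[of y C] by linarith
          obtain j0 :: nat where "1 < real j0 * infdist y C" using reals_Archimedean3[OF pos] by blast
          then have "g j y = 0" if "j0 \<le> j" for j
          proof -
            have "real j0 * infdist y C \<le> real j * infdist y C" using that pos by (intro mult_right_mono) auto
            with \<open>1 < real j0 * infdist y C\<close> show ?thesis by (simp add: g_def)
          qed
          then have "eventually (\<lambda>j. g j y = 0) sequentially" by (auto simp: eventually_sequentially)
          then show ?thesis using False by (simp add: tendsto_eventually)
        qed
        then show "(\<lambda>j. f y * g j y) \<longlonglongrightarrow> f y * indicator C y" by (intro tendsto_intros)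
      qed
    qed
    then show ?thesis by (simp add: cont_zero[OF g] LIMSEQ_const_iff)
  qed simp
  have borel_zero: "(\<integral>y. f y * indicator A y \<partial>sph) = 0" if "A \<in> sets borel" for A
  proof -
    have "Int_stable (Collect closed :: 'a set set)" "Collect closed \<subseteq> Pow (UNIV :: 'a set)"
      "A \<in> sigma_sets UNIV (Collect closed)"
      using that by (auto simp: Int_stable_def borel_eq_closed)
    then show ?thesis
    proof (induction rule: sigma_sets_induct_disjoint)
      case (basic A) then show ?case using closed_zero by simp
    next
      case (compl A)
      then have A: "A \<in> sets borel" by (simp add: borel_eq_closed)
      have "(\<integral>y. f y * indicator (UNIV - A) y \<partial>sph) = (\<integral>y. f y - f y * indicator A y \<partial>sph)"
        by (intro Bochner_Integration.integral_cong refl) (auto simp: indicator_def)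
      also have "\<dots> = (\<integral>y. f y \<partial>sph)" using f int_ind[OF A] compl by simp
      also have "\<dots> = 0" using cont_zero[of "\<lambda>_. 1"] by simp
      finally show ?case .
    next
      case (union A)
      then have A: "\<And>i. A i \<in> sets borel" by (auto simp: borel_eq_closed)
      have "(\<lambda>m. \<integral>y. f y * indicator (\<Union>i<m. A i) y \<partial>sph) \<longlonglongrightarrow> (\<integral>y. f y * indicator (\<Union>i. A i) y \<partial>sph)"
      proof (rule integral_dominated_convergence)
        show "(\<lambda>y. f y * indicator (\<Union>i. A i) y) \<in> borel_measurable sph"
          using A by (intro borel_measurable_times ind_meas) auto
        show "(\<lambda>y. f y * indicator (\<Union>i<m. A i) y) \<in> borel_measurable sph" for m
          using A by (intro borel_measurable_times ind_meas) auto
        show "integrable sph (\<lambda>y. \<bar>f y\<bar>)" using f by simp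
        show "AE y in sph. norm (f y * indicator (\<Union>i<m. A i) y) \<le> \<bar>f y\<bar>" for m
          by (rule AE_I2) (simp add: indicator_def)
        show "AE y in sph. (\<lambda>m. f y * indicator (\<Union>i<m. A i) y) \<longlonglongrightarrow> f y * indicator (\<Union>i. A i) y"
          by (intro AE_I2 tendsto_mult tendsto_const LIMSEQ_indicator_UN)
      qed
      moreover have "(\<integral>y. f y * indicator (\<Union>i<m. A i) y \<partial>sph) = 0" for m
      proof -
        have "(\<integral>y. f y * indicator (\<Union>i<m. A i) y \<partial>sph) = (\<integral>y. (\<Sum>i<m. f y * indicator (A i) y) \<partial>sph)"
        proof (intro Bochner_Integration.integral_cong refl)
          fix y
          have "disjoint_family_on A {..<m}" using union(1) by (auto simp: disjoint_family_on_def)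
          then have "indicator (\<Union>i<m. A i) y = (\<Sum>i<m. indicator (A i) y :: real)"
            by (intro indicator_UN_disjoint) auto
          then show "f y * indicator (\<Union>i<m. A i) y = (\<Sum>i<m. f y * indicator (A i) y)"
            by (simp add: sum_distrib_left)
        qed
        also have "\<dots> = (\<Sum>i<m. \<integral>y. f y * indicator (A i) y \<partial>sph)"
          using int_ind[OF A] by (intro Bochner_Integration.integral_sum) auto
        finally show ?thesis using union(3) by simp
      qed
      ultimately show ?case by (simp add: LIMSEQ_const_iff)
    qed simp
  qed
  show ?thesis
  proof (rule density_unique_real[OF f])
    fix A assume "A \<in> sets (sph :: 'a measure)"
    then have "A \<in> sets borel" using sets_restrict_space_iff[of "sphere (0::'a) 1" borel A] by auto
    from borel_zero[OF this] show "(\<integral>x\<in>A. f x \<partial>sph) = (\<integral>x\<in>A. 0 \<partial>sph)"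
      by (simp add: set_lebesgue_integral_def mult.commute)
  qed simp
qed

text \<open>
  By Stone-Weierstrass the exponential sums are dense in the continuous functions.
\<close>

lemma sphere_annihilator_zero:
  fixes f :: "'a::euclidean_space \<Rightarrow> real"
  assumes f: "integrable sph f" and zero: "\<And>u. (\<integral>y. f y * exp (u \<bullet> y) \<partial>sph) = 0"
  shows "AE x in sph. f x = 0"
proof -
  have [measurable]: "f \<in> borel_measurable sph" using f by auto
  have cont_meas: "g \<in> borel_measurable sph" if "continuous_on UNIV g" for g :: "'a \<Rightarrow> real"
    by (rule measurable_compose[OF measurable_ident_sphere borel_measurable_continuous_onI[OF that]])
  have int_cont: "integrable sph (\<lambda>y. f y * g y)" if g: "continuous_on UNIV g" for g :: "'a \<Rightarrow> real"
  proof -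
    have "bounded_on_sphere g"
      by (intro bounded_on_sphere_continuous continuous_on_subset[OF g]) simp
    then obtain L where L: "\<And>y. norm y = 1 \<Longrightarrow> \<bar>g y\<bar> \<le> L"
      unfolding bounded_on_sphere_def by blast
    note [measurable] = cont_meas[OF g]
    show ?thesis
    proof (rule Bochner_Integration.integrable_bound)
      show "integrable sph (\<lambda>y. L * f y)" using f by simp
      show "AE y in sph. norm (f y * g y) \<le> norm (L * f y)"
      proof (rule AE_I2)
        fix y :: 'a assume "y \<in> space sph"
        then have "\<bar>f y\<bar> * \<bar>g y\<bar> \<le> \<bar>f y\<bar> * \<bar>L\<bar>" using L[of y] by (intro mult_left_mono) auto
        then show "norm (f y * g y) \<le> norm (L * f y)" by (simp add: abs_mult mult_ac)
      qed
    qed measurable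
  qed
  have exp_zero: "(\<integral>y. f y * h y \<partial>sph) = 0" if "exponential_sum h" for h
    using that
  proof induction
    case (exponential c u)
    have "(\<integral>y. f y * (c * exp (u \<bullet> y)) \<partial>sph) = c * (\<integral>y. f y * exp (u \<bullet> y) \<partial>sph)"
      by (simp add: mult.left_commute[of _ c])
    then show ?case using zero by simp
  next
    case (add g h)
    then show ?case
      using int_cont[OF exponential_sum_continuous[OF add(1)]] int_cont[OF exponential_sum_continuous[OF add(2)]]
      by (simp add: distrib_left)
  qed
  show ?thesis
  proof (rule AE_zero_if_orthogonal_to_continuous[OF f])
    fix g :: "'a \<Rightarrow> real" assume g: "continuous_on UNIV g"
    show "(\<integral>y. f y * g y \<partial>sph) = 0"
    proof -
      have "\<bar>\<integral>y. f y * g y \<partial>sph\<bar> \<le> e * (\<integral>y. \<bar>f y\<bar> \<partial>sph)" if "0 < e" for e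
      proof -
        obtain h where h: "exponential_sum h" "\<And>y. norm y = 1 \<Longrightarrow> \<bar>g y - h y\<bar> < e"
          using exponential_sum_dense[OF continuous_on_subset[OF g] \<open>0 < e\<close>] by auto
        have ih: "integrable sph (\<lambda>y. f y * h y)" by (rule int_cont[OF exponential_sum_continuous[OF h(1)]])
        have eq: "(\<integral>y. f y * g y \<partial>sph) = (\<integral>y. f y * g y - f y * h y \<partial>sph)"
          using int_cont[OF g] ih exp_zero[OF h(1)] by simp
        have "\<bar>\<integral>y. f y * g y - f y * h y \<partial>sph\<bar> \<le> (\<integral>y. \<bar>f y * g y - f y * h y\<bar> \<partial>sph)"
          by (rule integral_abs_bound)
        also have "\<dots> \<le> (\<integral>y. e * \<bar>f y\<bar> \<partial>sph)"
        proof (rule integral_mono)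
          show "integrable sph (\<lambda>y. \<bar>f y * g y - f y * h y\<bar>)" using int_cont[OF g] ih by simp
          show "integrable sph (\<lambda>y. e * \<bar>f y\<bar>)" using f by simp
          fix y :: 'a assume "y \<in> space sph"
          then have "\<bar>f y\<bar> * \<bar>g y - h y\<bar> \<le> \<bar>f y\<bar> * e" using h(2)[of y] by (intro mult_left_mono) auto
          then show "\<bar>f y * g y - f y * h y\<bar> \<le> e * \<bar>f y\<bar>"
            by (simp add: abs_mult[symmetric] right_diff_distrib mult.commute)
        qed
        finally show ?thesis using eq by simp
      qed
      note bound = this
      have "\<bar>\<integral>y. f y * g y \<partial>sph\<bar> \<le> 0"
      proof (rule field_le_epsilon)
        fix e :: real assume e: "0 < e"
        have I: "0 < 1 + (\<integral>y. \<bar>f y\<bar> \<partial>sph)" by (simp add: add_pos_nonneg)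
        have "\<bar>\<integral>y. f y * g y \<partial>sph\<bar> \<le> e / (1 + (\<integral>y. \<bar>f y\<bar> \<partial>sph)) * (\<integral>y. \<bar>f y\<bar> \<partial>sph)"
          using e I by (intro bound) simp
        also have "\<dots> \<le> e"
          using e I by (simp add: pos_divide_le_eq)
        finally show "\<bar>\<integral>y. f y * g y \<partial>sph\<bar> \<le> 0 + e" by simp
      qed
      then show ?thesis by simp
    qed
  qed
qed

lemma zonal_kernel_exp: "zonal_kernel (exp \<bar>\<tau>\<bar>) (\<lambda>t. exp (\<tau> * t))"
  unfolding zonal_kernel_def
proof (intro conjI allI impI)
  fix t :: real assume "\<bar>t\<bar> \<le> 1"
  then have "\<bar>\<tau>\<bar> * \<bar>t\<bar> \<le> \<bar>\<tau>\<bar> * 1" by (intro mult_left_mono) auto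
  then have "\<tau> * t \<le> \<bar>\<tau>\<bar>" using abs_ge_self[of "\<tau> * t"] by (simp add: abs_mult)
  then show "\<bar>exp (\<tau> * t)\<bar> \<le> exp \<bar>\<tau>\<bar>" by simp
qed measurable

text \<open>
  As reflections act transitively, the hypothesis says that \<open>\<integral>y. f y * exp (u \<bullet> y)\<close> depends on the norm of \<open>u\<close> only. Averaged over
  all \<open>u\<close> of a given norm, the transform of a function of mean zero vanishes; so the transform of \<open>f\<close> minus its mean is zero.
\<close>

lemma constant_if_reflection_invariant:
  fixes f :: "'a::euclidean_space \<Rightarrow> real"
  assumes n: "2 \<le> DIM('a)" and f: "integrable sph f"
    and inv: "\<And>\<tau> v x. \<lbrakk>norm v = 1; norm x = 1\<rbrakk> \<Longrightarrow>
      zonal_conv (\<lambda>t. exp (\<tau> * t)) f (reflection v x) = zonal_conv (\<lambda>t. exp (\<tau> * t)) f x"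
  shows "\<exists>c. AE x in sph. f x = c"
proof -
  define S where "S = measure (sph :: 'a measure) (sphere 0 1)"
  have S: "0 < S"
    using n by (simp add: S_def sphere_area_eq_measure sphere_area_def)
  define c where "c = (\<integral>y. f y \<partial>sph) / S"
  define g where "g = (\<lambda>y. f y - c)"
  have g: "integrable sph g" using f by (simp add: g_def)
  have g0: "(\<integral>y. g y \<partial>sph) = 0" using f S by (simp add: g_def c_def S_def)
  obtain e :: 'a where e: "norm e = 1" using vector_choose_size[of 1] by auto
  have conv: "zonal_conv (\<lambda>t. exp (\<tau> * t)) g x = 0" if x: "norm x = 1" for \<tau> x
  proof -
    let ?\<phi> = "\<lambda>t. exp (\<tau> * t)"
    note \<phi> = zonal_kernel_exp[of \<tau>]
    define m where "m = (\<integral>y. ?\<phi> (e \<bullet> y) \<partial>sph)"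
    have m: "zonal_mass TYPE('a) ?\<phi> m"
      unfolding m_def zonal_mass_def using zonal_integral_indep[OF zonal_kernelD(1)[OF \<phi>] _ e] by auto
    have cg: "zonal_conv ?\<phi> g x = zonal_conv ?\<phi> f x - c * m" if x: "norm x = 1" for x
    proof -
      have "zonal_conv ?\<phi> (\<lambda>_. c) x = c * m"
        using zonal_massD[OF m x] by (simp add: zonal_conv_def)
      then show ?thesis
        using zonal_conv_diff[OF \<phi> f _ x, of "\<lambda>_. c"] by (simp add: g_def)
    qed
    have same: "zonal_conv ?\<phi> g y = zonal_conv ?\<phi> g x" if y: "norm y = 1" for y
    proof (cases "x = y")
      case False
      then obtain v where "norm v = 1" "reflection v x = y"
        using x y by (auto elim: reflection_exchanges[rotated])
      then show ?thesis using inv[of v x \<tau>] x cg[OF x] cg[OF y] by simp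
    qed simp
    have "S * zonal_conv ?\<phi> g x = (\<integral>y. zonal_conv ?\<phi> g x \<partial>(sph :: 'a measure))" by (simp add: S_def)
    also have "\<dots> = (\<integral>y. zonal_conv ?\<phi> g y \<partial>sph)"
      by (intro Bochner_Integration.integral_cong refl) (simp add: same)
    also have "\<dots> = 0" using integral_zonal_conv[OF \<phi> m g] g0 by simp
    finally show ?thesis using S by simp
  qed
  have "AE x in sph. g x = 0"
  proof (rule sphere_annihilator_zero[OF g])
    fix u :: 'a
    show "(\<integral>y. g y * exp (u \<bullet> y) \<partial>sph) = 0"
    proof (cases "u = 0")
      case False
      then have "zonal_conv (\<lambda>t. exp (norm u * t)) g (u /\<^sub>R norm u) = 0" by (intro conv) simp
      then show ?thesis using False by (simp add: zonal_conv_def mult.assoc[symmetric])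
    qed (simp add: g0)
  qed
  then show ?thesis unfolding g_def by (intro exI[of _ c]) simp
qed

section \<open>Functions with small approximation error\<close>

text \<open>
  By the gap, the \<open>L\<^sup>2\<close> norm of the odd part \<open>D\<close> of a smoothed \<open>f\<close> is at most a constant times \<open>k ^ (2 * r)\<close> times the
  \<open>L\<^sup>1\<close> norm of \<open>residual k s r f\<close>, for all large \<open>k\<close>. By hypothesis this product tends to zero.
\<close>

lemma constant_if_residual_small:
  fixes f :: "'a::euclidean_space \<Rightarrow> real"
  assumes n: "3 \<le> DIM('a)" and s: "1 \<le> s" and f: "integrable sph f"
    and small: "(\<lambda>k. \<integral>x. \<bar>residual k s r f x\<bar> \<partial>sph) \<in> o(\<lambda>k. 1 / real k ^ (2 * r))"
  shows "\<exists>c. AE x in sph. f x = c"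
proof (rule constant_if_reflection_invariant[OF _ f])
  show "2 \<le> DIM('a)" using n by simp
  fix \<tau> :: real and v x :: 'a assume v: "norm v = 1" and x: "norm x = 1"
  let ?\<phi> = "\<lambda>t. exp (\<tau> * t)"
  define F where "F = zonal_conv ?\<phi> f"
  define D where "D = (\<lambda>x. F x - F (reflection v x))"
  define N where "N = (\<integral>x. (D x)\<^sup>2 \<partial>sph)"
  define C where "C = measure sph (sphere (0::'a) 1) * (2 * exp \<bar>\<tau>\<bar>)\<^sup>2"
  obtain c K where cK: "0 < c" "1 \<le> K" and gap: "\<And>k v (H :: 'a \<Rightarrow> real). \<lbrakk>K \<le> k; norm v = 1; bounded_on_sphere H;
        \<And>x. norm x = 1 \<Longrightarrow> H (reflection v x) = - H x\<rbrakk> \<Longrightarrow>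
      (c / (real k)\<^sup>2)\<^sup>2 * (\<integral>x. (H x)\<^sup>2 \<partial>sph) \<le>
        (\<integral>x. (H x - zonal_conv (jackson_zonal DIM('a) k s) H x)\<^sup>2 \<partial>sph)"
    using jackson_gap[OF n s] by blast
  define a where "a = (\<lambda>k. \<integral>x. \<bar>residual k s r f x\<bar> \<partial>(sph :: 'a measure))"
  have lim: "(\<lambda>k. a k / (1 / real k ^ (2 * r))) \<longlonglongrightarrow> 0"
    using small unfolding a_def by (rule smalloD_tendsto)
  \<comment> \<open>The factors \<open>k ^ (2 * r)\<close> from the gap and from the order of the residual cancel.\<close>
  have "(\<lambda>k. C / c ^ (2 * r) * (a k / (1 / real k ^ (2 * r)))\<^sup>2) \<longlonglongrightarrow> C / c ^ (2 * r) * 0\<^sup>2"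
    by (intro tendsto_intros lim)
  moreover have "eventually (\<lambda>k. N \<le> C / c ^ (2 * r) * (a k / (1 / real k ^ (2 * r)))\<^sup>2) sequentially"
  proof (rule eventually_sequentiallyI[of K])
    fix k assume k: "K \<le> k"
    then have k1: "1 \<le> k" using cK by simp
    have "(c / (real k)\<^sup>2) ^ (2 * r) * N \<le> C * (a k)\<^sup>2"
      unfolding N_def C_def a_def D_def F_def
      by (rule residual_odd_bound[OF n zonal_kernel_exp f v k1 gap[OF k v]])
    moreover have "(c / (real k)\<^sup>2) ^ (2 * r) = c ^ (2 * r) / (real k ^ (2 * r))\<^sup>2"
      by (simp add: power_divide power_mult[symmetric] mult_ac)
    ultimately show "N \<le> C / c ^ (2 * r) * (a k / (1 / real k ^ (2 * r)))\<^sup>2"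
      using cK k1 by (simp add: field_simps power_mult_distrib)
  qed
  ultimately have "N \<le> C / c ^ (2 * r) * 0\<^sup>2"
    by (intro tendsto_lowerbound) auto
  then have N: "N \<le> 0" by simp
  have cont: "continuous_on (sphere 0 1) F"
    unfolding F_def by (intro zonal_conv_continuous[OF zonal_kernel_exp _ f] continuous_intros)
  have R: "continuous_on A (reflection v)" for A
    unfolding reflection_def[abs_def] by (intro continuous_intros)
  have contD: "continuous_on (sphere 0 1) D"
    unfolding D_def
    by (intro continuous_intros cont continuous_on_compose2[OF cont R]) (auto simp: norm_reflection[OF v])
  have "bounded_on_sphere D" by (rule bounded_on_sphere_continuous[OF contD])
  then have "integrable sph (\<lambda>x. (D x)\<^sup>2)"
    by (intro bounded_on_sphere_integrable bounded_on_sphere_power2)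
  moreover have "N = 0" using N by (simp add: N_def antisym)
  ultimately have "AE x in sph. (D x)\<^sup>2 = 0"
    using integral_nonneg_eq_0_iff_AE[of sph "\<lambda>x. (D x)\<^sup>2"] by (simp add: N_def)
  then have "AE x in sph. D x = 0" by simp
  from continuous_AE_zero_on_sphere[OF contD this x]
  show "zonal_conv ?\<phi> f (reflection v x) = zonal_conv ?\<phi> f x" by (simp add: D_def F_def)
qed

section \<open>Lebesgue spaces on the sphere\<close>

text \<open>
  A substitute for Hoelder's inequality: integrated, and with \<open>c\<close> the \<open>L\<^sup>q\<close> norm, it bounds the
  \<open>L\<^sup>1\<close> norm by the \<open>L\<^sup>q\<close> norm on a finite measure space.
\<close>

lemma abs_le_powr_split:
  fixes a c q :: real
  assumes "0 < c" "1 \<le> q"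
  shows "\<bar>a\<bar> \<le> c + \<bar>a\<bar> powr q * c powr (1 - q)"
proof (cases "\<bar>a\<bar> \<le> c")
  case True
  then show ?thesis by (smt (verit) mult_nonneg_nonneg powr_ge_zero)
next
  case False
  with assms have a: "0 < \<bar>a\<bar>" by linarith
  have "\<bar>a\<bar> powr (1 - q) \<le> c powr (1 - q)"
    using False assms by (intro powr_mono2') auto
  then have "\<bar>a\<bar> powr q * \<bar>a\<bar> powr (1 - q) \<le> \<bar>a\<bar> powr q * c powr (1 - q)"
    by (rule mult_left_mono) simp
  moreover have "\<bar>a\<bar> powr q * \<bar>a\<bar> powr (1 - q) = \<bar>a\<bar>"
    using a by (simp add: powr_add[symmetric])
  ultimately show ?thesis using assms by linarith
qed

lemma Lp_sphere_integrable:
  fixes f :: "'a::euclidean_space \<Rightarrow> real"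
  assumes f: "f \<in> Lp sph p" and p: "1 \<le> p"
  shows "integrable sph f"
    and "(\<integral>x. \<bar>f x\<bar> \<partial>sph) \<le> (measure sph (sphere (0::'a) 1) + 1) * Lp_norm sph p f"
proof -
  let ?S = "measure sph (sphere (0::'a) 1)"
  have [measurable]: "f \<in> borel_measurable sph" using f by (simp add: Lp_def)
  have "integrable sph f \<and> (\<integral>x. \<bar>f x\<bar> \<partial>sph) \<le> (?S + 1) * Lp_norm sph p f"
  proof (cases "p = \<infinity>")
    case True
    define N where "N = Lp_norm sph p f"
    have N0: "0 \<le> N" using True by (simp add: N_def Lp_norm_def)
    have "esssup sph (\<lambda>x. ennreal \<bar>f x\<bar>) < \<infinity>" using f True by (simp add: Lp_def)
    then have eq: "esssup sph (\<lambda>x. ennreal \<bar>f x\<bar>) = ennreal N"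
      using True by (simp add: N_def Lp_norm_def ennreal_enn2real_if)
    have AE: "AE x in sph. \<bar>f x\<bar> \<le> N"
      using esssup_AE[where f = "\<lambda>x. ennreal \<bar>f x\<bar>" and M = sph] N0 unfolding eq by simp
    have i: "integrable sph f"
      by (rule sph.integrable_const_bound[where B = N]) (use AE in auto)
    have "(\<integral>x. \<bar>f x\<bar> \<partial>sph) \<le> (\<integral>x. N \<partial>(sph :: 'a measure))"
      using i AE by (intro integral_mono_AE) auto
    also have "\<dots> \<le> (?S + 1) * N" using N0 by (simp add: algebra_simps)
    finally show ?thesis using i by (simp add: N_def)
  next
    case False
    define q where "q = enn2real p"
    have q: "1 \<le> q"
      using p False enn2real_mono[of 1 p] by (simp add: q_def less_top)
    have iq: "integrable sph (\<lambda>x. \<bar>f x\<bar> powr q)" using f False by (simp add: Lp_def q_def)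
    define I where "I = (\<integral>x. \<bar>f x\<bar> powr q \<partial>sph)"
    have I: "0 \<le> I" by (simp add: I_def)
    have N: "Lp_norm sph p f = I powr (1 / q)" using False by (simp add: Lp_norm_def I_def q_def)
    have i: "integrable sph f"
    proof (rule Bochner_Integration.integrable_bound)
      show "integrable sph (\<lambda>x. 1 + \<bar>f x\<bar> powr q)" using iq by simp
      show "AE x in sph. norm (f x) \<le> norm (1 + \<bar>f x\<bar> powr q)"
      proof (rule AE_I2)
        fix x show "norm (f x) \<le> norm (1 + \<bar>f x\<bar> powr q)"
          using abs_le_powr_split[of 1 q "f x"] q by simp
      qed
    qed simp
    have bound: "(\<integral>x. \<bar>f x\<bar> \<partial>sph) \<le> c * ?S + I * c powr (1 - q)" if "0 < c" for c
    proof -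
      have "(\<integral>x. \<bar>f x\<bar> \<partial>sph) \<le> (\<integral>x. c + \<bar>f x\<bar> powr q * c powr (1 - q) \<partial>sph)"
        using i iq abs_le_powr_split[OF that q] by (intro integral_mono) auto
      also have "\<dots> = c * ?S + I * c powr (1 - q)" using iq by (simp add: I_def)
      finally show ?thesis .
    qed
    show ?thesis
    proof (cases "I = 0")
      case True
      then have "AE x in sph. \<bar>f x\<bar> powr q = 0"
        using integral_nonneg_eq_0_iff_AE[OF iq] by (simp add: I_def)
      then have "AE x in sph. \<bar>f x\<bar> = 0" by simp
      then have "(\<integral>x. \<bar>f x\<bar> \<partial>sph) = (\<integral>x. 0 \<partial>(sph :: 'a measure))" by (intro integral_cong_AE) auto
      then show ?thesis using i by (simp add: N)
    next
      case False
      with I have "0 < I" by simp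
      define c where "c = I powr (1 / q)"
      have c: "0 < c" using \<open>0 < I\<close> by (simp add: c_def)
      have "I = c powr q" using q \<open>0 < I\<close> by (simp add: c_def powr_powr)
      then have "I * c powr (1 - q) = c" using c by (simp add: powr_add[symmetric])
      then show ?thesis using bound[OF c] i by (simp add: N c_def[symmetric] algebra_simps)
    qed
  qed
  then show "integrable sph f" "(\<integral>x. \<bar>f x\<bar> \<partial>sph) \<le> (?S + 1) * Lp_norm sph p f" by auto
qed

text \<open>
  Powers of the approximation error differ from \<open>f\<close> by a bounded function, so they stay in \<open>L\<^sup>p\<close>.
\<close>

lemma Lp_sphere_diff_bounded:
  fixes f g :: "'a::euclidean_space \<Rightarrow> real"
  assumes f: "f \<in> Lp sph p" and p: "1 \<le> p" and g: "bounded_on_sphere g"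
  shows "(\<lambda>x. f x - g x) \<in> Lp sph p"
proof -
  have [measurable]: "f \<in> borel_measurable sph" "g \<in> borel_measurable sph"
    using f bounded_on_sphere_measurable[OF g] by (auto simp: Lp_def)
  obtain L0 where L0: "\<And>x. norm x = 1 \<Longrightarrow> \<bar>g x\<bar> \<le> L0" using g by (auto simp: bounded_on_sphere_def)
  define L where "L = max 0 L0"
  have L: "0 \<le> L" "\<And>x. norm x = 1 \<Longrightarrow> \<bar>g x\<bar> \<le> L" using L0 by (auto simp: L_def intro: order_trans max.cobounded2)
  show ?thesis
  proof (cases "p = \<infinity>")
    case True
    let ?e = "esssup sph (\<lambda>x. ennreal \<bar>f x\<bar>)"
    have "esssup sph (\<lambda>x. ennreal \<bar>f x - g x\<bar>) \<le> ?e + ennreal L"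
    proof (rule esssup_I)
      have "AE x in sph. ennreal \<bar>f x\<bar> \<le> ?e" by (rule esssup_AE)
      with AE_space show "AE x in sph. ennreal \<bar>f x - g x\<bar> \<le> ?e + ennreal L"
      proof eventually_elim
        case (elim x)
        have "ennreal \<bar>f x - g x\<bar> \<le> ennreal (\<bar>f x\<bar> + L)"
          using L(2)[of x] elim(1) by (intro ennreal_leI) simp
        also have "\<dots> = ennreal \<bar>f x\<bar> + ennreal L" using L by (simp add: ennreal_plus)
        also have "\<dots> \<le> ?e + ennreal L" using elim(2) by (rule add_right_mono)
        finally show ?case .
      qed
    qed measurable
    also have "\<dots> < \<infinity>" using f True by (simp add: Lp_def)
    finally show ?thesis using True by (simp add: Lp_def)
  next
    case False
    define q where "q = enn2real p"
    have q: "1 \<le> q"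
      using p False enn2real_mono[of 1 p] by (simp add: q_def less_top)
    have iq: "integrable sph (\<lambda>x. \<bar>f x\<bar> powr q)" using f False by (simp add: Lp_def q_def)
    have "integrable sph (\<lambda>x. \<bar>f x - g x\<bar> powr q)"
    proof (rule Bochner_Integration.integrable_bound)
      show "integrable sph (\<lambda>x. 2 powr q * (\<bar>f x\<bar> powr q + L powr q))" using iq by simp
      show "AE x in sph. norm (\<bar>f x - g x\<bar> powr q) \<le> norm (2 powr q * (\<bar>f x\<bar> powr q + L powr q))"
      proof (rule AE_I2)
        fix x :: 'a assume "x \<in> space sph"
        then have "\<bar>f x - g x\<bar> \<le> 2 * max \<bar>f x\<bar> L" using L(2)[of x] by (simp add: max_def) linarith
        then have "\<bar>f x - g x\<bar> powr q \<le> (2 * max \<bar>f x\<bar> L) powr q" using q by (intro powr_mono2) auto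
        also have "\<dots> = 2 powr q * max \<bar>f x\<bar> L powr q" by (rule powr_mult) 
        also have "\<dots> \<le> 2 powr q * (\<bar>f x\<bar> powr q + L powr q)" by (intro mult_left_mono) (auto simp: max_def)
        finally show "norm (\<bar>f x - g x\<bar> powr q) \<le> norm (2 powr q * (\<bar>f x\<bar> powr q + L powr q))" by simp
      qed
    qed measurable
    then show ?thesis using False by (simp add: Lp_def q_def)
  qed
qed

lemma Lp_sphere_bounded:
  fixes g :: "'a::euclidean_space \<Rightarrow> real"
  assumes p: "1 \<le> p" and g: "bounded_on_sphere g"
  shows "g \<in> Lp sph p"
proof -
  have "esssup sph (\<lambda>x::'a. 0 :: ennreal) \<le> 0" by (rule esssup_I) auto
  then have "(\<lambda>x::'a. 0) \<in> Lp sph p" by (simp add: Lp_def)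
  moreover have "bounded_on_sphere (\<lambda>x. 0 - g x)"
    by (intro bounded_on_sphere_diff bounded_on_sphere_const g)
  ultimately have "(\<lambda>x. 0 - (0 - g x)) \<in> Lp sph p" by (rule Lp_sphere_diff_bounded[OF _ p])
  then show ?thesis by simp
qed

section \<open>Saturation\<close>

lemma boolean_sum_jackson: "boolean_sum r (jackson k s) f x = f x - residual k s r f x"
  by (simp add: boolean_sum_def residual_def)

lemma boolean_sum_jackson_operator:
  assumes n: "3 \<le> DIM('a::euclidean_space)" and k: "1 \<le> k" and p: "1 \<le> p"
  shows "operator_on_Lp (sph :: 'a measure) p (boolean_sum r (jackson k s))"
  unfolding operator_on_Lp_def
proof (intro conjI ballI impI)
  fix f :: "'a \<Rightarrow> real" assume f: "f \<in> Lp sph p"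
  show "boolean_sum r (jackson k s) f \<in> Lp sph p"
    using bounded_on_sphere_diff_residual[OF n k Lp_sphere_integrable(1)[OF f p]]
    unfolding boolean_sum_jackson[abs_def] by (rule Lp_sphere_bounded[OF p])
  fix g :: "'a \<Rightarrow> real" assume g: "g \<in> Lp sph p" and eq: "AE x in sph. f x = g x"
  have "AE x in sph. residual k s r f x = residual k s r g x"
    by (rule residual_cong_AE[OF n k Lp_sphere_integrable(1)[OF f p] Lp_sphere_integrable(1)[OF g p] eq])
  with eq show "AE x in sph. boolean_sum r (jackson k s) f x = boolean_sum r (jackson k s) g x"
    unfolding boolean_sum_jackson by eventually_elim simp
qed

lemma boolean_sum_jackson_const:
  fixes f :: "'a::euclidean_space \<Rightarrow> real"
  assumes n: "3 \<le> DIM('a)" and k: "1 \<le> k" and r: "1 \<le> r" and f: "integrable sph f"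
    and c: "AE x in sph. f x = c"
  shows "AE x in sph. boolean_sum r (jackson k s) f x = f x"
proof -
  obtain j where j: "r = Suc j" using r by (cases r) auto
  have "AE x in sph. residual k s r f x = residual k s r (\<lambda>_. c) x"
    by (rule residual_cong_AE[OF n k f _ c]) simp
  with AE_space show ?thesis
    by eventually_elim (simp add: boolean_sum_jackson residual_const[OF n k] j)
qed

lemma residual_small_if_approximation_small:
  fixes f :: "'a::euclidean_space \<Rightarrow> real"
  assumes n: "3 \<le> DIM('a)" and p: "1 \<le> p" and f: "f \<in> Lp sph p"
    and small: "(\<lambda>k. Lp_norm sph p (\<lambda>x. boolean_sum r (jackson k s) f x - f x)) \<in> o(\<phi>)"
  shows "(\<lambda>k. \<integral>x. \<bar>residual k s r f x\<bar> \<partial>sph) \<in> o(\<phi>)"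
proof (rule landau_o.big_small_trans[OF _ small])
  let ?S = "measure sph (sphere (0::'a) 1)"
  note fi = Lp_sphere_integrable(1)[OF f p]
  show "(\<lambda>k. \<integral>x. \<bar>residual k s r f x\<bar> \<partial>sph) \<in> O(\<lambda>k. Lp_norm sph p (\<lambda>x. boolean_sum r (jackson k s) f x - f x))"
  proof (rule bigoI[where c = "?S + 1"], rule eventually_sequentiallyI[of 1])
    fix k :: nat assume k: "1 \<le> k"
    let ?g = "\<lambda>x. boolean_sum r (jackson k s) f x - f x"
    have "?g \<in> Lp sph p"
    proof -
      have "(\<lambda>x. f x - (f x - residual k s r f x)) \<in> Lp sph p"
        by (rule Lp_sphere_diff_bounded[OF f p bounded_on_sphere_diff_residual[OF n k fi]])
      then show ?thesis by (auto simp: Lp_def boolean_sum_jackson split: if_splits)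
    qed
    from Lp_sphere_integrable(2)[OF this p]
    have "(\<integral>x. \<bar>residual k s r f x\<bar> \<partial>sph) \<le> (?S + 1) * Lp_norm sph p ?g"
      by (simp add: boolean_sum_jackson)
    moreover have "0 \<le> Lp_norm sph p ?g" by (simp add: Lp_norm_def)
    ultimately show "norm (\<integral>x. \<bar>residual k s r f x\<bar> \<partial>sph) \<le> (?S + 1) * norm (Lp_norm sph p ?g)" by simp
  qed
qed

text \<open>
  The saturation class is the set of all functions whose approximation error is of the order \<open>\<phi>\<close>; the content is that a smaller order
  forces a constant. An invariant function has error zero, so it is a case of the same statement.
\<close>

theorem jackson_saturation:
  fixes r s :: nat and p :: ennreal
  assumes n: "3 \<le> DIM('a::euclidean_space)" and r: "1 \<le> r" and s: "1 \<le> s" and p: "1 \<le> p"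
  shows "saturated (sph :: 'a measure) p (\<lambda>k. boolean_sum r (jackson k s)) (\<lambda>k. 1 / real k ^ (2 * r))"
    and "invariant_class (sph :: 'a measure) p (\<lambda>k. boolean_sum r (jackson k s)) =
      {f \<in> Lp sph p. \<exists>c. AE x in sph. f x = c}"
proof -
  let ?T = "\<lambda>k. boolean_sum r (jackson k s) :: ('a \<Rightarrow> real) \<Rightarrow> 'a \<Rightarrow> real"
  let ?\<phi> = "\<lambda>k. 1 / real k ^ (2 * r)"
  let ?E = "\<lambda>f k. Lp_norm sph p (\<lambda>x. ?T k f x - f x)"
  have inv: "\<forall>k\<ge>1. AE x in sph. ?T k f x = f x" if "f \<in> Lp sph p" "\<exists>c. AE x in sph. f x = c" for f :: "'a \<Rightarrow> real"
    using that boolean_sum_jackson_const[OF n _ r Lp_sphere_integrable(1)[OF that(1) p]] by blast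
  have const: "\<exists>c. AE x in sph. f x = c" if f: "f \<in> Lp sph p" and small: "?E f \<in> o(?\<phi>)" for f :: "'a \<Rightarrow> real"
    using residual_small_if_approximation_small[OF n p f small]
    by (rule constant_if_residual_small[OF n s Lp_sphere_integrable(1)[OF f p]])
  have "?\<phi> \<longlonglongrightarrow> 0"
  proof (rule tendsto_divide_0[OF tendsto_const])
    have "filterlim (\<lambda>k. real k ^ (2 * r)) at_top sequentially"
      using r by (intro filterlim_pow_at_top filterlim_real_sequentially) simp
    then show "filterlim (\<lambda>k. real k ^ (2 * r)) at_infinity sequentially"
      by (rule filterlim_at_top_imp_at_infinity)
  qed
  moreover have "antimono_on {1..} ?\<phi>"
    by (rule monotone_onI) (auto intro!: divide_left_mono power_mono)
  ultimately show "saturated sph p ?T ?\<phi>"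
    unfolding saturated_def using boolean_sum_jackson_operator[OF n _ p] const inv
    by (intro conjI exI[of _ "{f \<in> Lp sph p. ?E f \<in> O(?\<phi>)}"]) auto
  show "invariant_class sph p ?T = {f \<in> Lp sph p. \<exists>c. AE x in sph. f x = c}"
  proof (intro equalityI subsetI)
    fix f :: "'a \<Rightarrow> real" assume "f \<in> invariant_class sph p ?T"
    then have f: "f \<in> Lp sph p" and eq: "\<And>k. 1 \<le> k \<Longrightarrow> AE x in sph. ?T k f x = f x"
      by (auto simp: invariant_class_def)
    have "(\<integral>x. \<bar>residual k s r f x\<bar> \<partial>sph) = 0" if "1 \<le> k" for k
    proof -
      have "AE x in sph. \<bar>residual k s r f x\<bar> = 0"
        using eq[OF that] by eventually_elim (simp add: boolean_sum_jackson)
      then show ?thesis by (rule integral_eq_zero_AE)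
    qed
    then have "eventually (\<lambda>k. (\<integral>x. \<bar>residual k s r f x\<bar> \<partial>sph) = 0) sequentially"
      by (auto simp: eventually_sequentially)
    then have "(\<lambda>k. \<integral>x. \<bar>residual k s r f x\<bar> \<partial>sph) \<in> o(?\<phi>)"
      by (subst landau_o.small.in_cong[where g = "\<lambda>_. 0"]) auto
    then show "f \<in> {f \<in> Lp sph p. \<exists>c. AE x in sph. f x = c}"
      using f constant_if_residual_small[OF n s Lp_sphere_integrable(1)[OF f p]] by simp
  next
    fix f :: "'a \<Rightarrow> real" assume "f \<in> {f \<in> Lp sph p. \<exists>c. AE x in sph. f x = c}"
    then show "f \<in> invariant_class sph p ?T" using inv by (simp add: invariant_class_def)
  qed
qed

theorem theorem4p3:
  fixes r s :: nat and p :: ennreal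
  assumes "CARD('n::finite) \<ge> 3" and "r \<ge> 1" and "s \<ge> 1" and "1 \<le> p"
  shows "saturated (sphere_measure :: (real ^ 'n) measure) p
           (\<lambda>k. boolean_sum r (jackson k s)) (\<lambda>k. 1 / real k ^ (2 * r)) \<and>
         invariant_class (sphere_measure :: (real ^ 'n) measure) p
           (\<lambda>k. boolean_sum r (jackson k s)) =
         {f \<in> Lp sphere_measure p. \<exists>c. AE x in sphere_measure. f x = c}"
  using jackson_saturation[where 'a = "real ^ 'n", OF _ assms(2-4)] assms(1) by simp

end
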